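(* Let $\mathcal H$ be a separable Banach space, $\Psi:\mathcal H\to\mathbb R$ measurable, $\mathcal K$ a Markov transition kernel on $\mathcal H$, $\lambda$ a Radon probability measure on $\mathcal H$, and let $\mathcal P$ be the RCAR-MH kernel built from $(\Psi,\mathcal K,\lambda)$ (see context). Let $q\ge0$. Assume that $\Psi$ satisfies: (1a) for every $R>0$ there is $M_1(R)\ge0$ with $\Psi(u)\le M_1(R)$ for all $u\in B_R(0)$; (1b) there exist $M_2,M_3\ge0$ with $\Psi(u)\ge M_3-M_2\log(1+\|u\|^q)$ for all $u\in\mathcal H$; (1c) for every $\tilde\beta,\tilde b\in(0,1)$ there exist $R_0(\tilde\beta,\tilde b)>0$, $M_4(\tilde\beta,\tilde b)>0$ such that for all $u$ with $\|u\|>R_0$, $\inf_{v\in B_{\tilde b(1-\tilde\beta)\|u\|}(\tilde\beta u)}\exp(\Psi(u)-\Psi(v))\ge M_4$; (1d) there exists $L>0$ with $|\Psi(u)-\Psi(v)|\le L(1\vee\|u\|^q\vee\|v\|^q)\|u-v\|$ for all $u,v\in\mathcal H$. Assume that $\mathcal K$ satisfies, with $\zeta_u\sim\mathcal K(u,\cdot)$: (2a) $\|\zeta_u\|<\|u\|$ a.s. for every $u\neq0$, and $\zeta_0=0$ a.s.; (2b) there exist $0<b_0<\beta_0<1$ and $\epsilon_0>0$ with $\mathbb P[\|\zeta_u-\beta_0u\|\le b_0(1-\beta_0)\|u\|]\ge\epsilon_0$ for all $u\in\mathcal H$; (2c) for all $u,v\in\mathcal H$ there is a coupling $\varpi_{u,v}$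 of $\mathcal K(u,\cdot)$ and $\mathcal K(v,\cdot)$ such that, for $(\zeta_u,\zeta_v)\sim\varpi_{u,v}$, $\|\zeta_u-\zeta_v\|<\|u-v\|$ a.s. if $u\ne v$ (and $\zeta_u=\zeta_v$ a.s. if $u=v$), and there is a uniform constant $\beta_c\in(0,1)$ with $$\sup_{u\neq v}\frac{\int_{\mathcal H\times\mathcal H}\|\zeta_u-\zeta_v\|\,\varpi_{u,v}(d\zeta_u,d\zeta_v)}{\|u-v\|}\le\beta_c.$$ Assume that $\int\|\xi\|^p\lambda(d\xi)<\infty$ for an integer $p\ge1\vee\lceil q\rceil$. Let $V(u)=\sum_{j=0}^pa_j\|u\|^j$ with $a_p>0$ and $a_j\ge0$ for $0\le j<p$, and for $\theta,\omega,\eta>0$ let $$d_q(u,v)=1\wedge\frac{(1+\eta\|u\|+\eta\|v\|)^q\|u-v\|}{\omega},\qquad \tilde d_q(u,v)=\left[d_q(u,v)(2+\theta V(u)+\theta V(v))\right]^{1/2}.$$ Then there exist constants $(\theta,\omega,\eta,n,\gamma)\in(0,\infty)^3\times\mathbb N\times(0,1)$ such that $$\tilde d_q(\mathcal P^n\delta_u,\mathcal P^n\delta_v)\le\gamma\,\tilde d_q(u,v)\qquad\text{for all }u,v\in\mathcal H.$$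
   Context: $B_R(v)$ denotes the closed ball of radius $R$ centered at $v$. Given $(\Psi,\mathcal K,\lambda)$, put $\mathcal Q(u,\cdot):=\mathcal K(u,\cdot)*\lambda$ (the law of $\zeta_u+\xi$ with independent $\zeta_u\sim\mathcal K(u,\cdot)$, $\xi\sim\lambda$) and $\alpha(u,v):=1\wedge\exp(\Psi(u)-\Psi(v))$. The RCAR-MH kernel is $$\mathcal P(u,dv):=\alpha(u,v)\,\mathcal Q(u,dv)+\delta_u(dv)\int_{\mathcal H}(1-\alpha(u,w))\,\mathcal Q(u,dw).$$ $\mathcal P^n\delta_u$ is the law after $n$ steps of the chain started at $u$. For a function $d:\mathcal H\times\mathcal H\to[0,\infty)$ and probability measures $\mu_1,\mu_2$ on $\mathcal H$, $d(\mu_1,\mu_2):=\inf_\pi\int d(u,v)\,\pi(du,dv)$, the infimum being over all couplings $\pi$ of $\mu_1,\mu_2$. *)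

theory Defs
  imports "HOL-Probability.Probability"
begin

text \<open>Power with the convention that the 0-th power is 1 also at 0
  (\<open>0 powr 0 = 0\<close> in the library).\<close>
definition rpow :: "real \<Rightarrow> real \<Rightarrow> real" where
  "rpow x q = (if q = 0 then 1 else x powr q)"

definition radon_prob_measure :: "'a::topological_space measure \<Rightarrow> bool" where
  "radon_prob_measure M \<longleftrightarrow> prob_space M \<and> sets M = sets borel \<and>
     (\<forall>A\<in>sets borel. emeasure M A = (SUP C\<in>{C. C \<subseteq> A \<and> compact C}. emeasure M C))"

definition couplings :: "'a::topological_space measure \<Rightarrow> 'a measure \<Rightarrow> ('a \<times> 'a) measure set" where
  "couplings \<mu> \<nu> = {\<pi>. prob_space \<pi> \<and> sets \<pi> = sets (borel \<Otimes>\<^sub>M borel) \<and>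
     distr \<pi> borel fst = \<mu> \<and> distr \<pi> borel snd = \<nu>}"

definition transport_dist ::
  "('a::topological_space \<Rightarrow> 'a \<Rightarrow> real) \<Rightarrow> 'a measure \<Rightarrow> 'a measure \<Rightarrow> ennreal" where
  "transport_dist d \<mu> \<nu> = (INF \<pi>\<in>couplings \<mu> \<nu>. \<integral>\<^sup>+ z. ennreal (d (fst z) (snd z)) \<partial>\<pi>)"

text \<open>The convolution of \<open>K u\<close> with \<open>lam\<close>; the constant \<open>convolution\<close> of the library
  is restricted to \<open>ordered_euclidean_space\<close>.\<close>
definition rcar_proposal ::
  "('a::real_normed_vector \<Rightarrow> 'a measure) \<Rightarrow> 'a measure \<Rightarrow> 'a \<Rightarrow> 'a measure" where
  "rcar_proposal K lam u = distr (K u \<Otimes>\<^sub>M lam) borel (\<lambda>(z, x). z + x)"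

definition acceptance :: "('a \<Rightarrow> real) \<Rightarrow> 'a \<Rightarrow> 'a \<Rightarrow> real" where
  "acceptance Psi u v = min 1 (exp (Psi u - Psi v))"

definition rcar_mh :: "('a::real_normed_vector \<Rightarrow> real) \<Rightarrow> ('a \<Rightarrow> 'a measure) \<Rightarrow> 'a measure
    \<Rightarrow> 'a \<Rightarrow> 'a measure" where
  "rcar_mh Psi K lam u = measure_of UNIV (sets borel) (\<lambda>A.
     (\<integral>\<^sup>+ v\<in>A. ennreal (acceptance Psi u v) \<partial>rcar_proposal K lam u) +
     emeasure (return borel u) A *
       (\<integral>\<^sup>+ w. ennreal (1 - acceptance Psi u w) \<partial>rcar_proposal K lam u))"

definition kernel_pow :: "('a::topological_space \<Rightarrow> 'a measure) \<Rightarrow> nat \<Rightarrow> 'a measure \<Rightarrow> 'a measure" where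
  "kernel_pow P n \<mu> = ((\<lambda>\<nu>. \<nu> \<bind> P) ^^ n) \<mu>"

definition lyap :: "(nat \<Rightarrow> real) \<Rightarrow> nat \<Rightarrow> 'a::real_normed_vector \<Rightarrow> real" where
  "lyap a p u = (\<Sum>j\<le>p. a j * norm u ^ j)"

definition d_q :: "real \<Rightarrow> real \<Rightarrow> real \<Rightarrow> 'a::real_normed_vector \<Rightarrow> 'a \<Rightarrow> real" where
  "d_q q \<omega> \<eta> u v = min 1 ((1 + \<eta> * norm u + \<eta> * norm v) powr q * norm (u - v) / \<omega>)"

definition d_q_tilde ::
  "real \<Rightarrow> ('a::real_normed_vector \<Rightarrow> real) \<Rightarrow> real \<Rightarrow> real \<Rightarrow> real \<Rightarrow> 'a \<Rightarrow> 'a \<Rightarrow> real" where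
  "d_q_tilde q V \<theta> \<omega> \<eta> u v = sqrt (d_q q \<omega> \<eta> u v * (2 + \<theta> * V u + \<theta> * V v))"

lemma borel_measurable_acceptance [measurable]:
  assumes [measurable]: "Psi \<in> borel_measurable borel"
  shows "(\<lambda>(u, v). acceptance Psi u v) \<in> borel_measurable (borel \<Otimes>\<^sub>M borel)"
  unfolding acceptance_def by measurable

lemma sets_rcar_proposal [simp, measurable_cong]: "sets (rcar_proposal K lam u) = sets borel"
  by (simp add: rcar_proposal_def)

lemma space_rcar_proposal [simp]: "space (rcar_proposal K lam u) = UNIV"
  by (simp add: rcar_proposal_def)

lemma sets_rcar_mh [simp, measurable_cong]: "sets (rcar_mh Psi K lam u) = sets borel"
  unfolding rcar_mh_def
  by (rule sigma_algebra.sets_measure_of_eq) (metis sets.sigma_algebra_axioms space_borel)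

lemma space_rcar_mh [simp]: "space (rcar_mh Psi K lam u) = UNIV"
  using sets_eq_imp_space_eq[OF sets_rcar_mh] by simp

lemma rcar_proposal_measurable:
  fixes K :: "'a::{banach, second_countable_topology} \<Rightarrow> 'a measure"
  assumes K [measurable]: "K \<in> borel \<rightarrow>\<^sub>M prob_algebra borel"
    and lam: "prob_space lam" "sets lam = sets borel"
  shows "rcar_proposal K lam \<in> borel \<rightarrow>\<^sub>M prob_algebra borel"
proof -
  have [measurable]: "lam \<in> space (prob_algebra borel)"
    using lam by (simp add: space_prob_algebra)
  have [measurable]: "(\<lambda>u. K u \<Otimes>\<^sub>M lam) \<in> borel \<rightarrow>\<^sub>M prob_algebra (borel \<Otimes>\<^sub>M borel)"
    by (intro measurable_pair_prob K) simp
  have "(\<lambda>u. distr (K u \<Otimes>\<^sub>M lam) borel (\<lambda>(z, x). z + x)) \<in> borel \<rightarrow>\<^sub>M prob_algebra borel"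
    by (rule measurable_distr_prob_space2[where M="borel \<Otimes>\<^sub>M borel"]) measurable
  then show ?thesis by (simp add: rcar_proposal_def[abs_def])
qed

lemma emeasure_rcar_mh:
  assumes [measurable]: "Psi \<in> borel_measurable borel" and A: "A \<in> sets borel"
  shows "emeasure (rcar_mh Psi K lam u) A =
     (\<integral>\<^sup>+ v\<in>A. ennreal (acceptance Psi u v) \<partial>rcar_proposal K lam u) +
     emeasure (return borel u) A *
       (\<integral>\<^sup>+ w. ennreal (1 - acceptance Psi u w) \<partial>rcar_proposal K lam u)"
proof -
  let ?c = "\<integral>\<^sup>+ w. ennreal (1 - acceptance Psi u w) \<partial>rcar_proposal K lam u"
  let ?D = "density (rcar_proposal K lam u) (\<lambda>v. ennreal (acceptance Psi u v))"
  have [measurable]: "(\<lambda>v. ennreal (acceptance Psi u v)) \<in> borel_measurable borel"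
    unfolding acceptance_def by measurable
  have D: "(\<integral>\<^sup>+ v\<in>B. ennreal (acceptance Psi u v) \<partial>rcar_proposal K lam u) = emeasure ?D B"
    if "B \<in> sets borel" for B
    using that by (subst emeasure_density) auto
  have ca: "countably_additive (sets borel) (\<lambda>A.
     (\<integral>\<^sup>+ v\<in>A. ennreal (acceptance Psi u v) \<partial>rcar_proposal K lam u) +
     emeasure (return borel u) A * ?c)"
  proof (rule countably_additiveI)
    fix B :: "nat \<Rightarrow> 'a set"
    assume B: "range B \<subseteq> sets borel" "disjoint_family B" "(\<Union>i. B i) \<in> sets borel"
    have Bi: "B i \<in> sets borel" for i using B(1) by auto
    have 1: "(\<Sum>i. emeasure ?D (B i)) = emeasure ?D (\<Union>i. B i)"
      by (rule suminf_emeasure) (use B in auto)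
    have 2: "(\<Sum>i. emeasure (return borel u) (B i)) = emeasure (return borel u) (\<Union>i. B i)"
      by (rule suminf_emeasure) (use B in auto)
    show "(\<Sum>i. (\<integral>\<^sup>+ v\<in>B i. ennreal (acceptance Psi u v) \<partial>rcar_proposal K lam u) +
        emeasure (return borel u) (B i) * ?c) =
      (\<integral>\<^sup>+ v\<in>(\<Union>i. B i). ennreal (acceptance Psi u v) \<partial>rcar_proposal K lam u) +
        emeasure (return borel u) (\<Union>i. B i) * ?c"
      by (simp only: D[OF Bi] D[OF B(3)] suminf_add[symmetric] summableI 1 2 ennreal_suminf_multc)
  qed
  have s: "sets (rcar_mh Psi K lam u) = sets borel" by (rule sets_rcar_mh)
  show ?thesis
  proof (rule emeasure_measure_of[OF rcar_mh_def])
    show "sets (borel :: 'a measure) \<subseteq> Pow UNIV" by simp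
    show "A \<in> sets (rcar_mh Psi K lam u)" using A unfolding s .
    show "positive (sets (rcar_mh Psi K lam u)) (\<lambda>A.
     (\<integral>\<^sup>+ v\<in>A. ennreal (acceptance Psi u v) \<partial>rcar_proposal K lam u) +
     emeasure (return borel u) A * ?c)"
      unfolding positive_def by simp
    show "countably_additive (sets (rcar_mh Psi K lam u)) (\<lambda>A.
     (\<integral>\<^sup>+ v\<in>A. ennreal (acceptance Psi u v) \<partial>rcar_proposal K lam u) +
     emeasure (return borel u) A * ?c)"
      unfolding s by (rule ca)
  qed
qed

lemma rcar_mh_measurable:
  fixes K :: "'a::{banach, second_countable_topology} \<Rightarrow> 'a measure"
  assumes Psi [measurable]: "Psi \<in> borel_measurable borel"
    and K: "K \<in> borel \<rightarrow>\<^sub>M prob_algebra borel"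
    and lam: "prob_space lam" "sets lam = sets borel"
  shows "rcar_mh Psi K lam \<in> borel \<rightarrow>\<^sub>M prob_algebra borel"
proof (rule measurable_prob_algebraI)
  note Q = rcar_proposal_measurable[OF K lam]
  have Qs [measurable]: "rcar_proposal K lam \<in> borel \<rightarrow>\<^sub>M subprob_algebra borel"
    by (rule measurable_prob_algebraD[OF Q])
  show P: "prob_space (rcar_mh Psi K lam u)" for u
  proof
    interpret Q: prob_space "rcar_proposal K lam u"
      using measurable_space[OF Q, of u] by (simp add: space_prob_algebra)
    have [measurable]: "acceptance Psi u \<in> borel_measurable borel"
      unfolding acceptance_def by measurable
    have le: "0 \<le> acceptance Psi u v" "acceptance Psi u v \<le> 1" for v
      by (auto simp: acceptance_def)
    have "emeasure (rcar_mh Psi K lam u) UNIV =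
      (\<integral>\<^sup>+ v. ennreal (acceptance Psi u v) + ennreal (1 - acceptance Psi u v) \<partial>rcar_proposal K lam u)"
      by (subst emeasure_rcar_mh[OF Psi]) (auto simp: nn_integral_add)
    also have "\<dots> = (\<integral>\<^sup>+ v. 1 \<partial>rcar_proposal K lam u)"
      by (intro nn_integral_cong) (use le in \<open>simp flip: ennreal_plus\<close>)
    also have "\<dots> = 1" using Q.emeasure_space_1 by simp
    finally show "emeasure (rcar_mh Psi K lam u) (space (rcar_mh Psi K lam u)) = 1" by simp
  qed
  show "rcar_mh Psi K lam \<in> borel \<rightarrow>\<^sub>M subprob_algebra borel"
  proof (rule measurable_subprob_algebra)
    fix A :: "'a set" assume [measurable]: "A \<in> sets borel"
    have "(\<lambda>u. (\<integral>\<^sup>+ v\<in>A. ennreal (acceptance Psi u v) \<partial>rcar_proposal K lam u) +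
     emeasure (return borel u) A *
       (\<integral>\<^sup>+ w. ennreal (1 - acceptance Psi u w) \<partial>rcar_proposal K lam u)) \<in> borel_measurable borel"
    proof (intro borel_measurable_add borel_measurable_times_ennreal)
      show "(\<lambda>u. \<integral>\<^sup>+ v\<in>A. ennreal (acceptance Psi u v) \<partial>rcar_proposal K lam u) \<in> borel_measurable borel"
        by (rule nn_integral_measurable_subprob_algebra2[OF _ Qs], unfold acceptance_def) measurable
      show "(\<lambda>u. \<integral>\<^sup>+ w. ennreal (1 - acceptance Psi u w) \<partial>rcar_proposal K lam u) \<in> borel_measurable borel"
        by (rule nn_integral_measurable_subprob_algebra2[OF _ Qs], unfold acceptance_def) measurable
      show "(\<lambda>u. emeasure (return borel u) A) \<in> borel_measurable borel"
        by simp
    qed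
    then show "(\<lambda>u. emeasure (rcar_mh Psi K lam u) A) \<in> borel_measurable borel"
      by (simp add: emeasure_rcar_mh)
  qed (use P in \<open>auto intro: prob_space_imp_subprob_space\<close>)
qed

end

theory Submission
  imports Defs
begin

text \<open>
  Write \<open>P\<close> for the RCAR-MH kernel, \<open>D\<close> for \<open>d_q q \<omega> \<eta>\<close> and \<open>V\<close> for \<open>lyap a p\<close>. The cost \<open>d_q_tilde\<close>
  is the square root of \<open>D u v * (2 + \<theta> * V u + \<theta> * V v)\<close>, so by Cauchy-Schwarz its transport cost is
  at most the geometric mean of the transport cost of \<open>D\<close> and of \<open>2\<close> plus the means of \<open>\<theta> * V\<close>. This
  reduces the theorem to three properties of \<open>P\<close> (lemma \<open>weak_harris\<close>): one step contracts \<open>D\<close> for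
  pairs with \<open>D < 1\<close> (\<open>contraction\<close>), \<open>V\<close> decreases on average far from the origin (\<open>drift\<close>), and
  on every ball the laws after some number of steps have \<open>D\<close>-cost uniformly below 1 (\<open>small_set\<close>).

  For the contraction, the two chains use the given coupling of the kernels \<open>K\<close>, the same noise,
  and acceptance decisions that agree as often as possible. If both accept near the origin, the
  acceptance probability is bounded below and the mean contraction of the coupling applies. Far
  away, the acceptance probability is controlled only on the ball around \<open>\<beta>0 *\<^sub>R u\<close>, where the pair
  need not come closer; what decreases there is the weight \<open>(1 + \<eta> * norm u + \<eta> * norm v) powr q\<close>,
  and for large \<open>norm u\<close> this outweighs the growth of the weight that the noise causes. Differing
  decisions cost at most a multiple of \<open>\<omega> * D\<close>, because the weight of \<open>D\<close> grows like the local
  Lipschitz constant of \<open>Psi\<close>. The constants are therefore chosen in the order: radius, \<open>\<eta>\<close>, \<open>\<omega>\<close>,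
  number of steps, \<open>\<theta>\<close>.

  For the small set, the chain that accepts every proposal and uses only bounded noise forgets its
  starting point in the Wasserstein distance, and on bounded sets \<open>P\<close> dominates a multiple of it.

  The coupling of \<open>K u\<close> and \<open>K v\<close> is given pair by pair and need not depend measurably on the pair, so
  couplings of successive steps cannot be glued directly. Lemma \<open>transport_dist_bind_le\<close> gets around
  this: every coupling is approximated by one whose density with respect to the product measure is
  constant on the blocks of a countable partition and has rational values
  (\<open>block_density_exists\<close>). There are only countably many such densities, hence a nearly optimal one
  can be selected measurably.

  For \<open>q = 0\<close> there is no weight to decrease, and one step may even expand \<open>D\<close> by a factor
  \<open>1 + O(\<omega>)\<close> far from the origin. The hypotheses for \<open>q = 0\<close> imply those for \<open>q = 1\<close>, and iterating the
  result for \<open>q = 1\<close> gives a factor \<open>\<gamma> ^ k\<close>. It pays for the passage from the cost with \<open>q = 1\<close> back to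
  the one with \<open>q = 0\<close> as long as \<open>1 + \<eta> * (norm u + norm v)\<close> is at most \<open>1 / \<gamma> ^ k\<close>; for all other
  pairs \<open>V\<close> is so large that its own decrease suffices (\<open>d_q_tilde_contraction_zero\<close>).
\<close>

section \<open>Sub-couplings\<close>

definition add_measure :: "'a measure \<Rightarrow> 'a measure \<Rightarrow> 'a measure" where
  "add_measure M N = measure_of (space M) (sets M) (\<lambda>A. emeasure M A + emeasure N A)"

lemma sets_add_measure [simp, measurable_cong]: "sets (add_measure M N) = sets M"
  by (simp add: add_measure_def)

lemma space_add_measure [simp]: "space (add_measure M N) = space M"
  by (simp add: add_measure_def)

lemma emeasure_add_measure:
  assumes N: "sets N = sets M" and A: "A \<in> sets M"
  shows "emeasure (add_measure M N) A = emeasure M A + emeasure N A"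
proof (rule emeasure_measure_of[OF add_measure_def])
  show "sets M \<subseteq> Pow (space M)" by (rule sets.space_closed)
  show "positive (sets (add_measure M N)) (\<lambda>A. emeasure M A + emeasure N A)"
    by (simp add: positive_def)
  show "A \<in> sets (add_measure M N)" using A by simp
  show "countably_additive (sets (add_measure M N)) (\<lambda>A. emeasure M A + emeasure N A)"
  proof (rule countably_additiveI)
    fix B :: "nat \<Rightarrow> 'a set"
    assume B: "range B \<subseteq> sets (add_measure M N)" "disjoint_family B"
    have 1: "(\<Sum>i. emeasure M (B i)) = emeasure M (\<Union>i. B i)"
      by (rule suminf_emeasure) (use B in auto)
    have 2: "(\<Sum>i. emeasure N (B i)) = emeasure N (\<Union>i. B i)"
      by (rule suminf_emeasure) (use B N in auto)
    show "(\<Sum>i. emeasure M (B i) + emeasure N (B i)) = emeasure M (\<Union>i. B i) + emeasure N (\<Union>i. B i)"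
      by (simp only: 1[symmetric] 2[symmetric] suminf_add[symmetric] summableI)
  qed
qed

lemma nn_integral_add_measure:
  assumes N: "sets N = sets M" and f: "f \<in> borel_measurable M"
  shows "(\<integral>\<^sup>+ x. f x \<partial>add_measure M N) = (\<integral>\<^sup>+ x. f x \<partial>M) + (\<integral>\<^sup>+ x. f x \<partial>N)"
  using f
proof induct
  note [measurable_cong] = N
  note sp = sets_eq_imp_space_eq[OF N]
  {
    case (cong f g)
    then show ?case
      by (metis (mono_tags, lifting) nn_integral_cong sp space_add_measure)
  next
    case (set A)
    then show ?case using N by (simp add: emeasure_add_measure)
  next
    case (mult u c)
    then have [measurable]: "u \<in> borel_measurable M" by simp
    show ?case using mult by (simp add: nn_integral_cmult distrib_left)
  next
    case (add u v)
    then have [measurable]: "u \<in> borel_measurable M" "v \<in> borel_measurable M" by simp_all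
    show ?case using add by (simp add: nn_integral_add algebra_simps)
  next
    case (seq U)
    then have [measurable]: "U i \<in> borel_measurable M" for i by simp
    have "(\<integral>\<^sup>+ x. (SUP i. U i x) \<partial>add_measure M N) = (SUP i. integral\<^sup>N (add_measure M N) (U i))"
      by (intro nn_integral_monotone_convergence_SUP seq) simp
    also have "\<dots> = (SUP i. integral\<^sup>N M (U i) + integral\<^sup>N N (U i))"
      using seq by simp
    also have "\<dots> = (SUP i. integral\<^sup>N M (U i)) + (SUP i. integral\<^sup>N N (U i))"
      by (intro ennreal_SUP_add incseq_nn_integral seq)
    also have "(SUP i. integral\<^sup>N M (U i)) = (\<integral>\<^sup>+ x. (SUP i. U i x) \<partial>M)"
      by (intro nn_integral_monotone_convergence_SUP[symmetric] seq)
    also have "(SUP i. integral\<^sup>N N (U i)) = (\<integral>\<^sup>+ x. (SUP i. U i x) \<partial>N)"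
      by (intro nn_integral_monotone_convergence_SUP[symmetric] seq) measurable
    finally show ?case by (simp add: SUP_apply image_comp)
  }
qed

text \<open>A sub-coupling is completed to a coupling by the normalised product of the two remainders of the
marginals; the completion costs at most the integrals of \<open>f\<close> over these remainders. The term
\<open>f x + f y - c x y\<close> stands on the left so that no difference of possibly infinite integrals occurs.\<close>

lemma transport_dist_add_subcoupling_le:
  fixes \<mu> \<nu> :: "'a::second_countable_topology measure"
  assumes "prob_space \<mu>" "prob_space \<nu>"
    and \<mu> [measurable_cong]: "sets \<mu> = sets borel" and \<nu> [measurable_cong]: "sets \<nu> = sets borel"
    and \<sigma> [measurable_cong]: "sets \<sigma> = sets (borel \<Otimes>\<^sub>M borel)"
    and fst: "\<And>A. A \<in> sets borel \<Longrightarrow> emeasure \<sigma> (A \<times> UNIV) \<le> emeasure \<mu> A"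
    and snd: "\<And>A. A \<in> sets borel \<Longrightarrow> emeasure \<sigma> (UNIV \<times> A) \<le> emeasure \<nu> A"
    and c [measurable]: "(\<lambda>z. c (fst z) (snd z)) \<in> borel_measurable (borel \<Otimes>\<^sub>M borel)"
    and f [measurable]: "f \<in> borel_measurable borel"
    and c_nonneg: "\<And>x y. 0 \<le> c x y" and c_le: "\<And>x y. c x y \<le> f x + f y" and f_nonneg: "\<And>x. 0 \<le> f x"
  shows "transport_dist c \<mu> \<nu> + (\<integral>\<^sup>+ z. ennreal (f (fst z) + f (snd z) - c (fst z) (snd z)) \<partial>\<sigma>)
    \<le> (\<integral>\<^sup>+ x. ennreal (f x) \<partial>\<mu>) + (\<integral>\<^sup>+ x. ennreal (f x) \<partial>\<nu>)"
proof -
  interpret \<mu>: prob_space \<mu> by fact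
  interpret \<nu>: prob_space \<nu> by fact
  have spaces [simp]: "space \<mu> = UNIV" "space \<nu> = UNIV" "space \<sigma> = UNIV"
    using \<mu> \<nu> \<sigma> by (auto dest!: sets_eq_imp_space_eq simp: space_pair_measure)
  define \<sigma>1 where "\<sigma>1 = distr \<sigma> borel fst"
  define \<sigma>2 where "\<sigma>2 = distr \<sigma> borel snd"
  have s12 [simp, measurable_cong]: "sets \<sigma>1 = sets borel" "sets \<sigma>2 = sets borel" and
    [simp]: "space \<sigma>1 = UNIV" "space \<sigma>2 = UNIV"
    by (auto simp: \<sigma>1_def \<sigma>2_def)
  have e1: "emeasure \<sigma>1 A = emeasure \<sigma> (A \<times> UNIV)" if "A \<in> sets borel" for A
    unfolding \<sigma>1_def using that by (subst emeasure_distr) (auto intro!: arg_cong[where f="emeasure \<sigma>"])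
  have e2: "emeasure \<sigma>2 A = emeasure \<sigma> (UNIV \<times> A)" if "A \<in> sets borel" for A
    unfolding \<sigma>2_def using that by (subst emeasure_distr) (auto intro!: arg_cong[where f="emeasure \<sigma>"])
  have U: "emeasure \<mu> UNIV = 1" "emeasure \<nu> UNIV = 1"
    using \<mu>.emeasure_space_1 \<nu>.emeasure_space_1 by auto
  have "emeasure \<sigma> UNIV \<le> 1" using fst[of UNIV] U by simp
  then interpret \<sigma>: finite_measure \<sigma>
    by (intro finite_measureI) (auto simp: top_unique)
  have fin1: "finite_measure \<sigma>1" unfolding \<sigma>1_def by (rule \<sigma>.finite_measure_distr) simp
  have fin2: "finite_measure \<sigma>2" unfolding \<sigma>2_def by (rule \<sigma>.finite_measure_distr) simp
  define \<mu>' where "\<mu>' = diff_measure \<mu> \<sigma>1"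
  define \<nu>' where "\<nu>' = diff_measure \<nu> \<sigma>2"
  have [simp]: "sets \<mu>' = sets borel" "sets \<nu>' = sets borel" "space \<mu>' = UNIV" "space \<nu>' = UNIV"
    using \<mu> \<nu> by (auto simp: \<mu>'_def \<nu>'_def)
  note [measurable_cong] = \<open>sets \<mu>' = sets borel\<close> \<open>sets \<nu>' = sets borel\<close>
  have m1: "emeasure \<mu>' A = emeasure \<mu> A - emeasure \<sigma>1 A" if "A \<in> sets borel" for A
    unfolding \<mu>'_def using that fst fin1
    by (intro emeasure_diff_measure \<mu>.finite_measure_axioms) (auto simp: \<mu> e1)
  have m2: "emeasure \<nu>' A = emeasure \<nu> A - emeasure \<sigma>2 A" if "A \<in> sets borel" for A
    unfolding \<nu>'_def using that snd fin2
    by (intro emeasure_diff_measure \<nu>.finite_measure_axioms) (auto simp: \<nu> e2)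
  have d1: "emeasure \<mu>' A + emeasure \<sigma>1 A = emeasure \<mu> A" if "A \<in> sets borel" for A
    using fst[OF that] m1[OF that] e1[OF that] by (simp add: diff_add_cancel_ennreal)
  have d2: "emeasure \<nu>' A + emeasure \<sigma>2 A = emeasure \<nu> A" if "A \<in> sets borel" for A
    using snd[OF that] m2[OF that] e2[OF that] by (simp add: diff_add_cancel_ennreal)
  have dec1: "\<mu> = add_measure \<mu>' \<sigma>1"
    by (rule measure_eqI) (auto simp: emeasure_add_measure d1 \<mu>)
  have dec2: "\<nu> = add_measure \<nu>' \<sigma>2"
    by (rule measure_eqI) (auto simp: emeasure_add_measure d2 \<nu>)
  define t where "t = emeasure \<mu>' UNIV"
  have t2: "emeasure \<nu>' UNIV = t"
    unfolding t_def by (simp add: m1 m2 U e1 e2)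
  have t_fin: "t \<noteq> \<infinity>" "t < \<infinity>" unfolding t_def using m1[of UNIV] U by (auto simp: top_unique less_top[symmetric])
  interpret \<mu>': finite_measure \<mu>' using t_fin by (intro finite_measureI) (simp add: t_def)
  interpret \<nu>': finite_measure \<nu>' using t_fin t2 by (intro finite_measureI) simp
  interpret pair_sigma_finite \<mu>' \<nu>' ..
  \<comment> \<open>If t = 0 then both remainders vanish, so the value of inverse t does not matter there.\<close>
  have inv: "inverse t * (x * t) = x" if "x \<le> t" for x
  proof (cases "t = 0")
    case False
    then have "inverse t * t = 1"
      using t_fin by (simp add: mult.commute ennreal_divide_self divide_ennreal_def[symmetric])
    then show ?thesis by (metis mult.assoc mult.commute mult_1)
  qed (use that in simp)
  define \<pi> where "\<pi> = add_measure \<sigma> (scale_measure (inverse t) (\<mu>' \<Otimes>\<^sub>M \<nu>'))"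
  have sp: "sets (\<mu>' \<Otimes>\<^sub>M \<nu>') = sets (borel \<Otimes>\<^sub>M borel)" by (intro sets_pair_measure_cong) auto
  have s\<pi> [measurable_cong]: "sets \<pi> = sets (borel \<Otimes>\<^sub>M borel)"
    unfolding \<pi>_def by (simp add: \<sigma>)
  have e\<pi>: "emeasure \<pi> A = emeasure \<sigma> A + inverse t * emeasure (\<mu>' \<Otimes>\<^sub>M \<nu>') A"
    if "A \<in> sets (borel \<Otimes>\<^sub>M borel)" for A
    unfolding \<pi>_def using that by (subst emeasure_add_measure) (auto simp: \<sigma> sp)
  have le1: "emeasure \<mu>' A \<le> t" and le2: "emeasure \<nu>' A \<le> t" for A
    unfolding t2[symmetric] unfolding t_def
    using emeasure_space[of \<mu>' A] emeasure_space[of \<nu>' A] t2 t_def by auto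
  have p1: "emeasure \<pi> (A \<times> UNIV) = emeasure \<mu> A" if "A \<in> sets borel" for A
    using that by (simp add: e\<pi> \<nu>'.emeasure_pair_measure_Times t2 inv le1 d1[symmetric] e1 add.commute)
  have p2: "emeasure \<pi> (UNIV \<times> A) = emeasure \<nu> A" if "A \<in> sets borel" for A
    using that inv[OF le2, of A] by (simp add: e\<pi> \<nu>'.emeasure_pair_measure_Times t_def[symmetric]
      d2[symmetric] e2 add.commute mult.commute)
  have space\<pi>: "space \<pi> = UNIV" using sets_eq_imp_space_eq[OF s\<pi>] by (simp add: space_pair_measure)
  have coupling: "\<pi> \<in> couplings \<mu> \<nu>"
  proof -
    have "distr \<pi> borel fst = \<mu>"
    proof (rule measure_eqI)
      fix A assume "A \<in> sets (distr \<pi> borel fst)"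
      then show "emeasure (distr \<pi> borel fst) A = emeasure \<mu> A"
        by (subst emeasure_distr) (auto simp: p1[symmetric] space\<pi> intro!: arg_cong[where f="emeasure \<pi>"])
    qed (simp add: \<mu>)
    moreover have "distr \<pi> borel snd = \<nu>"
    proof (rule measure_eqI)
      fix A assume "A \<in> sets (distr \<pi> borel snd)"
      then show "emeasure (distr \<pi> borel snd) A = emeasure \<nu> A"
        by (subst emeasure_distr) (auto simp: p2[symmetric] space\<pi> intro!: arg_cong[where f="emeasure \<pi>"])
    qed (simp add: \<nu>)
    moreover have "prob_space \<pi>"
      using p1[of UNIV] U by (intro prob_spaceI) (simp add: space\<pi>)
    ultimately show ?thesis by (simp add: couplings_def s\<pi>)
  qed
  have meas: "(\<lambda>z. ennreal (c (fst z) (snd z))) \<in> borel_measurable \<sigma>" by measurable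
  have rest: "(\<integral>\<^sup>+ z. ennreal (c (fst z) (snd z)) \<partial>scale_measure (inverse t) (\<mu>' \<Otimes>\<^sub>M \<nu>'))
      \<le> (\<integral>\<^sup>+ x. ennreal (f x) \<partial>\<mu>') + (\<integral>\<^sup>+ x. ennreal (f x) \<partial>\<nu>')"
  proof -
    have "(\<integral>\<^sup>+ z. ennreal (c (fst z) (snd z)) \<partial>scale_measure (inverse t) (\<mu>' \<Otimes>\<^sub>M \<nu>'))
      = inverse t * (\<integral>\<^sup>+ z. ennreal (c (fst z) (snd z)) \<partial>(\<mu>' \<Otimes>\<^sub>M \<nu>'))"
      by (rule nn_integral_scale_measure) measurable
    also have "\<dots> \<le> inverse t * (\<integral>\<^sup>+ z. ennreal (f (fst z)) + ennreal (f (snd z)) \<partial>(\<mu>' \<Otimes>\<^sub>M \<nu>'))"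
      using c_le by (intro mult_left_mono nn_integral_mono) (auto simp: f_nonneg simp flip: ennreal_plus intro: ennreal_leI)
    also have "(\<integral>\<^sup>+ z. ennreal (f (fst z)) + ennreal (f (snd z)) \<partial>(\<mu>' \<Otimes>\<^sub>M \<nu>'))
      = (\<integral>\<^sup>+ x. ennreal (f x) \<partial>\<mu>') * t + t * (\<integral>\<^sup>+ x. ennreal (f x) \<partial>\<nu>')"
      by (subst nn_integral_add) (auto simp: \<nu>'.nn_integral_fst[symmetric] nn_integral_add t2 nn_integral_cmult nn_integral_multc t_def[symmetric] mult.commute)
    also have "inverse t * \<dots> \<le> (\<integral>\<^sup>+ x. ennreal (f x) \<partial>\<mu>') + (\<integral>\<^sup>+ x. ennreal (f x) \<partial>\<nu>')"
    proof -
      have "inverse t * t \<le> 1"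
        using t_fin by (cases "t = 0") (auto simp: mult.commute ennreal_divide_self divide_ennreal_def[symmetric])
      then have "(inverse t * t) * X \<le> X" for X
        using mult_right_mono[of "inverse t * t" 1 X] by simp
      then have "(inverse t * t) * X + (inverse t * t) * Y \<le> X + Y" for X Y
        by (intro add_mono)
      from this[of "\<integral>\<^sup>+ x. ennreal (f x) \<partial>\<mu>'" "\<integral>\<^sup>+ x. ennreal (f x) \<partial>\<nu>'"]
      show ?thesis by (simp add: distrib_left ac_simps)
    qed
    finally show ?thesis .
  qed
  have "transport_dist c \<mu> \<nu> \<le> (\<integral>\<^sup>+ z. ennreal (c (fst z) (snd z)) \<partial>\<pi>)"
    unfolding transport_dist_def by (rule INF_lower[OF coupling])
  also have "\<dots> = (\<integral>\<^sup>+ z. ennreal (c (fst z) (snd z)) \<partial>\<sigma>)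
      + (\<integral>\<^sup>+ z. ennreal (c (fst z) (snd z)) \<partial>scale_measure (inverse t) (\<mu>' \<Otimes>\<^sub>M \<nu>'))"
    unfolding \<pi>_def by (rule nn_integral_add_measure) (auto simp: \<sigma> sp)
  also have "\<dots> \<le> (\<integral>\<^sup>+ z. ennreal (c (fst z) (snd z)) \<partial>\<sigma>)
      + ((\<integral>\<^sup>+ x. ennreal (f x) \<partial>\<mu>') + (\<integral>\<^sup>+ x. ennreal (f x) \<partial>\<nu>'))"
    by (rule add_left_mono[OF rest])
  finally have "transport_dist c \<mu> \<nu> + (\<integral>\<^sup>+ z. ennreal (f (fst z) + f (snd z) - c (fst z) (snd z)) \<partial>\<sigma>)
    \<le> ((\<integral>\<^sup>+ z. ennreal (c (fst z) (snd z)) \<partial>\<sigma>) + (\<integral>\<^sup>+ z. ennreal (f (fst z) + f (snd z) - c (fst z) (snd z)) \<partial>\<sigma>))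
     + ((\<integral>\<^sup>+ x. ennreal (f x) \<partial>\<mu>') + (\<integral>\<^sup>+ x. ennreal (f x) \<partial>\<nu>'))"
    by (simp add: add_right_mono add.assoc add.commute add.left_commute)
  also have "(\<integral>\<^sup>+ z. ennreal (c (fst z) (snd z)) \<partial>\<sigma>) + (\<integral>\<^sup>+ z. ennreal (f (fst z) + f (snd z) - c (fst z) (snd z)) \<partial>\<sigma>)
     = (\<integral>\<^sup>+ z. ennreal (f (fst z)) + ennreal (f (snd z)) \<partial>\<sigma>)"
    using c_le c_nonneg f_nonneg
    by (subst nn_integral_add[symmetric]) (auto intro!: nn_integral_cong simp flip: ennreal_plus)
  also have "\<dots> = (\<integral>\<^sup>+ x. ennreal (f x) \<partial>\<sigma>1) + (\<integral>\<^sup>+ x. ennreal (f x) \<partial>\<sigma>2)"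
    unfolding \<sigma>1_def \<sigma>2_def by (simp add: nn_integral_add nn_integral_distr)
  also have "(\<integral>\<^sup>+ x. ennreal (f x) \<partial>\<sigma>1) + (\<integral>\<^sup>+ x. ennreal (f x) \<partial>\<sigma>2) + ((\<integral>\<^sup>+ x. ennreal (f x) \<partial>\<mu>') + (\<integral>\<^sup>+ x. ennreal (f x) \<partial>\<nu>'))
    = (\<integral>\<^sup>+ x. ennreal (f x) \<partial>\<mu>) + (\<integral>\<^sup>+ x. ennreal (f x) \<partial>\<nu>)"
    unfolding dec1 dec2 by (subst (1 2) nn_integral_add_measure) (auto simp: ac_simps)
  finally show ?thesis .
qed

section \<open>Block approximation of couplings\<close>

text \<open>The cell of a point is the index of the first term of a dense sequence that is close to it.\<close>

lemma fine_cells_exist: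
  obtains cell :: "nat \<Rightarrow> 'a::{metric_space, second_countable_topology} \<Rightarrow> nat"
  where "\<And>n. cell n \<in> borel \<rightarrow>\<^sub>M count_space UNIV"
    and "\<And>n x y. cell n x = cell n y \<Longrightarrow> dist x y < 1 / Suc n"
proof -
  obtain D :: "'a set" where D: "countable D" "\<And>X. open X \<Longrightarrow> X \<noteq> {} \<Longrightarrow> \<exists>d\<in>D. d \<in> X"
    using countable_dense_setE by metis
  define near where "near n k x \<longleftrightarrow> dist (from_nat_into D k) x < 1 / (2 * Suc n)" for n k x
  define cell where "cell n x = (LEAST k. near n k x)" for n x
  have near_cell: "near n (cell n x) x" for n x
  proof -
    obtain d where "d \<in> D" "d \<in> ball x (1 / (2 * Suc n))"
      using D(2)[of "ball x (1 / (2 * Suc n))"] by auto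
    then have "near n (to_nat_on D d) x"
      using D(1) by (simp add: near_def dist_commute)
    then show ?thesis unfolding cell_def by (rule LeastI)
  qed
  show thesis
  proof (rule that[of cell])
    show "cell n \<in> borel \<rightarrow>\<^sub>M count_space UNIV" for n
      unfolding cell_def near_def by measurable
    fix n x y assume "cell n x = cell n y"
    then have "near n (cell n x) x" "near n (cell n x) y"
      using near_cell[of n x] near_cell[of n y] by auto
    then have "dist x y < 1 / (2 * Suc n) + 1 / (2 * Suc n)"
      unfolding near_def using dist_triangle3[of x y "from_nat_into D (cell n x)"] by linarith
    then show "dist x y < 1 / Suc n" by (simp add: field_simps)
  qed
qed

text \<open>A matrix with finitely many nonzero entries, coded as a list of rows so that all such matrices form
a countable type.\<close>

definition rat_matrix :: "rat list list \<Rightarrow> nat \<Rightarrow> nat \<Rightarrow> ennreal" where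
  "rat_matrix M k l = (if k < length M \<and> l < length (M ! k) then ennreal (of_rat (M ! k ! l)) else 0)"

text \<open>Replacing a coupling within each block of a fine partition by the product of the conditioned
marginals keeps the block masses \<open>r k l\<close> and yields the density \<open>r k l / (P k * Q l)\<close> with respect to
the product measure. The infimum of \<open>w\<close> over the block of a point tends to the value of \<open>w\<close> as the mesh shrinks,
so Fatou's lemma bounds the loss in the integral of \<open>w\<close>. Keeping finitely many blocks and rounding the
densities down to rational numbers loses again arbitrarily little, and both only decrease the
marginals.\<close>

lemma block_density_exists:
  fixes cell :: "nat \<Rightarrow> 'a::{metric_space, second_countable_topology} \<Rightarrow> nat"
    and \<mu> \<nu> :: "'a measure" and w :: "'a \<times> 'a \<Rightarrow> real"
  assumes cell [measurable]: "\<And>n. cell n \<in> borel \<rightarrow>\<^sub>M count_space UNIV"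
    and fine: "\<And>n x y. cell n x = cell n y \<Longrightarrow> dist x y < 1 / Suc n"
    and prob: "prob_space \<mu>" "prob_space \<nu>"
    and coupling: "\<rho> \<in> couplings \<mu> \<nu>"
    and cont: "continuous_on UNIV w"
    and less: "b < (\<integral>\<^sup>+ z. ennreal (w z) \<partial>\<rho>)"
  shows "\<exists>n M. (\<forall>k. (\<integral>\<^sup>+ t. rat_matrix M k (cell n t) \<partial>\<nu>) \<le> 1) \<and>
    (\<forall>l. (\<integral>\<^sup>+ s. rat_matrix M (cell n s) l \<partial>\<mu>) \<le> 1) \<and>
    b < (\<integral>\<^sup>+ z. ennreal (w z) * rat_matrix M (cell n (fst z)) (cell n (snd z)) \<partial>(\<mu> \<Otimes>\<^sub>M \<nu>))"
proof -
  interpret \<mu>: prob_space \<mu> by fact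
  interpret \<nu>: prob_space \<nu> by fact
  interpret pair_prob_space \<mu> \<nu> ..
  interpret \<rho>: prob_space \<rho> using coupling by (simp add: couplings_def)
  have s\<rho> [measurable_cong]: "sets \<rho> = sets (borel \<Otimes>\<^sub>M borel)"
    and d1: "distr \<rho> borel fst = \<mu>" and d2: "distr \<rho> borel snd = \<nu>"
    using coupling by (auto simp: couplings_def)
  have s\<mu> [measurable_cong]: "sets \<mu> = sets borel" and s\<nu> [measurable_cong]: "sets \<nu> = sets borel"
    using d1 d2 by (metis sets_distr)+
  have [simp]: "space \<mu> = UNIV" "space \<nu> = UNIV" "space \<rho> = UNIV"
    using s\<mu> s\<nu> s\<rho> by (auto dest!: sets_eq_imp_space_eq simp: space_pair_measure)
  have [measurable]: "w \<in> borel_measurable (borel \<Otimes>\<^sub>M borel)"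
    using cont by (simp add: borel_prod borel_measurable_continuous_onI)
  \<comment> \<open>The largest function that is constant on the blocks of level n and lies below w.\<close>
  define low where "low n k l = (INF z\<in>{z. cell n (fst z) = k \<and> cell n (snd z) = l}. ennreal (w z))" for n k l
  have low_le: "low n (cell n (fst z)) (cell n (snd z)) \<le> ennreal (w z)" for n z
    unfolding low_def by (rule INF_lower) simp
  have lim: "ennreal (w z) \<le> liminf (\<lambda>n. low n (cell n (fst z)) (cell n (snd z)))" for z
  proof (rule le_Liminf_iff[THEN iffD2], intro allI impI)
    fix y assume "y < ennreal (w z)"
    then obtain y' where y': "y < y'" "y' < ennreal (w z)" using dense by blast
    have cw: "continuous_on UNIV (\<lambda>z. ennreal (w z))" by (intro continuous_on_ennreal cont)
    have "open {z. y' < ennreal (w z)}"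
      using cw by (intro open_Collect_less continuous_on_const)
    then obtain e where e: "e > 0" "\<And>z'. dist z' z < e \<Longrightarrow> y' < ennreal (w z')"
      using y'(2) unfolding open_dist by blast
    obtain N where N: "1 / real (Suc N) < e / 2" using e(1)
      using nat_approx_posE[of "e / 2"] by auto
    show "eventually (\<lambda>n. y < low n (cell n (fst z)) (cell n (snd z))) sequentially"
    proof (rule eventually_sequentiallyI)
      fix n assume n: "N \<le> n"
      have "1 / real (Suc n) \<le> 1 / real (Suc N)" using n by (simp add: frac_le)
      have "y' \<le> low n (cell n (fst z)) (cell n (snd z))"
        unfolding low_def
      proof (rule INF_greatest)
        fix z' assume "z' \<in> {z'. cell n (fst z') = cell n (fst z) \<and> cell n (snd z') = cell n (snd z)}"
        then have *: "dist (fst z') (fst z) < e / 2" "dist (snd z') (snd z) < e / 2"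
          using fine[of n "fst z'" "fst z"] fine[of n "snd z'" "snd z"] N \<open>1 / real (Suc n) \<le> 1 / real (Suc N)\<close> by auto
        have "dist z' z \<le> dist (fst z') (fst z) + dist (snd z') (snd z)"
          unfolding dist_prod_def by (rule sqrt_sum_squares_le_sum) auto
        then show "y' \<le> ennreal (w z')" using * e(2)[of z'] by force
      qed
      then show "y < low n (cell n (fst z)) (cell n (snd z))" using y' by order
    qed
  qed
  have "(\<integral>\<^sup>+ z. ennreal (w z) \<partial>\<rho>) \<le> (\<integral>\<^sup>+ z. liminf (\<lambda>n. low n (cell n (fst z)) (cell n (snd z))) \<partial>\<rho>)"
    by (intro nn_integral_mono lim)
  also have "\<dots> \<le> liminf (\<lambda>n. \<integral>\<^sup>+ z. low n (cell n (fst z)) (cell n (snd z)) \<partial>\<rho>)"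
    by (rule nn_integral_liminf) measurable
  finally have "b < liminf (\<lambda>n. \<integral>\<^sup>+ z. low n (cell n (fst z)) (cell n (snd z)) \<partial>\<rho>)"
    by (rule less_le_trans[OF less])
  then have "eventually (\<lambda>n. b < (\<integral>\<^sup>+ z. low n (cell n (fst z)) (cell n (snd z)) \<partial>\<rho>)) sequentially"
    by (rule le_Liminf_iff[THEN iffD1, rule_format, OF order_refl])
  then obtain n where n: "b < (\<integral>\<^sup>+ z. low n (cell n (fst z)) (cell n (snd z)) \<partial>\<rho>)"
    by (auto simp: eventually_sequentially)
  define C where "C = cell n"
  have [measurable]: "C \<in> borel \<rightarrow>\<^sub>M count_space UNIV" unfolding C_def by measurable
  have "(\<integral>\<^sup>+ z. low n (C (fst z)) (C (snd z)) \<partial>\<rho>)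
      = (\<integral>\<^sup>+ z. (SUP N. low n (C (fst z)) (C (snd z)) * indicator {z. C (fst z) < N \<and> C (snd z) < N} z) \<partial>\<rho>)"
  proof (intro nn_integral_cong antisym)
    fix z
    show "low n (C (fst z)) (C (snd z)) \<le> (SUP N. low n (C (fst z)) (C (snd z)) * indicator {z. C (fst z) < N \<and> C (snd z) < N} z)"
      by (rule SUP_upper2[of "Suc (max (C (fst z)) (C (snd z)))"]) (auto simp: less_Suc_eq_le)
  qed (auto intro!: SUP_least simp: indicator_def)
  also have "\<dots> = (SUP N. \<integral>\<^sup>+ z. low n (C (fst z)) (C (snd z)) * indicator {z. C (fst z) < N \<and> C (snd z) < N} z \<partial>\<rho>)"
  proof (rule nn_integral_monotone_convergence_SUP)
    show "incseq (\<lambda>N z. low n (C (fst z)) (C (snd z)) * indicator {z. C (fst z) < N \<and> C (snd z) < N} z)"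
      by (auto simp: incseq_def le_fun_def indicator_def)
  qed measurable
  finally obtain N where N: "b < (\<integral>\<^sup>+ z. low n (C (fst z)) (C (snd z)) * indicator {z. C (fst z) < N \<and> C (snd z) < N} z \<partial>\<rho>)"
    using n by (auto simp: C_def less_SUP_iff)
  have "{z \<in> space \<rho>. C (fst z) = k} \<in> sets \<rho>" "{z \<in> space \<rho>. C (snd z) = k} \<in> sets \<rho>"
    "{z \<in> space \<rho>. C (fst z) = k \<and> C (snd z) = l} \<in> sets \<rho>" for k l
    by measurable
  then have ev1: "{z. C (fst z) = k} \<in> sets \<rho>" and ev2: "{z. C (snd z) = k} \<in> sets \<rho>"
    and ev12: "{z. C (fst z) = k \<and> C (snd z) = l} \<in> sets \<rho>" for k l
    by simp_all
  define r where "r k l = emeasure \<rho> {z. C (fst z) = k \<and> C (snd z) = l}" for k l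
  define X where "X = (\<Sum>k<N. \<Sum>l<N. low n k l * r k l)"
  have split: "(\<integral>\<^sup>+ z. g (C (fst z)) (C (snd z)) * indicator {z. C (fst z) < N \<and> C (snd z) < N} z \<partial>\<rho>)
     = (\<Sum>k<N. \<Sum>l<N. g k l * r k l)" for g :: "nat \<Rightarrow> nat \<Rightarrow> ennreal"
  proof -
    have "(\<integral>\<^sup>+ z. g (C (fst z)) (C (snd z)) * indicator {z. C (fst z) < N \<and> C (snd z) < N} z \<partial>\<rho>)
      = (\<integral>\<^sup>+ z. (\<Sum>k<N. \<Sum>l<N. g k l * indicator {z. C (fst z) = k \<and> C (snd z) = l} z) \<partial>\<rho>)"
    proof (rule nn_integral_cong)
      fix z
      have "(\<Sum>k<N. \<Sum>l<N. g k l * indicator {z. C (fst z) = k \<and> C (snd z) = l} z)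
        = (\<Sum>k<N. if C (fst z) = k then (\<Sum>l<N. if C (snd z) = l then g k l else 0) else 0)"
        by (intro sum.cong) (auto simp: indicator_def intro!: sum.cong sum.neutral)
      then show "g (C (fst z)) (C (snd z)) * indicator {z. C (fst z) < N \<and> C (snd z) < N} z =
          (\<Sum>k<N. \<Sum>l<N. g k l * indicator {z. C (fst z) = k \<and> C (snd z) = l} z)"
        by (simp add: indicator_def)
    qed
    also have "\<dots> = (\<Sum>k<N. \<integral>\<^sup>+ z. (\<Sum>l<N. g k l * indicator {z. C (fst z) = k \<and> C (snd z) = l} z) \<partial>\<rho>)"
      by (rule nn_integral_sum) measurable
    also have "\<dots> = (\<Sum>k<N. \<Sum>l<N. \<integral>\<^sup>+ z. g k l * indicator {z. C (fst z) = k \<and> C (snd z) = l} z \<partial>\<rho>)"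
      by (rule sum.cong[OF refl], rule nn_integral_sum) measurable
    also have "\<dots> = (\<Sum>k<N. \<Sum>l<N. g k l * r k l)"
      by (simp add: nn_integral_cmult_indicator ev12 r_def)
    finally show ?thesis .
  qed
  have bX: "b < X" using N unfolding split X_def .
  \<comment> \<open>A factor below 1 leaves room for rounding the densities down to rational numbers.\<close>
  have "X = (SUP \<tau>\<in>{0<..<1::real}. ennreal \<tau>) * X"
  proof -
    have "(SUP \<tau>\<in>{0<..<1::real}. ennreal \<tau>) = 1"
    proof (rule antisym)
      show "1 \<le> (SUP \<tau>\<in>{0<..<1::real}. ennreal \<tau>)"
      proof (rule dense_le)
        fix y :: ennreal assume y: "y < 1"
        then have "max y (1/2) < 1" by (simp add: divide_less_ennreal)
        then obtain y' where y': "max y (1/2) < y'" "y' < 1" using dense by blast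
        then have "y' < top" using less_trans[OF y'(2) ennreal_one_less_top] by simp
        then obtain t where t: "y' = ennreal t" "0 \<le> t" by (cases y') auto
        have "t \<noteq> 0" using y'(1) t by (intro notI) simp
        then have "t \<in> {0<..<1}" using y'(2) t by (simp add: ennreal_less_one_iff)
        then show "y \<le> (SUP \<tau>\<in>{0<..<1::real}. ennreal \<tau>)"
          by (rule SUP_upper2) (use y' t in auto)
      qed
    qed (auto intro!: SUP_least)
    then show ?thesis by simp
  qed
  also have "\<dots> = (SUP \<tau>\<in>{0<..<1::real}. ennreal \<tau> * X)"
    by (rule SUP_mult_right_ennreal)
  finally have "b < (SUP \<tau>\<in>{0<..<1::real}. ennreal \<tau> * X)" using bX by (simp only:)
  then obtain \<tau> :: real where \<tau>: "0 < \<tau>" "\<tau> < 1" "b < ennreal \<tau> * X"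
    unfolding less_SUP_iff by auto
  define P where "P k = emeasure \<mu> {s. C s = k}" for k
  define Q where "Q l = emeasure \<nu> {t. C t = l}" for l
  have P_eq: "P k = emeasure \<rho> {z. C (fst z) = k}" for k
    unfolding P_def d1[symmetric] by (subst emeasure_distr) (auto simp: vimage_def)
  have Q_eq: "Q l = emeasure \<rho> {z. C (snd z) = l}" for l
    unfolding Q_def d2[symmetric] by (subst emeasure_distr) (auto simp: vimage_def)
  have rP: "r k l \<le> P k" and rQ: "r k l \<le> Q l" for k l
    unfolding r_def P_eq Q_eq by (auto intro!: emeasure_mono ev1 ev2)
  have "\<exists>x::rat. 0 \<le> x \<and> ennreal (of_rat x) * (P k * Q l) \<le> r k l \<and> ennreal \<tau> * r k l \<le> ennreal (of_rat x) * (P k * Q l)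
      \<and> (r k l = 0 \<longrightarrow> x = 0)" for k l
  proof (cases "r k l = 0")
    case False
    define r' p' q' where "r' = enn2real (r k l)" and "p' = enn2real (P k)" and "q' = enn2real (Q l)"
    have e: "r k l = ennreal r'" "P k = ennreal p'" "Q l = ennreal q'"
      unfolding r'_def p'_def q'_def r_def P_def Q_def
      by (auto simp: less_top[symmetric])
    have nn: "0 \<le> r'" "0 \<le> p'" "0 \<le> q'" by (auto simp: r'_def p'_def q'_def)
    then have pos: "0 < r'" "0 < p'" "0 < q'"
      using False rP[of k l] rQ[of k l] by (auto simp: e)
    have "\<tau> * r' / (p' * q') < r' / (p' * q')"
      using pos \<tau> by (intro divide_strict_right_mono) auto
    then obtain x where x: "\<tau> * r' / (p' * q') < of_rat x" "of_rat x < r' / (p' * q')"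
      using of_rat_dense by blast
    have "0 < \<tau> * r' / (p' * q')" using pos \<tau> by simp
    with x have "0 < (of_rat x :: real)" by linarith
    then have x0: "0 \<le> x" by simp
    have "of_rat x * (p' * q') \<le> r'" "\<tau> * r' \<le> of_rat x * (p' * q')"
      using x pos by (auto simp: field_simps)
    then show ?thesis
      using x0 nn \<tau> False by (intro exI[of _ x]) (auto simp: e simp flip: ennreal_mult)
  qed (auto intro!: exI[of _ 0])
  then obtain x :: "nat \<Rightarrow> nat \<Rightarrow> rat" where x: "\<And>k l. 0 \<le> x k l" "\<And>k l. ennreal (of_rat (x k l)) * (P k * Q l) \<le> r k l"
      "\<And>k l. ennreal \<tau> * r k l \<le> ennreal (of_rat (x k l)) * (P k * Q l)" "\<And>k l. r k l = 0 \<Longrightarrow> x k l = 0"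
    by metis
  define M where "M = map (\<lambda>k. map (x k) [0..<N]) [0..<N]"
  have M: "rat_matrix M k l = (if k < N \<and> l < N then ennreal (of_rat (x k l)) else 0)" for k l
    unfolding rat_matrix_def M_def by auto
  have intP: "(\<integral>\<^sup>+ s. (if C s < N then g (C s) else 0) \<partial>\<mu>) = (\<Sum>k<N. g k * P k)" for g :: "nat \<Rightarrow> ennreal"
  proof -
    have "(\<integral>\<^sup>+ s. (if C s < N then g (C s) else 0) \<partial>\<mu>) = (\<integral>\<^sup>+ s. (\<Sum>k<N. g k * indicator {s. C s = k} s) \<partial>\<mu>)"
      by (intro nn_integral_cong) (simp add: indicator_def)
    then show ?thesis by (simp add: nn_integral_sum nn_integral_cmult_indicator P_def del: sum_mult_indicator)
  qed
  have intQ: "(\<integral>\<^sup>+ s. (if C s < N then g (C s) else 0) \<partial>\<nu>) = (\<Sum>k<N. g k * Q k)" for g :: "nat \<Rightarrow> ennreal"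
  proof -
    have "(\<integral>\<^sup>+ s. (if C s < N then g (C s) else 0) \<partial>\<nu>) = (\<integral>\<^sup>+ s. (\<Sum>k<N. g k * indicator {s. C s = k} s) \<partial>\<nu>)"
      by (intro nn_integral_cong) (simp add: indicator_def)
    then show ?thesis by (simp add: nn_integral_sum nn_integral_cmult_indicator Q_def del: sum_mult_indicator)
  qed
  have finP: "P k \<noteq> \<infinity>" and finQ: "Q k \<noteq> \<infinity>" for k by (auto simp: P_def Q_def)
  have cancel: "y \<le> 1" if "y * p \<le> p" "p \<noteq> 0" "p \<noteq> \<infinity>" for y p :: ennreal
    using that by (metis ennreal_mult_le_mult_iff infinity_ennreal_def mult.commute mult.right_neutral)
  have row: "(\<Sum>l<N. ennreal (of_rat (x k l)) * Q l) \<le> 1" for k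
  proof (cases "P k = 0")
    case True
    then have "r k l = 0" for l using rP[of k l] by simp
    then show ?thesis using x(4) by simp
  next
    case False
    have "(\<Sum>l<N. ennreal (of_rat (x k l)) * Q l) * P k \<le> (\<Sum>l<N. r k l)"
      unfolding sum_distrib_right by (intro sum_mono) (use x(2) in \<open>auto simp: ac_simps\<close>)
    also have "\<dots> = emeasure \<rho> (\<Union>l<N. {z. C (fst z) = k \<and> C (snd z) = l})"
      unfolding r_def by (subst sum_emeasure) (auto simp: disjoint_family_on_def ev12)
    also have "\<dots> \<le> P k" unfolding P_eq by (intro emeasure_mono ev1 ev2) auto
    finally show ?thesis using False finP by (rule cancel)
  qed
  have col: "(\<Sum>k<N. ennreal (of_rat (x k l)) * P k) \<le> 1" for l
  proof (cases "Q l = 0")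
    case True
    then have "r k l = 0" for k using rQ[of k l] by simp
    then show ?thesis using x(4) by simp
  next
    case False
    have "(\<Sum>k<N. ennreal (of_rat (x k l)) * P k) * Q l \<le> (\<Sum>k<N. r k l)"
      unfolding sum_distrib_right by (intro sum_mono) (use x(2) in \<open>auto simp: ac_simps\<close>)
    also have "\<dots> = emeasure \<rho> (\<Union>k<N. {z. C (fst z) = k \<and> C (snd z) = l})"
      unfolding r_def by (subst sum_emeasure) (auto simp: disjoint_family_on_def ev12)
    also have "\<dots> \<le> Q l" unfolding Q_eq by (intro emeasure_mono ev1 ev2) auto
    finally show ?thesis using False finQ by (rule cancel)
  qed
  have 1: "(\<integral>\<^sup>+ t. rat_matrix M k (cell n t) \<partial>\<nu>) \<le> 1" for k
    using row[of k] intQ[of "\<lambda>l. ennreal (of_rat (x k l))"] unfolding C_def[symmetric] by (cases "k < N") (simp_all add: M)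
  have 2: "(\<integral>\<^sup>+ s. rat_matrix M (cell n s) l \<partial>\<mu>) \<le> 1" for l
    using col[of l] intP[of "\<lambda>k. ennreal (of_rat (x k l))"] unfolding C_def[symmetric] by (cases "l < N") (simp_all add: M)
  have "{z \<in> space (\<mu> \<Otimes>\<^sub>M \<nu>). C (fst z) = k \<and> C (snd z) = l} \<in> sets (\<mu> \<Otimes>\<^sub>M \<nu>)" for k l
    by measurable
  then have ev12': "{z. C (fst z) = k \<and> C (snd z) = l} \<in> sets (\<mu> \<Otimes>\<^sub>M \<nu>)" for k l
    by (simp add: space_pair_measure)
  have block: "emeasure (\<mu> \<Otimes>\<^sub>M \<nu>) {z. C (fst z) = k \<and> C (snd z) = l} = P k * Q l" for k l
  proof -
    have "{z. C (fst z) = k \<and> C (snd z) = l} = {s. C s = k} \<times> {t. C t = l}" by auto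
    then show ?thesis by (simp add: \<nu>.emeasure_pair_measure_Times P_def Q_def)
  qed
  have "b < ennreal \<tau> * X" by fact
  also have "\<dots> = (\<Sum>k<N. \<Sum>l<N. low n k l * (ennreal \<tau> * r k l))"
    unfolding X_def by (simp add: sum_distrib_left ac_simps)
  also have "\<dots> \<le> (\<Sum>k<N. \<Sum>l<N. low n k l * (ennreal (of_rat (x k l)) * (P k * Q l)))"
    by (intro sum_mono mult_left_mono x) simp
  also have "\<dots> = (\<Sum>k<N. \<Sum>l<N. low n k l * ennreal (of_rat (x k l)) *
      (\<integral>\<^sup>+ z. indicator {z. C (fst z) = k \<and> C (snd z) = l} z \<partial>(\<mu> \<Otimes>\<^sub>M \<nu>)))"
    by (simp add: block ev12' mult.assoc)
  also have "\<dots> = (\<Sum>k<N. \<Sum>l<N. \<integral>\<^sup>+ z. low n k l * ennreal (of_rat (x k l)) *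
      indicator {z. C (fst z) = k \<and> C (snd z) = l} z \<partial>(\<mu> \<Otimes>\<^sub>M \<nu>))"
    by (simp add: nn_integral_cmult_indicator ev12')
  also have "\<dots> = (\<Sum>k<N. \<integral>\<^sup>+ z. (\<Sum>l<N. low n k l * ennreal (of_rat (x k l)) *
      indicator {z. C (fst z) = k \<and> C (snd z) = l} z) \<partial>(\<mu> \<Otimes>\<^sub>M \<nu>))"
    by (rule sum.cong[OF refl], rule nn_integral_sum[symmetric]) measurable
  also have "\<dots> = (\<integral>\<^sup>+ z. (\<Sum>k<N. \<Sum>l<N. low n k l * ennreal (of_rat (x k l)) *
      indicator {z. C (fst z) = k \<and> C (snd z) = l} z) \<partial>(\<mu> \<Otimes>\<^sub>M \<nu>))"
    by (rule nn_integral_sum[symmetric]) measurable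
  also have "\<dots> \<le> (\<integral>\<^sup>+ z. ennreal (w z) * rat_matrix M (cell n (fst z)) (cell n (snd z)) \<partial>(\<mu> \<Otimes>\<^sub>M \<nu>))"
  proof (rule nn_integral_mono)
    fix z
    have "(\<Sum>k<N. \<Sum>l<N. low n k l * ennreal (of_rat (x k l)) * indicator {z. C (fst z) = k \<and> C (snd z) = l} z)
      = (\<Sum>k<N. if C (fst z) = k then (\<Sum>l<N. if C (snd z) = l then low n k l * ennreal (of_rat (x k l)) else 0) else 0)"
      by (intro sum.cong) (auto simp: indicator_def intro!: sum.cong sum.neutral)
    also have "\<dots> \<le> ennreal (w z) * rat_matrix M (cell n (fst z)) (cell n (snd z))"
      using low_le[of n z] by (auto simp: M C_def intro!: mult_right_mono)
    finally show "(\<Sum>k<N. \<Sum>l<N. low n k l * ennreal (of_rat (x k l)) * indicator {z. C (fst z) = k \<and> C (snd z) = l} z)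
      \<le> ennreal (w z) * rat_matrix M (cell n (fst z)) (cell n (snd z))" .
  qed
  finally show ?thesis using 1 2 by blast
qed

section \<open>Transport costs under a Markov kernel\<close>

lemma ennreal_diff_less_of_less:
  fixes W C D :: ennreal
  assumes "C < D" "0 < W" "W < top"
  shows "(W + C) - D < W"
proof (cases "D = top")
  case False
  then obtain d where d: "D = ennreal d" "0 \<le> d" by (cases D) auto
  obtain c where c: "C = ennreal c" "0 \<le> c" using assms(1) d by (cases C) auto
  obtain w where w: "W = ennreal w" "0 \<le> w" using assms(3) by (cases W) auto
  show ?thesis using assms d c w
    by (auto simp: ennreal_minus ennreal_less_iff simp flip: ennreal_plus intro!: ennreal_lessI)
next
  case True
  then have "W + C - D = 0"
    using assms by (intro diff_eq_0_ennreal) (auto simp: ennreal_add_less_top)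
  then show ?thesis using assms by simp
qed

lemma le_mult_transport_dist:
  assumes t: "0 < t"
    and le: "\<And>\<pi>. \<pi> \<in> couplings \<mu> \<nu> \<Longrightarrow> x \<le> ennreal t * (\<integral>\<^sup>+ z. ennreal (c (fst z) (snd z)) \<partial>\<pi>)"
  shows "x \<le> ennreal t * transport_dist c \<mu> \<nu>"
proof -
  have it: "ennreal (inverse t) * ennreal t = 1" "ennreal t * ennreal (inverse t) = 1"
    using t ennreal_mult[of "inverse t" t] ennreal_mult[of t "inverse t"] by simp_all
  have "ennreal (inverse t) * x \<le> transport_dist c \<mu> \<nu>"
    unfolding transport_dist_def
  proof (rule INF_greatest)
    fix \<pi> assume "\<pi> \<in> couplings \<mu> \<nu>"
    then have "ennreal (inverse t) * x \<le> ennreal (inverse t) * (ennreal t * (\<integral>\<^sup>+ z. ennreal (c (fst z) (snd z)) \<partial>\<pi>))"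
      by (intro mult_left_mono le) auto
    then show "ennreal (inverse t) * x \<le> (\<integral>\<^sup>+ z. ennreal (c (fst z) (snd z)) \<partial>\<pi>)"
      by (simp only: mult.assoc[symmetric] it mult_1)
  qed
  then have "ennreal t * (ennreal (inverse t) * x) \<le> ennreal t * transport_dist c \<mu> \<nu>"
    by (rule mult_left_mono) simp
  then show ?thesis by (simp only: mult.assoc[symmetric] it mult_1)
qed

text \<open>For each pair \<open>(x, y)\<close> the first block density is chosen that is a sub-coupling of \<open>P x\<close> and \<open>P y\<close> of
cost within \<open>e\<close> of the bound. Each of the countably many conditions is measurable in \<open>(x, y)\<close>, hence so is the choice, and mixing the
chosen sub-couplings along a coupling of \<open>\<mu>\<close> and \<open>\<nu>\<close> gives a sub-coupling of \<open>\<mu> \<bind> P\<close> and \<open>\<nu> \<bind> P\<close>.\<close>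

lemma transport_dist_bind_le:
  fixes P :: "'a::{metric_space, second_countable_topology} \<Rightarrow> 'a measure"
  assumes P [measurable]: "P \<in> borel \<rightarrow>\<^sub>M prob_algebra borel"
    and \<mu>: "\<mu> \<in> space (prob_algebra borel)" and \<nu>: "\<nu> \<in> space (prob_algebra borel)"
    and cont_c: "continuous_on UNIV (\<lambda>z. c (fst z) (snd z))" and cont_f: "continuous_on UNIV f"
    and c_nonneg: "\<And>x y. 0 \<le> c x y" and c_le: "\<And>x y. c x y \<le> f x + f y" and f_nonneg: "\<And>x. 0 \<le> f x"
    and fin: "\<And>x. (\<integral>\<^sup>+ y. ennreal (f y) \<partial>P x) < \<infinity>"
    and fin_\<mu>: "(\<integral>\<^sup>+ y. ennreal (f y) \<partial>(\<mu> \<bind> P)) < \<infinity>"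
    and fin_\<nu>: "(\<integral>\<^sup>+ y. ennreal (f y) \<partial>(\<nu> \<bind> P)) < \<infinity>"
    and K: "0 < K"
    and step: "\<And>x y. transport_dist c (P x) (P y) \<le> ennreal (K * c x y)"
  shows "transport_dist c (\<mu> \<bind> P) (\<nu> \<bind> P) \<le> ennreal K * transport_dist c \<mu> \<nu>"
proof -
  obtain cell :: "nat \<Rightarrow> 'a \<Rightarrow> nat" where
    cell [measurable]: "\<And>n. cell n \<in> borel \<rightarrow>\<^sub>M count_space UNIV" and
    fine: "\<And>n x y. cell n x = cell n y \<Longrightarrow> dist x y < 1 / Suc n"
    by (rule fine_cells_exist) blast
  have P' [measurable]: "P \<in> borel \<rightarrow>\<^sub>M subprob_algebra borel"
    by (rule measurable_prob_algebraD[OF P])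
  have prob: "prob_space (P x)" and sP [measurable_cong]: "sets (P x) = sets borel" for x
    using measurable_space[OF P, of x] by (auto simp: space_prob_algebra)
  have spP [simp]: "space (P x) = UNIV" for x using sets_eq_imp_space_eq[OF sP] by simp
  have s\<mu> [measurable_cong]: "sets \<mu> = sets borel" and s\<nu> [measurable_cong]: "sets \<nu> = sets borel"
    using \<mu> \<nu> by (auto simp: space_prob_algebra)
  have [simp]: "space \<mu> = UNIV" "space \<nu> = UNIV"
    using s\<mu> s\<nu> by (auto dest!: sets_eq_imp_space_eq)
  have c [measurable]: "(\<lambda>z. c (fst z) (snd z)) \<in> borel_measurable (borel \<Otimes>\<^sub>M borel)"
    using cont_c by (simp add: borel_prod borel_measurable_continuous_onI)
  have f [measurable]: "f \<in> borel_measurable borel"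
    using cont_f by (rule borel_measurable_continuous_onI)
  define w where "w z = f (fst z) + f (snd z) - c (fst z) (snd z)" for z
  have w_nonneg: "0 \<le> w z" for z using c_le[of "fst z" "snd z"] by (simp add: w_def)
  have cont_w: "continuous_on UNIV w"
    unfolding w_def by (intro continuous_intros cont_c continuous_on_compose2[OF cont_f]) auto
  have w [measurable]: "w \<in> borel_measurable (borel \<Otimes>\<^sub>M borel)"
    unfolding w_def by measurable
  define N where "N z = P (fst z) \<Otimes>\<^sub>M P (snd z)" for z
  have N [measurable]: "N \<in> borel \<Otimes>\<^sub>M borel \<rightarrow>\<^sub>M prob_algebra (borel \<Otimes>\<^sub>M borel)"
    unfolding N_def by measurable
  have N' [measurable]: "N \<in> borel \<Otimes>\<^sub>M borel \<rightarrow>\<^sub>M subprob_algebra (borel \<Otimes>\<^sub>M borel)"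
    by (rule measurable_prob_algebraD[OF N])
  have sN [measurable_cong]: "sets (N z) = sets (borel \<Otimes>\<^sub>M borel)" for z
    unfolding N_def by (intro sets_pair_measure_cong sP)
  have space_N: "space (N z) = UNIV" for z by (simp add: N_def space_pair_measure)
  define F where "F x = (\<integral>\<^sup>+ y. ennreal (f y) \<partial>P x)" for x
  have F [measurable]: "F \<in> borel_measurable borel"
    unfolding F_def by measurable
  define n where "n j = fst (from_nat j :: nat \<times> rat list list)" for j
  define M where "M j = snd (from_nat j :: nat \<times> rat list list)" for j
  define h where "h j z = rat_matrix (M j) (cell (n j) (fst z)) (cell (n j) (snd z))" for j z
  have h [measurable]: "h j \<in> borel_measurable (borel \<Otimes>\<^sub>M borel)" for j
    unfolding h_def by measurable
  have main: "transport_dist c (\<mu> \<bind> P) (\<nu> \<bind> P) \<le> ennreal K * (\<integral>\<^sup>+ z. ennreal (c (fst z) (snd z)) \<partial>\<pi>) + ennreal e"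
    if \<pi>: "\<pi> \<in> couplings \<mu> \<nu>" and e: "0 < e" for \<pi> e
  proof -
    interpret \<pi>: prob_space \<pi> using \<pi> by (simp add: couplings_def)
    have s\<pi> [measurable_cong]: "sets \<pi> = sets (borel \<Otimes>\<^sub>M borel)"
      and d1: "distr \<pi> borel fst = \<mu>" and d2: "distr \<pi> borel snd = \<nu>"
      using \<pi> by (auto simp: couplings_def)
    have [simp]: "space \<pi> = UNIV"
      using sets_eq_imp_space_eq[OF s\<pi>] by (simp add: space_pair_measure)
    \<comment> \<open>The first two conditions say that both marginals of the density h j are at most 1.\<close>
    define good where "good j z \<longleftrightarrow>
       (\<forall>k. (\<integral>\<^sup>+ t. rat_matrix (M j) k (cell (n j) t) \<partial>P (snd z)) \<le> 1) \<and>
       (\<forall>l. (\<integral>\<^sup>+ s. rat_matrix (M j) (cell (n j) s) l \<partial>P (fst z)) \<le> 1) \<and>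
       F (fst z) + F (snd z) \<le> (\<integral>\<^sup>+ y. ennreal (w y) * h j y \<partial>N z) + ennreal (K * c (fst z) (snd z)) + ennreal e" for j z
    have ex: "\<exists>j. good j z" for z
    proof -
      have "transport_dist c (P (fst z)) (P (snd z)) < ennreal (K * c (fst z) (snd z)) + ennreal e"
        using step[of "fst z" "snd z"] e K c_nonneg[of "fst z" "snd z"]
        by (auto intro!: order.strict_trans1[OF step] simp: ennreal_less_iff simp flip: ennreal_plus)
      then obtain \<rho> where \<rho>: "\<rho> \<in> couplings (P (fst z)) (P (snd z))"
        and less: "(\<integral>\<^sup>+ y. ennreal (c (fst y) (snd y)) \<partial>\<rho>) < ennreal (K * c (fst z) (snd z)) + ennreal e"
        unfolding transport_dist_def by (auto simp: INF_less_iff)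
      have s\<rho> [measurable_cong]: "sets \<rho> = sets (borel \<Otimes>\<^sub>M borel)"
        and e1: "distr \<rho> borel fst = P (fst z)" and e2: "distr \<rho> borel snd = P (snd z)"
        using \<rho> by (auto simp: couplings_def)
      have "F (fst z) + F (snd z) = (\<integral>\<^sup>+ y. ennreal (f (fst y)) \<partial>\<rho>) + (\<integral>\<^sup>+ y. ennreal (f (snd y)) \<partial>\<rho>)"
        unfolding F_def e1[symmetric] e2[symmetric] by (subst (1 2) nn_integral_distr) auto
      also have "\<dots> = (\<integral>\<^sup>+ y. ennreal (w y) + ennreal (c (fst y) (snd y)) \<partial>\<rho>)"
        using w_nonneg c_nonneg f_nonneg
        by (subst nn_integral_add[symmetric]) (auto intro!: nn_integral_cong simp: w_def simp flip: ennreal_plus)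
      also have "\<dots> = (\<integral>\<^sup>+ y. ennreal (w y) \<partial>\<rho>) + (\<integral>\<^sup>+ y. ennreal (c (fst y) (snd y)) \<partial>\<rho>)"
        by (rule nn_integral_add) measurable
      finally have sum: "F (fst z) + F (snd z) = (\<integral>\<^sup>+ y. ennreal (w y) \<partial>\<rho>) + (\<integral>\<^sup>+ y. ennreal (c (fst y) (snd y)) \<partial>\<rho>)" .
      show ?thesis
      proof (cases "(\<integral>\<^sup>+ y. ennreal (w y) \<partial>\<rho>) = 0")
        case True
        have "M (to_nat (0::nat, []::rat list list)) = []" by (simp add: M_def)
        then have "good (to_nat (0::nat, []::rat list list)) z"
          using sum True less_imp_le[OF less]
          by (simp add: good_def rat_matrix_def add.assoc add_increasing)
        then show ?thesis ..
      next
        case False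
        have "F (fst z) + F (snd z) < top" using fin by (simp add: F_def)
        then have "(\<integral>\<^sup>+ y. ennreal (w y) \<partial>\<rho>) < top" using sum by (simp add: ennreal_add_less_top)
        with False less have "F (fst z) + F (snd z) - (ennreal (K * c (fst z) (snd z)) + ennreal e) < (\<integral>\<^sup>+ y. ennreal (w y) \<partial>\<rho>)"
          unfolding sum by (intro ennreal_diff_less_of_less) (auto simp: zero_less_iff_neq_zero)
        from block_density_exists[where cell=cell, OF cell fine prob prob \<rho> cont_w this]
        obtain m A where *: "\<forall>k. (\<integral>\<^sup>+ t. rat_matrix A k (cell m t) \<partial>P (snd z)) \<le> 1"
          "\<forall>l. (\<integral>\<^sup>+ s. rat_matrix A (cell m s) l \<partial>P (fst z)) \<le> 1"
          "F (fst z) + F (snd z) - (ennreal (K * c (fst z) (snd z)) + ennreal e)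
            < (\<integral>\<^sup>+ y. ennreal (w y) * rat_matrix A (cell m (fst y)) (cell m (snd y)) \<partial>(P (fst z) \<Otimes>\<^sub>M P (snd z)))"
          by blast
        have "F (fst z) + F (snd z) \<le> (\<integral>\<^sup>+ y. ennreal (w y) * rat_matrix A (cell m (fst y)) (cell m (snd y)) \<partial>N z)
            + (ennreal (K * c (fst z) (snd z)) + ennreal e)"
          using less_imp_le[OF *(3)] by (simp add: ennreal_minus_le_iff N_def add.commute)
        then have "good (to_nat (m, A)) z"
          using * by (simp add: good_def h_def M_def n_def add.assoc)
        then show ?thesis ..
      qed
    qed
    have [measurable]: "(\<lambda>z. \<integral>\<^sup>+ t. rat_matrix (M j) k (cell (n j) t) \<partial>P (snd z)) \<in> borel_measurable (borel \<Otimes>\<^sub>M borel)" for j k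
      by (rule measurable_compose[OF _ nn_integral_measurable_subprob_algebra[where N=borel]]) measurable
    have [measurable]: "(\<lambda>z. \<integral>\<^sup>+ t. rat_matrix (M j) (cell (n j) t) k \<partial>P (fst z)) \<in> borel_measurable (borel \<Otimes>\<^sub>M borel)" for j k
      by (rule measurable_compose[OF _ nn_integral_measurable_subprob_algebra[where N=borel]]) measurable
    have [measurable]: "(\<lambda>z. \<integral>\<^sup>+ y. ennreal (w y) * h j y \<partial>N z) \<in> borel_measurable (borel \<Otimes>\<^sub>M borel)" for j
      by (rule measurable_compose[OF N' nn_integral_measurable_subprob_algebra]) measurable
    have [measurable]: "Measurable.pred (borel \<Otimes>\<^sub>M borel) (good j)" for j
      unfolding good_def by measurable
    define J where "J z = (LEAST j. good j z)" for z
    have J [measurable]: "J \<in> borel \<Otimes>\<^sub>M borel \<rightarrow>\<^sub>M count_space UNIV"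
      unfolding J_def by measurable
    have good: "good (J z) z" for z unfolding J_def using ex by (rule LeastI_ex)
    have hJ [measurable]: "(\<lambda>x. h (J (fst x)) (snd x)) \<in> borel_measurable ((borel \<Otimes>\<^sub>M borel) \<Otimes>\<^sub>M (borel \<Otimes>\<^sub>M borel))"
      by (rule measurable_compose_countable[where g="\<lambda>x. J (fst x)" and f="\<lambda>j x. h j (snd x)"]) measurable
    have fst_le: "(\<integral>\<^sup>+ y. h (J z) y * indicator (A \<times> UNIV) y \<partial>N z) \<le> emeasure (P (fst z)) A" if [measurable]: "A \<in> sets borel" for z A
    proof -
      interpret Py: prob_space "P (snd z)" by (rule prob)
      have "(\<integral>\<^sup>+ y. h (J z) y * indicator (A \<times> UNIV) y \<partial>N z)
        = (\<integral>\<^sup>+ s. (\<integral>\<^sup>+ t. h (J z) (s, t) * indicator A s \<partial>P (snd z)) \<partial>P (fst z))"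
        unfolding N_def by (subst Py.nn_integral_fst[symmetric]) (auto simp: indicator_def intro!: nn_integral_cong)
      also have "\<dots> = (\<integral>\<^sup>+ s. (\<integral>\<^sup>+ t. h (J z) (s, t) \<partial>P (snd z)) * indicator A s \<partial>P (fst z))"
        by (intro nn_integral_cong nn_integral_multc) measurable
      also have "\<dots> \<le> (\<integral>\<^sup>+ s. 1 * indicator A s \<partial>P (fst z))"
        using good[of z] by (intro nn_integral_mono mult_right_mono) (auto simp: good_def h_def)
      finally show ?thesis by simp
    qed
    have snd_le: "(\<integral>\<^sup>+ y. h (J z) y * indicator (UNIV \<times> A) y \<partial>N z) \<le> emeasure (P (snd z)) A" if [measurable]: "A \<in> sets borel" for z A
    proof -
      interpret Px: prob_space "P (fst z)" by (rule prob)
      interpret Py: prob_space "P (snd z)" by (rule prob)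
      interpret pair_sigma_finite "P (fst z)" "P (snd z)" ..
      have "(\<integral>\<^sup>+ y. h (J z) y * indicator (UNIV \<times> A) y \<partial>N z)
        = (\<integral>\<^sup>+ t. (\<integral>\<^sup>+ s. h (J z) (s, t) * indicator A t \<partial>P (fst z)) \<partial>P (snd z))"
        unfolding N_def by (subst nn_integral_snd[symmetric]) (auto simp: indicator_def intro!: nn_integral_cong)
      also have "\<dots> = (\<integral>\<^sup>+ t. (\<integral>\<^sup>+ s. h (J z) (s, t) \<partial>P (fst z)) * indicator A t \<partial>P (snd z))"
        by (intro nn_integral_cong nn_integral_multc) measurable
      also have "\<dots> \<le> (\<integral>\<^sup>+ t. 1 * indicator A t \<partial>P (snd z))"
        using good[of z] by (intro nn_integral_mono mult_right_mono) (auto simp: good_def h_def)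
      finally show ?thesis by simp
    qed
    have meas_N: "g \<in> borel_measurable (N z)" if "g \<in> borel_measurable (borel \<Otimes>\<^sub>M borel)" for g z
      using that by (simp add: measurable_cong_sets[OF sN refl])
    \<comment> \<open>The selected sub-coupling as a kernel in the pair z.\<close>
    define D where "D z = density (N z) (h (J z))" for z
    have D [measurable]: "D \<in> borel \<Otimes>\<^sub>M borel \<rightarrow>\<^sub>M subprob_algebra (borel \<Otimes>\<^sub>M borel)"
    proof (rule measurable_subprob_algebra)
      fix z
      show "sets (D z) = sets (borel \<Otimes>\<^sub>M borel)" by (simp add: D_def sN)
      have "UNIV \<in> sets (N z)" by (metis sets.top space_N)
      then have "emeasure (D z) UNIV \<le> 1"
        using fst_le[of UNIV z] prob_space.emeasure_space_1[OF prob[of "fst z"]]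
        unfolding D_def by (subst emeasure_density[OF meas_N[OF h]]) auto
      then show "subprob_space (D z)"
        by (intro subprob_spaceI) (simp_all add: D_def N_def space_pair_measure)
    next
      fix A :: "('a \<times> 'a) set" assume [measurable]: "A \<in> sets (borel \<Otimes>\<^sub>M borel)"
      have "(\<lambda>z. \<integral>\<^sup>+ y. h (J z) y * indicator A y \<partial>N z) \<in> borel_measurable (borel \<Otimes>\<^sub>M borel)"
        by (rule nn_integral_measurable_subprob_algebra2[OF _ N']) measurable
      then show "(\<lambda>z. emeasure (D z) A) \<in> borel_measurable (borel \<Otimes>\<^sub>M borel)"
        by (simp add: D_def emeasure_density[OF meas_N[OF h]] sN)
    qed
    define \<sigma> where "\<sigma> = \<pi> \<bind> D"
    have D\<pi> [measurable]: "D \<in> \<pi> \<rightarrow>\<^sub>M subprob_algebra (borel \<Otimes>\<^sub>M borel)" by measurable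
    have s\<sigma>: "sets \<sigma> = sets (borel \<Otimes>\<^sub>M borel)" unfolding \<sigma>_def
      by (rule sets_bind[OF sets_kernel[OF D\<pi>]]) auto
    have int_\<sigma>: "(\<integral>\<^sup>+ y. g y \<partial>\<sigma>) = (\<integral>\<^sup>+ z. (\<integral>\<^sup>+ y. h (J z) y * g y \<partial>N z) \<partial>\<pi>)"
      if [measurable]: "g \<in> borel_measurable (borel \<Otimes>\<^sub>M borel)" for g
      unfolding \<sigma>_def by (subst nn_integral_bind[OF that D\<pi>]) (simp add: D_def nn_integral_density[OF meas_N[OF h] meas_N[OF that]])
    have e\<sigma>: "emeasure \<sigma> A = (\<integral>\<^sup>+ z. (\<integral>\<^sup>+ y. h (J z) y * indicator A y \<partial>N z) \<partial>\<pi>)"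
      if [measurable]: "A \<in> sets (borel \<Otimes>\<^sub>M borel)" for A
      using int_\<sigma>[of "indicator A"] by (simp add: s\<sigma>)
    have bind_\<mu>: "emeasure (\<mu> \<bind> P) A = (\<integral>\<^sup>+ z. emeasure (P (fst z)) A \<partial>\<pi>)" 
     and bind_\<nu>: "emeasure (\<nu> \<bind> P) A = (\<integral>\<^sup>+ z. emeasure (P (snd z)) A \<partial>\<pi>)" if [measurable]: "A \<in> sets borel" for A
    proof -
      show "emeasure (\<mu> \<bind> P) A = (\<integral>\<^sup>+ z. emeasure (P (fst z)) A \<partial>\<pi>)"
        by (subst emeasure_bind[where N=borel]) (auto simp: d1[symmetric] nn_integral_distr)
      show "emeasure (\<nu> \<bind> P) A = (\<integral>\<^sup>+ z. emeasure (P (snd z)) A \<partial>\<pi>)"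
        by (subst emeasure_bind[where N=borel]) (auto simp: d2[symmetric] nn_integral_distr)
    qed
    have F_\<mu>: "(\<integral>\<^sup>+ y. ennreal (f y) \<partial>(\<mu> \<bind> P)) = (\<integral>\<^sup>+ z. F (fst z) \<partial>\<pi>)"
      by (subst nn_integral_bind[where B=borel]) (auto simp: d1[symmetric] nn_integral_distr F_def[symmetric])
    have F_\<nu>: "(\<integral>\<^sup>+ y. ennreal (f y) \<partial>(\<nu> \<bind> P)) = (\<integral>\<^sup>+ z. F (snd z) \<partial>\<pi>)"
      by (subst nn_integral_bind[where B=borel]) (auto simp: d2[symmetric] nn_integral_distr F_def[symmetric])
    have bp: "\<xi> \<bind> P \<in> space (prob_algebra borel)" if "\<xi> \<in> space (prob_algebra borel)" for \<xi>
      using measurable_bind_prob_space[OF measurable_const[OF that] P]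
      by (rule measurable_space[where x=undefined and M="count_space UNIV"]) simp
    have "transport_dist c (\<mu> \<bind> P) (\<nu> \<bind> P) + (\<integral>\<^sup>+ z. ennreal (f (fst z) + f (snd z) - c (fst z) (snd z)) \<partial>\<sigma>)
        \<le> (\<integral>\<^sup>+ y. ennreal (f y) \<partial>(\<mu> \<bind> P)) + (\<integral>\<^sup>+ y. ennreal (f y) \<partial>(\<nu> \<bind> P))"
    proof (rule transport_dist_add_subcoupling_le[OF _ _ _ _ s\<sigma> _ _ c f c_nonneg c_le f_nonneg])
      show "prob_space (\<mu> \<bind> P)" "prob_space (\<nu> \<bind> P)" "sets (\<mu> \<bind> P) = sets borel" "sets (\<nu> \<bind> P) = sets borel"
        using bp[OF \<mu>] bp[OF \<nu>] by (auto simp: space_prob_algebra)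
      fix A :: "'a set" assume [measurable]: "A \<in> sets borel"
      show "emeasure \<sigma> (A \<times> UNIV) \<le> emeasure (\<mu> \<bind> P) A"
        by (simp add: e\<sigma> bind_\<mu> nn_integral_mono fst_le)
      show "emeasure \<sigma> (UNIV \<times> A) \<le> emeasure (\<nu> \<bind> P) A"
        by (simp add: e\<sigma> bind_\<nu> nn_integral_mono snd_le)
    qed
    then have "(\<integral>\<^sup>+ z. ennreal (w z) \<partial>\<sigma>) + transport_dist c (\<mu> \<bind> P) (\<nu> \<bind> P)
        \<le> (\<integral>\<^sup>+ y. ennreal (f y) \<partial>(\<mu> \<bind> P)) + (\<integral>\<^sup>+ y. ennreal (f y) \<partial>(\<nu> \<bind> P))"
      by (simp add: w_def add.commute)
    moreover from this have fin_w: "(\<integral>\<^sup>+ z. ennreal (w z) \<partial>\<sigma>) < top"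
    proof -
      assume le: "(\<integral>\<^sup>+ z. ennreal (w z) \<partial>\<sigma>) + transport_dist c (\<mu> \<bind> P) (\<nu> \<bind> P)
        \<le> (\<integral>\<^sup>+ y. ennreal (f y) \<partial>(\<mu> \<bind> P)) + (\<integral>\<^sup>+ y. ennreal (f y) \<partial>(\<nu> \<bind> P))"
      have "(\<integral>\<^sup>+ z. ennreal (w z) \<partial>\<sigma>) \<le> (\<integral>\<^sup>+ z. ennreal (w z) \<partial>\<sigma>) + transport_dist c (\<mu> \<bind> P) (\<nu> \<bind> P)"
        by (simp add: add_increasing2)
      also note le
      also have "(\<integral>\<^sup>+ y. ennreal (f y) \<partial>(\<mu> \<bind> P)) + (\<integral>\<^sup>+ y. ennreal (f y) \<partial>(\<nu> \<bind> P)) < top"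
        using fin_\<mu> fin_\<nu> by (simp add: ennreal_add_less_top)
      finally show ?thesis .
    qed
    have "(\<integral>\<^sup>+ y. ennreal (f y) \<partial>(\<mu> \<bind> P)) + (\<integral>\<^sup>+ y. ennreal (f y) \<partial>(\<nu> \<bind> P))
      = (\<integral>\<^sup>+ z. F (fst z) + F (snd z) \<partial>\<pi>)"
      unfolding F_\<mu> F_\<nu> by (rule nn_integral_add[symmetric]) measurable
    also have "\<dots> \<le> (\<integral>\<^sup>+ z. (\<integral>\<^sup>+ y. h (J z) y * ennreal (w y) \<partial>N z) + ennreal (K * c (fst z) (snd z)) + ennreal e \<partial>\<pi>)"
      using good by (intro nn_integral_mono) (simp add: good_def mult.commute)
    also have "\<dots> = (\<integral>\<^sup>+ z. (\<integral>\<^sup>+ y. h (J z) y * ennreal (w y) \<partial>N z) \<partial>\<pi>) + (\<integral>\<^sup>+ z. ennreal (K * c (fst z) (snd z)) \<partial>\<pi>) + ennreal e"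
    proof -
      have [measurable]: "(\<lambda>z. \<integral>\<^sup>+ y. h (J z) y * ennreal (w y) \<partial>N z) \<in> borel_measurable (borel \<Otimes>\<^sub>M borel)"
        by (rule nn_integral_measurable_subprob_algebra2[OF _ N']) measurable
      show ?thesis by (simp add: nn_integral_add \<pi>.emeasure_space_1[simplified])
    qed
    also have "(\<integral>\<^sup>+ z. (\<integral>\<^sup>+ y. h (J z) y * ennreal (w y) \<partial>N z) \<partial>\<pi>) = (\<integral>\<^sup>+ z. ennreal (w z) \<partial>\<sigma>)"
      by (rule int_\<sigma>[symmetric]) measurable
    finally have le: "(\<integral>\<^sup>+ z. ennreal (w z) \<partial>\<sigma>) + transport_dist c (\<mu> \<bind> P) (\<nu> \<bind> P)
      \<le> (\<integral>\<^sup>+ z. ennreal (w z) \<partial>\<sigma>) + (\<integral>\<^sup>+ z. ennreal (K * c (fst z) (snd z)) \<partial>\<pi>) + ennreal e" .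
    have "(\<integral>\<^sup>+ z. ennreal (K * c (fst z) (snd z)) \<partial>\<pi>) = ennreal K * (\<integral>\<^sup>+ z. ennreal (c (fst z) (snd z)) \<partial>\<pi>)"
      using K c_nonneg by (simp add: ennreal_mult nn_integral_cmult)
    with le have "(\<integral>\<^sup>+ z. ennreal (w z) \<partial>\<sigma>) + transport_dist c (\<mu> \<bind> P) (\<nu> \<bind> P)
      \<le> (\<integral>\<^sup>+ z. ennreal (w z) \<partial>\<sigma>) + (ennreal K * (\<integral>\<^sup>+ z. ennreal (c (fst z) (snd z)) \<partial>\<pi>) + ennreal e)"
      by (simp only: add.assoc)
    then show ?thesis using fin_w unfolding ennreal_add_left_cancel_le by auto
  qed
  show ?thesis
    by (rule le_mult_transport_dist[OF K]) (rule ennreal_le_epsilon[OF main])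
qed

section \<open>The weak Harris theorem\<close>

lemma kernel_pow_0 [simp]: "kernel_pow P 0 \<mu> = \<mu>"
  by (simp add: kernel_pow_def)

lemma kernel_pow_Suc: "kernel_pow P (Suc n) \<mu> = kernel_pow P n \<mu> \<bind> P"
  by (simp add: kernel_pow_def)

lemma kernel_pow_add: "kernel_pow P (m + n) \<mu> = kernel_pow P m (kernel_pow P n \<mu>)"
  by (simp add: kernel_pow_def funpow_add)

lemma bind_in_prob_algebra:
  assumes "P \<in> borel \<rightarrow>\<^sub>M prob_algebra borel" "\<mu> \<in> space (prob_algebra borel)"
  shows "\<mu> \<bind> P \<in> space (prob_algebra borel)"
  using measurable_bind_prob_space[OF measurable_const[OF assms(2)] assms(1)]
  by (rule measurable_space[where x=undefined and M="count_space UNIV"]) simp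

lemma kernel_pow_in_prob_algebra:
  assumes "P \<in> borel \<rightarrow>\<^sub>M prob_algebra borel" "\<mu> \<in> space (prob_algebra borel)"
  shows "kernel_pow P n \<mu> \<in> space (prob_algebra borel)"
  by (induction n) (auto simp: kernel_pow_Suc assms intro: bind_in_prob_algebra)

lemma return_in_prob_algebra [simp]: "return borel x \<in> space (prob_algebra borel)"
  by (simp add: space_prob_algebra prob_space_return)

lemma kernel_pow_return_measurable:
  assumes P [measurable]: "P \<in> borel \<rightarrow>\<^sub>M prob_algebra borel"
  shows "(\<lambda>x. kernel_pow P n (return borel x)) \<in> borel \<rightarrow>\<^sub>M prob_algebra borel"
proof (induction n)
  case 0
  show ?case by (simp add: measurable_return_prob_space)
next
  case (Suc n)
  then show ?case by (simp add: kernel_pow_Suc measurable_bind_prob_space[OF _ P])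
qed

lemma kernel_pow_eq_bind:
  assumes P: "P \<in> borel \<rightarrow>\<^sub>M prob_algebra borel" and \<mu>: "\<mu> \<in> space (prob_algebra borel)"
  shows "kernel_pow P n \<mu> = \<mu> \<bind> (\<lambda>x. kernel_pow P n (return borel x))"
proof (induction n)
  case 0
  then show ?case using \<mu> by (simp add: bind_return'' space_prob_algebra)
next
  case (Suc n)
  have s: "sets \<mu> = sets borel" using \<mu> by (simp add: space_prob_algebra)
  have "(\<lambda>x. kernel_pow P n (return borel x)) \<in> \<mu> \<rightarrow>\<^sub>M subprob_algebra borel"
    using kernel_pow_return_measurable[OF P, of n] by (simp add: measurable_cong_sets[OF s refl] measurable_prob_algebraD)
  then show ?case
    by (simp add: kernel_pow_Suc Suc bind_assoc[OF _ measurable_prob_algebraD[OF P]])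
qed

text \<open>This makes statements about one step available for the \<open>n\<close>-step kernel.\<close>

lemma kernel_pow_mult:
  assumes P: "P \<in> borel \<rightarrow>\<^sub>M prob_algebra borel" and \<mu>: "\<mu> \<in> space (prob_algebra borel)"
  shows "kernel_pow (\<lambda>x. kernel_pow P n (return borel x)) k \<mu> = kernel_pow P (n * k) \<mu>"
proof (induction k)
  case (Suc k)
  have "kernel_pow P (n * Suc k) \<mu> = kernel_pow P n (kernel_pow P (n * k) \<mu>)"
    by (simp add: kernel_pow_add)
  then show ?case
    using kernel_pow_eq_bind[OF P kernel_pow_in_prob_algebra[OF P \<mu>]] by (simp add: kernel_pow_Suc Suc)
qed simp

lemma kernel_pow_drift:
  fixes V :: "'a::topological_space \<Rightarrow> real"
  assumes P: "P \<in> borel \<rightarrow>\<^sub>M prob_algebra borel"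
    and V [measurable]: "V \<in> borel_measurable borel" and V_nonneg: "\<And>x. 0 \<le> V x"
    and l: "0 \<le> l" "l < 1" and J: "0 \<le> J"
    and drift: "\<And>x. (\<integral>\<^sup>+ y. ennreal (V y) \<partial>P x) \<le> ennreal (l * V x + J)"
  shows "(\<integral>\<^sup>+ y. ennreal (V y) \<partial>kernel_pow P n (return borel x)) \<le> ennreal (l ^ n * V x + J / (1 - l))"
proof (induction n)
  case 0
  have "(\<integral>\<^sup>+ y. ennreal (V y) \<partial>return borel x) = ennreal (V x)"
    by (rule nn_integral_return) auto
  then show ?case using l J by (simp add: ennreal_leI)
next
  case (Suc n)
  let ?\<mu> = "kernel_pow P n (return borel x)"
  have \<mu>: "?\<mu> \<in> space (prob_algebra borel)"
    by (rule kernel_pow_in_prob_algebra[OF P]) simp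
  then have s [measurable_cong]: "sets ?\<mu> = sets borel" and "prob_space ?\<mu>" by (auto simp: space_prob_algebra)
  interpret prob_space ?\<mu> by fact
  have [measurable]: "P \<in> borel \<rightarrow>\<^sub>M subprob_algebra borel" by (rule measurable_prob_algebraD[OF P])
  have "(\<integral>\<^sup>+ y. ennreal (V y) \<partial>kernel_pow P (Suc n) (return borel x)) = (\<integral>\<^sup>+ z. (\<integral>\<^sup>+ y. ennreal (V y) \<partial>P z) \<partial>?\<mu>)"
    unfolding kernel_pow_Suc by (rule nn_integral_bind[where B=borel]) measurable
  also have "\<dots> \<le> (\<integral>\<^sup>+ z. ennreal l * ennreal (V z) + ennreal J \<partial>?\<mu>)"
    using drift l J V_nonneg by (intro nn_integral_mono) (simp add: ennreal_mult)
  also have "\<dots> = ennreal l * (\<integral>\<^sup>+ z. ennreal (V z) \<partial>?\<mu>) + ennreal J"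
    by (simp add: nn_integral_add nn_integral_cmult emeasure_space_1)
  also have "\<dots> \<le> ennreal l * ennreal (l ^ n * V x + J / (1 - l)) + ennreal J"
    by (intro add_right_mono mult_left_mono Suc) simp
  also have "\<dots> = ennreal (l * (l ^ n * V x + J / (1 - l)) + J)"
    using l J V_nonneg by (simp add: ennreal_mult ennreal_plus)
  also have "l * (l ^ n * V x + J / (1 - l)) + J = l ^ Suc n * V x + J / (1 - l)"
    using l by (simp add: field_simps)
  finally show ?case .
qed

lemma transport_dist_return_le:
  fixes x y :: "'a::second_countable_topology"
  assumes [measurable]: "(\<lambda>z. c (fst z) (snd z)) \<in> borel_measurable (borel \<Otimes>\<^sub>M borel)"
  shows "transport_dist c (return borel x) (return borel y) \<le> ennreal (c x y)"
proof -
  have "return (borel \<Otimes>\<^sub>M borel) (x, y) \<in> couplings (return borel x) (return borel y)"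
    by (auto simp: couplings_def distr_return space_pair_measure intro!: prob_space_return)
  then have "transport_dist c (return borel x) (return borel y)
    \<le> (\<integral>\<^sup>+ z. ennreal (c (fst z) (snd z)) \<partial>return (borel \<Otimes>\<^sub>M borel) (x, y))"
    unfolding transport_dist_def by (rule INF_lower)
  also have "\<dots> = ennreal (c x y)"
    by (subst nn_integral_return) (auto simp: space_pair_measure)
  finally show ?thesis .
qed

lemma transport_dist_kernel_pow_le:
  fixes P :: "'a::{metric_space, second_countable_topology} \<Rightarrow> 'a measure"
  assumes P: "P \<in> borel \<rightarrow>\<^sub>M prob_algebra borel"
    and \<mu>: "\<mu> \<in> space (prob_algebra borel)" and \<nu>: "\<nu> \<in> space (prob_algebra borel)"
    and cont_c: "continuous_on UNIV (\<lambda>z. c (fst z) (snd z))" and cont_f: "continuous_on UNIV f"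
    and c_nonneg: "\<And>x y. 0 \<le> c x y" and c_le: "\<And>x y. c x y \<le> f x + f y" and f_nonneg: "\<And>x. 0 \<le> f x"
    and fin: "\<And>x. (\<integral>\<^sup>+ y. ennreal (f y) \<partial>P x) < \<infinity>"
    and fin_\<mu>: "\<And>n. (\<integral>\<^sup>+ y. ennreal (f y) \<partial>kernel_pow P n \<mu>) < \<infinity>"
    and fin_\<nu>: "\<And>n. (\<integral>\<^sup>+ y. ennreal (f y) \<partial>kernel_pow P n \<nu>) < \<infinity>"
    and K: "0 < K"
    and step: "\<And>x y. transport_dist c (P x) (P y) \<le> ennreal (K * c x y)"
  shows "transport_dist c (kernel_pow P n \<mu>) (kernel_pow P n \<nu>) \<le> ennreal (K ^ n) * transport_dist c \<mu> \<nu>"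
proof (induction n)
  case (Suc n)
  have "transport_dist c (kernel_pow P (Suc n) \<mu>) (kernel_pow P (Suc n) \<nu>)
    \<le> ennreal K * transport_dist c (kernel_pow P n \<mu>) (kernel_pow P n \<nu>)"
    unfolding kernel_pow_Suc using fin_\<mu>[of "Suc n"] fin_\<nu>[of "Suc n"] unfolding kernel_pow_Suc
    by (intro transport_dist_bind_le[OF P _ _ cont_c cont_f c_nonneg c_le f_nonneg fin _ _ K step]
        kernel_pow_in_prob_algebra P \<mu> \<nu>)
  also have "\<dots> \<le> ennreal K * (ennreal (K ^ n) * transport_dist c \<mu> \<nu>)"
    by (intro mult_left_mono Suc) simp
  also have "\<dots> = ennreal (K ^ Suc n) * transport_dist c \<mu> \<nu>"
    using K by (simp add: ennreal_mult mult.assoc)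
  finally show ?case .
qed simp

text \<open>Cauchy-Schwarz under a nearly optimal coupling for \<open>c\<close>: the integral of the second factor depends on
the marginals only.\<close>

lemma transport_dist_sqrt_le:
  fixes \<mu> \<nu> :: "'a::second_countable_topology measure"
  assumes c [measurable]: "(\<lambda>z. c (fst z) (snd z)) \<in> borel_measurable (borel \<Otimes>\<^sub>M borel)"
    and V [measurable]: "V \<in> borel_measurable borel"
    and c_nonneg: "\<And>x y. 0 \<le> c x y" and V_nonneg: "\<And>x. 0 \<le> V x" and \<theta>: "0 \<le> \<theta>"
    and A: "0 \<le> A" "transport_dist c \<mu> \<nu> \<le> ennreal A"
    and B1: "0 \<le> B1" "(\<integral>\<^sup>+ x. ennreal (V x) \<partial>\<mu>) \<le> ennreal B1"
    and B2: "0 \<le> B2" "(\<integral>\<^sup>+ x. ennreal (V x) \<partial>\<nu>) \<le> ennreal B2"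
  shows "transport_dist (\<lambda>x y. sqrt (c x y * (2 + \<theta> * V x + \<theta> * V y))) \<mu> \<nu>
    \<le> ennreal (sqrt (A * (2 + \<theta> * B1 + \<theta> * B2)))"
proof (rule ennreal_le_epsilon)
  fix e :: real assume e: "0 < e"
  define B where "B = 2 + \<theta> * B1 + \<theta> * B2"
  have B: "0 < B" unfolding B_def using \<theta> B1(1) B2(1) by (intro add_pos_nonneg) auto
  define \<epsilon> where "\<epsilon> = e\<^sup>2 / B"
  have "0 < \<epsilon>" using e B by (simp add: \<epsilon>_def)
  have "transport_dist c \<mu> \<nu> < ennreal (A + \<epsilon>)"
    using A \<open>0 < \<epsilon>\<close> by (intro order.strict_trans1[OF A(2)]) (simp add: ennreal_less_iff)
  then obtain \<pi> where \<pi>: "\<pi> \<in> couplings \<mu> \<nu>"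
    and less: "(\<integral>\<^sup>+ z. ennreal (c (fst z) (snd z)) \<partial>\<pi>) < ennreal (A + \<epsilon>)"
    unfolding transport_dist_def by (auto simp: INF_less_iff)
  have s\<pi> [measurable_cong]: "sets \<pi> = sets (borel \<Otimes>\<^sub>M borel)"
    and d: "distr \<pi> borel fst = \<mu>" "distr \<pi> borel snd = \<nu>" and "prob_space \<pi>"
    using \<pi> by (auto simp: couplings_def)
  interpret \<pi>: prob_space \<pi> by fact
  let ?W = "\<lambda>z. 2 + \<theta> * V (fst z) + \<theta> * V (snd z)"
  have W_nonneg: "0 \<le> ?W z" for z using \<theta> V_nonneg by (intro add_nonneg_nonneg) auto
  have "(\<integral>\<^sup>+ z. ennreal (?W z) \<partial>\<pi>)
      = (\<integral>\<^sup>+ z. 2 + ennreal \<theta> * ennreal (V (fst z)) + ennreal \<theta> * ennreal (V (snd z)) \<partial>\<pi>)"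
    using \<theta> V_nonneg by (intro nn_integral_cong) (simp add: ennreal_plus ennreal_mult)
  also have "\<dots> = 2 + ennreal \<theta> * (\<integral>\<^sup>+ z. ennreal (V (fst z)) \<partial>\<pi>) + ennreal \<theta> * (\<integral>\<^sup>+ z. ennreal (V (snd z)) \<partial>\<pi>)"
    by (simp add: nn_integral_add nn_integral_cmult \<pi>.emeasure_space_1)
  also have "(\<integral>\<^sup>+ z. ennreal (V (fst z)) \<partial>\<pi>) = (\<integral>\<^sup>+ x. ennreal (V x) \<partial>\<mu>)"
    unfolding d[symmetric] by (subst nn_integral_distr) auto
  also have "(\<integral>\<^sup>+ z. ennreal (V (snd z)) \<partial>\<pi>) = (\<integral>\<^sup>+ x. ennreal (V x) \<partial>\<nu>)"
    unfolding d[symmetric] by (subst nn_integral_distr) auto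
  also have "2 + ennreal \<theta> * (\<integral>\<^sup>+ x. ennreal (V x) \<partial>\<mu>) + ennreal \<theta> * (\<integral>\<^sup>+ x. ennreal (V x) \<partial>\<nu>)
    \<le> 2 + ennreal \<theta> * ennreal B1 + ennreal \<theta> * ennreal B2"
    by (intro add_mono mult_left_mono B1 B2) auto
  also have "\<dots> = ennreal B"
    unfolding B_def using \<theta> B1 B2 by (simp add: ennreal_plus ennreal_mult)
  finally have intW: "(\<integral>\<^sup>+ z. ennreal (?W z) \<partial>\<pi>) \<le> ennreal B" .
  let ?I = "\<integral>\<^sup>+ z. ennreal (sqrt (c (fst z) (snd z) * ?W z)) \<partial>\<pi>"
  have "?I = (\<integral>\<^sup>+ z. ennreal (sqrt (c (fst z) (snd z))) * ennreal (sqrt (?W z)) \<partial>\<pi>)"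
    using c_nonneg W_nonneg by (intro nn_integral_cong) (simp add: real_sqrt_mult ennreal_mult)
  then have "?I\<^sup>2 \<le> (\<integral>\<^sup>+ z. (ennreal (sqrt (c (fst z) (snd z))))\<^sup>2 \<partial>\<pi>) * (\<integral>\<^sup>+ z. (ennreal (sqrt (?W z)))\<^sup>2 \<partial>\<pi>)"
    by (simp only:) (rule Cauchy_Schwarz_nn_integral; measurable)
  also have "\<dots> = (\<integral>\<^sup>+ z. ennreal (c (fst z) (snd z)) \<partial>\<pi>) * (\<integral>\<^sup>+ z. ennreal (?W z) \<partial>\<pi>)"
    using c_nonneg W_nonneg by (simp add: ennreal_power)
  also have "\<dots> \<le> ennreal (A + \<epsilon>) * ennreal B"
    using less intW by (intro mult_mono) auto
  also have "\<dots> = ennreal ((A + \<epsilon>) * B)"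
    using A \<open>0 < \<epsilon>\<close> B by (simp add: ennreal_mult)
  finally have I2: "?I\<^sup>2 \<le> ennreal ((A + \<epsilon>) * B)" .
  have nn: "0 \<le> (A + \<epsilon>) * B" using A \<open>0 < \<epsilon>\<close> B by simp
  have "?I \<le> ennreal (sqrt ((A + \<epsilon>) * B))"
  proof (cases ?I)
    case (real r)
    then have "r\<^sup>2 \<le> (A + \<epsilon>) * B" using I2 nn by (simp add: ennreal_power)
    then show ?thesis using real by (simp add: real_le_rsqrt ennreal_leI)
  next
    case top
    then show ?thesis using I2 by (simp add: top_unique)
  qed
  also have "sqrt ((A + \<epsilon>) * B) \<le> sqrt (A * B) + sqrt (\<epsilon> * B)"
    using A \<open>0 < \<epsilon>\<close> B by (simp add: distrib_right sqrt_add_le_add_sqrt)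
  also have "sqrt (\<epsilon> * B) = e" using B e by (simp add: \<epsilon>_def)
  finally have "?I \<le> ennreal (sqrt (A * B) + e)" by (simp add: ennreal_leI order_trans)
  moreover have "transport_dist (\<lambda>x y. sqrt (c x y * (2 + \<theta> * V x + \<theta> * V y))) \<mu> \<nu> \<le> ?I"
    unfolding transport_dist_def by (rule INF_lower[OF \<pi>, THEN order_trans]) simp
  ultimately show "transport_dist (\<lambda>x y. sqrt (c x y * (2 + \<theta> * V x + \<theta> * V y))) \<mu> \<nu>
    \<le> ennreal (sqrt (A * (2 + \<theta> * B1 + \<theta> * B2))) + ennreal e"
    using e A B by (simp add: B_def ennreal_plus)
qed

text \<open>There are three regimes. If \<open>c x y < 1\<close>, the factor \<open>\<alpha>\<close> is gained. If \<open>c x y = 1\<close> and \<open>V x + V y\<close> is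
large, the drift shrinks the factor \<open>2 + \<theta> * V x + \<theta> * V y\<close> for any \<open>\<theta>\<close>. If \<open>c x y = 1\<close> and
\<open>V x + V y\<close> is small, the factor \<open>1 - s\<close> is gained. In the first and the third regime the mean of \<open>V\<close>
may grow, but only by \<open>2 * J\<close> for the pair, so a small \<open>\<theta>\<close> keeps the product below its former value.\<close>

lemma weak_harris:
  fixes R :: "'a::second_countable_topology \<Rightarrow> 'a measure"
  assumes c [measurable]: "(\<lambda>z. c (fst z) (snd z)) \<in> borel_measurable (borel \<Otimes>\<^sub>M borel)"
    and V [measurable]: "V \<in> borel_measurable borel"
    and c_nonneg: "\<And>x y. 0 \<le> c x y" and c_le: "\<And>x y. c x y \<le> 1" and V_nonneg: "\<And>x. 0 \<le> V x"
    and l: "0 \<le> l" "l < 1" and J: "0 < J"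
    and drift: "\<And>x. (\<integral>\<^sup>+ y. ennreal (V y) \<partial>R x) \<le> ennreal (l * V x + J)"
    and \<alpha>: "0 \<le> \<alpha>" "\<alpha> < 1" and s: "0 < s" "s \<le> 1"
    and contr: "\<And>x y. c x y < 1 \<Longrightarrow> transport_dist c (R x) (R y) \<le> ennreal (\<alpha> * c x y)"
    and triv: "\<And>x y. transport_dist c (R x) (R y) \<le> 1"
    and small: "\<And>x y. V x + V y \<le> 4 * J / (1 - l) \<Longrightarrow> transport_dist c (R x) (R y) \<le> ennreal (1 - s)"
  shows "\<exists>\<theta>>0. \<exists>\<gamma>\<in>{0<..<1}. \<forall>x y.
     transport_dist (\<lambda>x y. sqrt (c x y * (2 + \<theta> * V x + \<theta> * V y))) (R x) (R y)
       \<le> ennreal (\<gamma> * sqrt (c x y * (2 + \<theta> * V x + \<theta> * V y)))"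
proof -
  define \<kappa> where "\<kappa> = max \<alpha> (1 - s)"
  have \<kappa>: "0 \<le> \<kappa>" "\<kappa> < 1" "\<alpha> \<le> \<kappa>" "1 - s \<le> \<kappa>" using \<alpha> s by (auto simp: \<kappa>_def)
  define \<theta> where "\<theta> = (1 - \<kappa>) / (2 * J)"
  have \<theta>: "0 < \<theta>" and \<theta>J: "\<theta> * J = (1 - \<kappa>) / 2" using \<kappa> J by (auto simp: \<theta>_def)
  have \<kappa>\<theta>: "\<kappa> * (1 + \<theta> * J) \<le> (1 + \<kappa>) / 2"
  proof -
    have "\<kappa> * ((1 - \<kappa>) / 2) \<le> 1 * ((1 - \<kappa>) / 2)" using \<kappa> by (intro mult_right_mono) auto
    then show ?thesis unfolding \<theta>J by (simp add: field_simps)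
  qed
  define C where "C = 4 * J / (1 - l)"
  have C: "0 < C" and CJ: "2 * J = (1 - l) * C / 2" using l J by (auto simp: C_def)
  \<comment> \<open>The relative decrease of 2 + \<theta> * W at W = C, where it is smallest among all W \<ge> C.\<close>
  define \<delta> where "\<delta> = \<theta> * (1 - l) * C / (2 * (2 + \<theta> * C))"
  have \<theta>C: "0 < 2 + \<theta> * C" using \<theta> C by (intro add_pos_pos) auto
  have \<delta>: "0 < \<delta>" using \<theta> C \<theta>C l by (simp add: \<delta>_def)
  define g where "g = max ((1 + \<kappa>) / 2) (1 - \<delta>)"
  have g: "0 < g" "g < 1" using \<kappa> \<delta> by (auto simp: g_def less_max_iff_disj)
  show ?thesis
  proof (intro exI[of _ \<theta>] conjI bexI[of _ "sqrt g"] allI)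
    show "sqrt g \<in> {0<..<1}" using g by simp
    fix x y
    define W where "W = V x + V y"
    have W: "0 \<le> W" using V_nonneg by (simp add: W_def)
    have bound: "transport_dist (\<lambda>x y. sqrt (c x y * (2 + \<theta> * V x + \<theta> * V y))) (R x) (R y)
       \<le> ennreal (sqrt (A * (2 + \<theta> * (l * W + 2 * J))))" if "0 \<le> A" "transport_dist c (R x) (R y) \<le> ennreal A" for A
      using transport_dist_sqrt_le[OF c V c_nonneg V_nonneg _ that _ drift _ drift, of \<theta>] \<theta> l J V_nonneg
      by (simp add: W_def algebra_simps)
    have aux: "2 + \<theta> * (l * W + 2 * J) \<le> (1 + \<theta> * J) * (2 + \<theta> * W)"
    proof -
      have "0 \<le> (1 - l) * (\<theta> * W) + \<theta> * J * (\<theta> * W)"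
        using l \<theta> J W by (intro add_nonneg_nonneg mult_nonneg_nonneg) auto
      then show ?thesis by (simp add: algebra_simps)
    qed
    have W2: "0 \<le> 2 + \<theta> * W" using \<theta> W by simp
    have fin: "transport_dist (\<lambda>x y. sqrt (c x y * (2 + \<theta> * V x + \<theta> * V y))) (R x) (R y)
       \<le> ennreal (sqrt g * sqrt (c x y * (2 + \<theta> * V x + \<theta> * V y)))"
      if A: "0 \<le> A" "transport_dist c (R x) (R y) \<le> ennreal A"
        and le: "A * (2 + \<theta> * (l * W + 2 * J)) \<le> g * (c x y * (2 + \<theta> * W))" for A
    proof -
      have "sqrt (A * (2 + \<theta> * (l * W + 2 * J))) \<le> sqrt g * sqrt (c x y * (2 + \<theta> * V x + \<theta> * V y))"
        using le by (simp add: real_sqrt_mult[symmetric] W_def distrib_left add.assoc)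
      then show ?thesis using bound[OF A] by (meson ennreal_leI order_trans)
    qed
    have \<kappa>case: "a * (2 + \<theta> * (l * W + 2 * J)) \<le> g * (2 + \<theta> * W)" if "a \<le> \<kappa>" "0 \<le> a" for a
    proof -
      have "a * (2 + \<theta> * (l * W + 2 * J)) \<le> \<kappa> * ((1 + \<theta> * J) * (2 + \<theta> * W))"
        using that aux \<theta> l W J by (intro mult_mono) (auto intro!: add_nonneg_nonneg mult_nonneg_nonneg)
      also have "\<dots> \<le> (1 + \<kappa>) / 2 * (2 + \<theta> * W)"
        unfolding mult.assoc[symmetric] by (intro mult_right_mono \<kappa>\<theta> W2)
      also have "\<dots> \<le> g * (2 + \<theta> * W)" by (intro mult_right_mono W2) (simp add: g_def)
      finally show ?thesis .
    qed
    show "transport_dist (\<lambda>x y. sqrt (c x y * (2 + \<theta> * V x + \<theta> * V y))) (R x) (R y)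
       \<le> ennreal (sqrt g * sqrt (c x y * (2 + \<theta> * V x + \<theta> * V y)))"
    proof (cases "c x y < 1")
      case True
      have "\<alpha> * (2 + \<theta> * (l * W + 2 * J)) * c x y \<le> g * (2 + \<theta> * W) * c x y"
        using \<kappa>case[of \<alpha>] \<alpha> \<kappa> c_nonneg by (intro mult_right_mono) auto
      then show ?thesis
        using \<alpha> c_nonneg by (intro fin[OF _ contr[OF True]]) (auto simp: ac_simps)
    next
      case False
      then have c1: "c x y = 1" using c_le[of x y] by simp
      show ?thesis
      proof (cases "W \<le> C")
        case True
        have "(1 - s) * (2 + \<theta> * (l * W + 2 * J)) \<le> g * (c x y * (2 + \<theta> * W))"
          using \<kappa>case[of "1 - s"] \<kappa> s by (simp add: c1)
        then show ?thesis using s True by (intro fin[OF _ small]) (auto simp: W_def C_def)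
      next
        case W': False
        have "\<delta> * (2 + \<theta> * W) \<le> \<theta> * (1 - l) * W / 2"
        proof -
          have "C * (2 + \<theta> * W) \<le> W * (2 + \<theta> * C)" using W' by (simp add: algebra_simps)
          then have "\<theta> * (1 - l) * (C * (2 + \<theta> * W)) \<le> \<theta> * (1 - l) * (W * (2 + \<theta> * C))"
            using \<theta> l by (intro mult_left_mono) auto
          then have "\<theta> * (1 - l) * (C * (2 + \<theta> * W)) / (2 * (2 + \<theta> * C))
              \<le> \<theta> * (1 - l) * (W * (2 + \<theta> * C)) / (2 * (2 + \<theta> * C))"
            using \<theta>C by (intro divide_right_mono) auto
          also have "\<dots> = \<theta> * (1 - l) * W / 2"
          proof -
            have "t * (W * E) / (2 * E) = t * W / 2" if "0 < E" for t E :: real using that by simp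
            from this[OF \<theta>C] show ?thesis .
          qed
          finally show ?thesis by (simp add: \<delta>_def mult_ac)
        qed
        moreover have "\<theta> * (2 * J) \<le> \<theta> * ((1 - l) * W / 2)"
          unfolding CJ using \<theta> l W' by (intro mult_left_mono divide_right_mono) auto
        ultimately have "2 + \<theta> * (l * W + 2 * J) \<le> (1 - \<delta>) * (2 + \<theta> * W)"
          by (simp add: algebra_simps)
        also have "\<dots> \<le> g * (2 + \<theta> * W)" by (intro mult_right_mono W2) (simp add: g_def)
        finally show ?thesis
          using triv[of x y] by (intro fin[of 1]) (auto simp: c1)
      qed
    qed
  qed (rule \<theta>)
qed

section \<open>Coupling one step of the RCAR-MH kernel\<close>

lemma d_q_nonneg: "0 < \<omega> \<Longrightarrow> 0 \<le> d_q q \<omega> \<eta> u v"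
  by (simp add: d_q_def)

lemma d_q_le_1: "d_q q \<omega> \<eta> u v \<le> 1"
  by (simp add: d_q_def)

lemma continuous_on_d_q:
  assumes "0 \<le> \<eta>"
  shows "continuous_on UNIV (\<lambda>z :: 'a::real_normed_vector \<times> 'a. d_q q \<omega> \<eta> (fst z) (snd z))"
proof -
  have "0 < 1 + \<eta> * norm (fst z) + \<eta> * norm (snd z)" for z :: "'a \<times> 'a"
    using assms by (intro add_pos_nonneg) auto
  then have "1 + \<eta> * norm (fst z) + \<eta> * norm (snd z) \<noteq> 0" for z :: "'a \<times> 'a" by (metis less_irrefl)
  then show ?thesis unfolding d_q_def divide_inverse
    by (intro continuous_intros) auto
qed

lemma borel_measurable_d_q [measurable]:
  assumes "0 \<le> \<eta>"
  shows "(\<lambda>z :: 'a::{real_normed_vector, second_countable_topology} \<times> 'a. d_q q \<omega> \<eta> (fst z) (snd z))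
    \<in> borel_measurable (borel \<Otimes>\<^sub>M borel)"
  using borel_measurable_continuous_onI[OF continuous_on_d_q[OF assms]] by (simp add: borel_prod)

lemma abs_acceptance_diff_le:
  "\<bar>acceptance Psi u x - acceptance Psi v y\<bar> \<le> \<bar>Psi u - Psi v\<bar> + \<bar>Psi x - Psi y\<bar>"
proof -
  have lip: "min 1 (exp s) - min 1 (exp t) \<le> \<bar>s - t\<bar>" for s t :: real
  proof (cases "s \<le> t \<or> 0 \<le> t")
    case True
    have "min 1 (exp s) \<le> min 1 (exp t)"
    proof (cases "0 \<le> t")
      case True
      then have "min 1 (exp t) = 1" by simp
      then show ?thesis by simp
    next
      case False
      then show ?thesis using True by (intro min.mono) auto
    qed
    then show ?thesis by linarith
  next
    case False
    then have st: "t < s" "t < 0" by auto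
    define s' where "s' = min s 0"
    have s': "min 1 (exp s) = exp s'" "t \<le> s'" "s' \<le> s" "s' \<le> 0" using st by (auto simp: s'_def min_def)
    have e: "1 - exp (t - s') \<le> s' - t" using exp_ge_add_one_self[of "t - s'"] by linarith
    have "exp s' - exp t = exp s' * (1 - exp (t - s'))" by (simp add: algebra_simps exp_diff)
    also have "\<dots> \<le> 1 * (s' - t)"
      using s' e by (intro mult_mono) auto
    finally show ?thesis using st s' by (auto simp: min_def)
  qed
  have "\<bar>min 1 (exp s) - min 1 (exp t)\<bar> \<le> \<bar>s - t\<bar>" for s t :: real
    using lip[of s t] lip[of t s] abs_minus_commute[of s t] by linarith
  from this[of "Psi u - Psi x" "Psi v - Psi y"] show ?thesis
    unfolding acceptance_def by linarith
qed

lemma acceptance_nonneg: "0 \<le> acceptance Psi u v" and acceptance_le_1: "acceptance Psi u v \<le> 1"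
  by (auto simp: acceptance_def)

text \<open>The noise is integrated last, so that estimates can be made for a fixed value of the noise.\<close>

lemma nn_integral_rcar_mh:
  fixes K :: "'a::{banach, second_countable_topology} \<Rightarrow> 'a measure"
  assumes Psi [measurable]: "Psi \<in> borel_measurable borel"
    and K: "K \<in> borel \<rightarrow>\<^sub>M prob_algebra borel"
    and lam: "prob_space lam" "sets lam = sets borel"
    and f [measurable]: "f \<in> borel_measurable borel"
  shows "(\<integral>\<^sup>+ y. f y \<partial>rcar_mh Psi K lam u) =
    (\<integral>\<^sup>+ x. \<integral>\<^sup>+ z. ennreal (acceptance Psi u (z + x)) * f (z + x) + ennreal (1 - acceptance Psi u (z + x)) * f u \<partial>K u \<partial>lam)"
proof -
  note [measurable_cong] = lam(2)
  have Ku: "prob_space (K u)" and sK [measurable_cong]: "sets (K u) = sets borel"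
    using measurable_space[OF K, of u] by (auto simp: space_prob_algebra)
  interpret Ku: prob_space "K u" by fact
  interpret lam: prob_space lam by fact
  interpret pair_prob_space "K u" lam ..
  let ?Q = "rcar_proposal K lam u"
  have [measurable]: "acceptance Psi u \<in> borel_measurable borel"
    unfolding acceptance_def by measurable
  let ?c = "\<integral>\<^sup>+ w. ennreal (1 - acceptance Psi u w) \<partial>?Q"
  have "rcar_mh Psi K lam u = add_measure (density ?Q (\<lambda>v. ennreal (acceptance Psi u v))) (scale_measure ?c (return borel u))"
    by (rule measure_eqI)
      (auto simp: emeasure_rcar_mh[OF Psi] emeasure_add_measure emeasure_density mult.commute)
  then have "(\<integral>\<^sup>+ y. f y \<partial>rcar_mh Psi K lam u)
      = (\<integral>\<^sup>+ y. f y \<partial>density ?Q (\<lambda>v. ennreal (acceptance Psi u v))) + (\<integral>\<^sup>+ y. f y \<partial>scale_measure ?c (return borel u))"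
    by (simp add: nn_integral_add_measure)
  also have "(\<integral>\<^sup>+ y. f y \<partial>scale_measure ?c (return borel u)) = ?c * f u"
    by (simp add: nn_integral_scale_measure nn_integral_return)
  also have "(\<integral>\<^sup>+ y. f y \<partial>density ?Q (\<lambda>v. ennreal (acceptance Psi u v))) = (\<integral>\<^sup>+ y. ennreal (acceptance Psi u y) * f y \<partial>?Q)"
    by (rule nn_integral_density) measurable
  also have "(\<integral>\<^sup>+ y. ennreal (acceptance Psi u y) * f y \<partial>?Q) + ?c * f u
    = (\<integral>\<^sup>+ y. ennreal (acceptance Psi u y) * f y + ennreal (1 - acceptance Psi u y) * f u \<partial>?Q)"
    by (simp add: nn_integral_add nn_integral_multc)
  also have "\<dots> = (\<integral>\<^sup>+ zx. ennreal (acceptance Psi u (fst zx + snd zx)) * f (fst zx + snd zx)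
      + ennreal (1 - acceptance Psi u (fst zx + snd zx)) * f u \<partial>(K u \<Otimes>\<^sub>M lam))"
    unfolding rcar_proposal_def by (subst nn_integral_distr) (auto simp: case_prod_beta')
  also have "\<dots> = (\<integral>\<^sup>+ x. \<integral>\<^sup>+ z. ennreal (acceptance Psi u (z + x)) * f (z + x) + ennreal (1 - acceptance Psi u (z + x)) * f u \<partial>K u \<partial>lam)"
    by (subst nn_integral_snd[symmetric]) auto
  finally show ?thesis .
qed

text \<open>Both chains use the coupled proposals with the same noise and the same uniform variable for their
decisions: both accept with probability \<open>min\<close>, and both reject with probability \<open>1 - max\<close>, of the
two acceptance probabilities. This is a sub-coupling that misses the mass of the differing
decisions, and that mass costs at most 1 per unit.\<close>

lemma transport_dist_rcar_mh_le:
  fixes K :: "'a::{banach, second_countable_topology} \<Rightarrow> 'a measure"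
  assumes Psi [measurable]: "Psi \<in> borel_measurable borel"
    and K: "K \<in> borel \<rightarrow>\<^sub>M prob_algebra borel"
    and lam: "prob_space lam" "sets lam = sets borel"
    and \<pi>: "\<pi> \<in> couplings (K u) (K v)"
    and d [measurable]: "(\<lambda>z. d (fst z) (snd z)) \<in> borel_measurable (borel \<Otimes>\<^sub>M borel)"
    and d_nonneg: "\<And>x y. 0 \<le> d x y" and d_le: "\<And>x y. d x y \<le> 1"
  shows "transport_dist d (rcar_mh Psi K lam u) (rcar_mh Psi K lam v) \<le>
    (\<integral>\<^sup>+ x. \<integral>\<^sup>+ z. ennreal (acceptance Psi u (fst z + x) * d (fst z + x) (snd z + x)
        + (1 - acceptance Psi u (fst z + x)) * d u v
        + \<bar>acceptance Psi u (fst z + x) - acceptance Psi v (snd z + x)\<bar>) \<partial>\<pi> \<partial>lam)"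
proof -
  note [measurable_cong] = lam(2)
  have s\<pi> [measurable_cong]: "sets \<pi> = sets (borel \<Otimes>\<^sub>M borel)"
    and m\<pi>: "distr \<pi> borel fst = K u" "distr \<pi> borel snd = K v" and "prob_space \<pi>"
    using \<pi> by (auto simp: couplings_def)
  interpret \<pi>: prob_space \<pi> by fact
  interpret lam: prob_space lam by fact
  interpret M: pair_prob_space lam \<pi> ..
  define M where "M = lam \<Otimes>\<^sub>M \<pi>"
  have sM [measurable_cong]: "sets M = sets (borel \<Otimes>\<^sub>M (borel \<Otimes>\<^sub>M borel))"
    unfolding M_def by (intro sets_pair_measure_cong lam s\<pi>)
  have acc [measurable]: "acceptance Psi w \<in> borel_measurable borel" for w
    unfolding acceptance_def by measurable
  define A where "A m = acceptance Psi u (fst (snd m) + fst m)" for m :: "'a \<times> 'a \<times> 'a"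
  define A' where "A' m = acceptance Psi v (snd (snd m) + fst m)" for m :: "'a \<times> 'a \<times> 'a"
  define X where "X m = (fst (snd m) + fst m, snd (snd m) + fst m)" for m :: "'a \<times> 'a \<times> 'a"
  have [measurable]: "A \<in> borel_measurable (borel \<Otimes>\<^sub>M (borel \<Otimes>\<^sub>M borel))" "A' \<in> borel_measurable (borel \<Otimes>\<^sub>M (borel \<Otimes>\<^sub>M borel))"
      "X \<in> borel \<Otimes>\<^sub>M (borel \<Otimes>\<^sub>M borel) \<rightarrow>\<^sub>M borel \<Otimes>\<^sub>M borel"
    unfolding A_def A'_def X_def by measurable
  have A01: "0 \<le> A m" "A m \<le> 1" "0 \<le> A' m" "A' m \<le> 1" for m
    by (auto simp: A_def A'_def acceptance_nonneg acceptance_le_1)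
  have int_M: "(\<integral>\<^sup>+ m. g m \<partial>M) = (\<integral>\<^sup>+ x. \<integral>\<^sup>+ z. g (x, z) \<partial>\<pi> \<partial>lam)"
    if [measurable]: "g \<in> borel_measurable (borel \<Otimes>\<^sub>M (borel \<Otimes>\<^sub>M borel))" for g
    unfolding M_def by (rule \<pi>.nn_integral_fst[symmetric]) (simp add: M_def[symmetric])
  define cc where "cc = (\<integral>\<^sup>+ m. ennreal (1 - max (A m) (A' m)) \<partial>M)"
  define \<sigma> where "\<sigma> = add_measure (distr (density M (\<lambda>m. ennreal (min (A m) (A' m)))) (borel \<Otimes>\<^sub>M borel) X)
      (scale_measure cc (return (borel \<Otimes>\<^sub>M borel) (u, v)))"
  have s\<sigma>: "sets \<sigma> = sets (borel \<Otimes>\<^sub>M borel)" by (simp add: \<sigma>_def)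
  have int_\<sigma>: "(\<integral>\<^sup>+ y. g y \<partial>\<sigma>) = (\<integral>\<^sup>+ m. ennreal (min (A m) (A' m)) * g (X m) + ennreal (1 - max (A m) (A' m)) * g (u, v) \<partial>M)"
    if [measurable]: "g \<in> borel_measurable (borel \<Otimes>\<^sub>M borel)" for g
  proof -
    have "(\<integral>\<^sup>+ y. g y \<partial>\<sigma>) = (\<integral>\<^sup>+ y. g y \<partial>distr (density M (\<lambda>m. ennreal (min (A m) (A' m)))) (borel \<Otimes>\<^sub>M borel) X)
      + (\<integral>\<^sup>+ y. g y \<partial>scale_measure cc (return (borel \<Otimes>\<^sub>M borel) (u, v)))"
      unfolding \<sigma>_def by (rule nn_integral_add_measure) auto
    also have "(\<integral>\<^sup>+ y. g y \<partial>scale_measure cc (return (borel \<Otimes>\<^sub>M borel) (u, v))) = cc * g (u, v)"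
      by (simp add: nn_integral_scale_measure nn_integral_return space_pair_measure)
    also have "(\<integral>\<^sup>+ y. g y \<partial>distr (density M (\<lambda>m. ennreal (min (A m) (A' m)))) (borel \<Otimes>\<^sub>M borel) X)
      = (\<integral>\<^sup>+ m. ennreal (min (A m) (A' m)) * g (X m) \<partial>M)"
      by (simp add: nn_integral_distr nn_integral_density)
    finally show ?thesis by (simp add: cc_def nn_integral_add nn_integral_multc)
  qed
  have int_u: "(\<integral>\<^sup>+ y. g y \<partial>rcar_mh Psi K lam u)
      = (\<integral>\<^sup>+ m. ennreal (A m) * g (fst (X m)) + ennreal (1 - A m) * g u \<partial>M)"
    if [measurable]: "g \<in> borel_measurable borel" for g
    by (subst nn_integral_rcar_mh[OF Psi K lam that], subst int_M)
      (auto simp: m\<pi>(1)[symmetric] nn_integral_distr A_def X_def)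
  have int_v: "(\<integral>\<^sup>+ y. g y \<partial>rcar_mh Psi K lam v)
      = (\<integral>\<^sup>+ m. ennreal (A' m) * g (snd (X m)) + ennreal (1 - A' m) * g v \<partial>M)"
    if [measurable]: "g \<in> borel_measurable borel" for g
    by (subst nn_integral_rcar_mh[OF Psi K lam that], subst int_M)
      (auto simp: m\<pi>(2)[symmetric] nn_integral_distr A'_def X_def)
  have prob: "prob_space (rcar_mh Psi K lam w)" for w
    using measurable_space[OF rcar_mh_measurable[OF Psi K lam], of w] by (simp add: space_prob_algebra)
  let ?T = "transport_dist d (rcar_mh Psi K lam u) (rcar_mh Psi K lam v)"
  have half: "(\<integral>\<^sup>+ y. ennreal (1 / 2) \<partial>rcar_mh Psi K lam w) = ennreal (1 / 2)" for w
    using prob_space.emeasure_space_1[OF prob[of w]] by simp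
  have le1: "?T + (\<integral>\<^sup>+ z. ennreal (1 / 2 + 1 / 2 - d (fst z) (snd z)) \<partial>\<sigma>)
    \<le> (\<integral>\<^sup>+ y. ennreal (1 / 2) \<partial>rcar_mh Psi K lam u) + (\<integral>\<^sup>+ y. ennreal (1 / 2) \<partial>rcar_mh Psi K lam v)"
  proof (rule transport_dist_add_subcoupling_le[OF prob prob _ _ s\<sigma> _ _ d, where f="\<lambda>_. 1 / 2"])
    fix B :: "'a set" assume B [measurable]: "B \<in> sets borel"
    have "emeasure \<sigma> (B \<times> UNIV) = (\<integral>\<^sup>+ y. indicator (B \<times> UNIV) y \<partial>\<sigma>)"
      by (simp add: s\<sigma>)
    also have "\<dots> \<le> (\<integral>\<^sup>+ m. ennreal (A m) * indicator B (fst (X m)) + ennreal (1 - A m) * indicator B u \<partial>M)"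
      by (subst int_\<sigma>) (auto intro!: nn_integral_mono add_mono ennreal_leI simp: indicator_def)
    also have "\<dots> = emeasure (rcar_mh Psi K lam u) B"
      using int_u[of "indicator B"] by simp
    finally show "emeasure \<sigma> (B \<times> UNIV) \<le> emeasure (rcar_mh Psi K lam u) B" .
    have "emeasure \<sigma> (UNIV \<times> B) = (\<integral>\<^sup>+ y. indicator (UNIV \<times> B) y \<partial>\<sigma>)"
      by (simp add: s\<sigma>)
    also have "\<dots> \<le> (\<integral>\<^sup>+ m. ennreal (A' m) * indicator B (snd (X m)) + ennreal (1 - A' m) * indicator B v \<partial>M)"
      by (subst int_\<sigma>) (auto intro!: nn_integral_mono add_mono ennreal_leI simp: indicator_def)
    also have "\<dots> = emeasure (rcar_mh Psi K lam v) B"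
      using int_v[of "indicator B"] by simp
    finally show "emeasure \<sigma> (UNIV \<times> B) \<le> emeasure (rcar_mh Psi K lam v) B" .
  qed (use d_nonneg d_le in auto)
  define G where "G m = min (A m) (A' m) * (1 - d (fst (X m)) (snd (X m))) + (1 - max (A m) (A' m)) * (1 - d u v)" for m
  define H where "H m = A m * d (fst (X m)) (snd (X m)) + (1 - A m) * d u v + \<bar>A m - A' m\<bar>" for m
  have G_nonneg: "0 \<le> G m" for m
    using A01[of m] d_le unfolding G_def by (intro add_nonneg_nonneg mult_nonneg_nonneg) auto
  have H_nonneg: "0 \<le> H m" for m
    using A01[of m] d_nonneg unfolding H_def by (intro add_nonneg_nonneg mult_nonneg_nonneg) auto
  have GH: "1 \<le> G m + H m" for m
  proof (cases "A m \<le> A' m")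
    case True
    then have "0 \<le> (A' m - A m) * d u v" using d_nonneg by (intro mult_nonneg_nonneg) auto
    with True show ?thesis by (simp add: G_def H_def algebra_simps)
  next
    case False
    then have "0 \<le> (A m - A' m) * d (fst (X m)) (snd (X m))" using d_nonneg by (intro mult_nonneg_nonneg) auto
    with False show ?thesis by (simp add: G_def H_def algebra_simps)
  qed
  have [measurable]: "G \<in> borel_measurable (borel \<Otimes>\<^sub>M (borel \<Otimes>\<^sub>M borel))" "H \<in> borel_measurable (borel \<Otimes>\<^sub>M (borel \<Otimes>\<^sub>M borel))"
    unfolding G_def H_def by measurable
  have "(\<integral>\<^sup>+ z. ennreal (1 / 2 + 1 / 2 - d (fst z) (snd z)) \<partial>\<sigma>) = (\<integral>\<^sup>+ m. ennreal (G m) \<partial>M)"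
    using A01 d_le by (subst int_\<sigma>) (auto intro!: nn_integral_cong simp: G_def ennreal_mult ennreal_plus mult_nonneg_nonneg)
  with le1 have "(\<integral>\<^sup>+ m. ennreal (G m) \<partial>M) + ?T \<le> ennreal (1 / 2) + ennreal (1 / 2)"
    unfolding half by (simp add: add.commute)
  also have "\<dots> = (\<integral>\<^sup>+ m. 1 \<partial>M)"
    using M.emeasure_space_1 by (subst ennreal_plus[symmetric]) (auto simp: M_def[symmetric])
  also have "\<dots> \<le> (\<integral>\<^sup>+ m. ennreal (G m) + ennreal (H m) \<partial>M)"
    using GH G_nonneg H_nonneg by (intro nn_integral_mono) (simp flip: ennreal_plus)
  also have "\<dots> = (\<integral>\<^sup>+ m. ennreal (G m) \<partial>M) + (\<integral>\<^sup>+ m. ennreal (H m) \<partial>M)"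
    by (rule nn_integral_add) measurable
  finally have "(\<integral>\<^sup>+ m. ennreal (G m) \<partial>M) = \<infinity> \<or> ?T \<le> (\<integral>\<^sup>+ m. ennreal (H m) \<partial>M)"
    unfolding ennreal_add_left_cancel_le by simp
  moreover have "(\<integral>\<^sup>+ m. ennreal (G m) \<partial>M) < \<infinity>"
  proof -
    have "G m \<le> 2" for m
    proof -
      have "min (A m) (A' m) * (1 - d (fst (X m)) (snd (X m))) \<le> 1 * 1"
        using A01[of m] d_nonneg d_le by (intro mult_mono) auto
      moreover have "(1 - max (A m) (A' m)) * (1 - d u v) \<le> 1 * 1"
        using A01[of m] d_nonneg d_le by (intro mult_mono) auto
      ultimately show ?thesis by (simp add: G_def)
    qed
    then have "(\<integral>\<^sup>+ m. ennreal (G m) \<partial>M) \<le> (\<integral>\<^sup>+ m. 2 \<partial>M)"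
      by (intro nn_integral_mono) (metis ennreal_leI ennreal_numeral zero_le_numeral)
    also have "\<dots> < \<infinity>" using M.emeasure_space_1 by (simp add: M_def[symmetric])
    finally show ?thesis .
  qed
  ultimately have "?T \<le> (\<integral>\<^sup>+ m. ennreal (H m) \<partial>M)" by auto
  also have "\<dots> = (\<integral>\<^sup>+ x. \<integral>\<^sup>+ z. ennreal (H (x, z)) \<partial>\<pi> \<partial>lam)" by (rule int_M) measurable
  finally show ?thesis by (simp add: H_def A_def A'_def X_def)
qed

section \<open>Contraction of the cost\<close>

text \<open>The hypotheses with their constants named. The Lipschitz bound carries the weight
\<open>(1 + norm u + norm v) powr q\<close>, the form that the weight of \<open>d_q\<close> absorbs; in this form the bound with
\<open>q = 0\<close> implies the one with \<open>q = 1\<close>.\<close>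

locale rcar =
  fixes Psi :: "'a::{banach, second_countable_topology} \<Rightarrow> real"
    and K :: "'a \<Rightarrow> 'a measure" and lam :: "'a measure"
    and q :: real and p :: nat and L b0 \<beta>0 \<epsilon>0 \<beta>c :: real
    and coup :: "'a \<Rightarrow> 'a \<Rightarrow> ('a \<times> 'a) measure"
  assumes Psi [measurable]: "Psi \<in> borel_measurable borel"
    and K: "K \<in> borel \<rightarrow>\<^sub>M prob_algebra borel"
    and lam: "prob_space lam" "sets lam = sets borel"
    and q: "0 \<le> q" "q \<le> real p" and p: "1 \<le> p"
    and L: "0 < L" and Lip: "\<And>u v. \<bar>Psi u - Psi v\<bar> \<le> L * (1 + norm u + norm v) powr q * norm (u - v)"
    and retract: "\<And>\<beta> b. 0 < \<beta> \<Longrightarrow> \<beta> < 1 \<Longrightarrow> 0 < b \<Longrightarrow> b < 1 \<Longrightarrow>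
        \<exists>R0>0. \<exists>M4>0. \<forall>u. norm u > R0 \<longrightarrow>
        (INF v\<in>cball (\<beta> *\<^sub>R u) (b * (1 - \<beta>) * norm u). exp (Psi u - Psi v)) \<ge> M4"
    and K_norm: "\<And>u. AE z in K u. norm z \<le> norm u"
    and K_ball: "0 < b0" "b0 < \<beta>0" "\<beta>0 < 1" "0 < \<epsilon>0"
      "\<And>u. \<epsilon>0 \<le> measure (K u) {z. norm (z - \<beta>0 *\<^sub>R u) \<le> b0 * (1 - \<beta>0) * norm u}"
    and coup: "\<And>u v. coup u v \<in> couplings (K u) (K v)"
    and coup_norm: "\<And>u v. AE z in coup u v. norm (fst z - snd z) \<le> norm (u - v)"
    and \<beta>c: "0 < \<beta>c" "\<beta>c < 1"
    and coup_mean: "\<And>u v. (\<integral>\<^sup>+ z. ennreal (norm (fst z - snd z)) \<partial>coup u v) \<le> ennreal (\<beta>c * norm (u - v))"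
    and moment: "integrable lam (\<lambda>x. norm x ^ p)"
begin

sublocale lam: prob_space lam by (rule lam)

lemmas sets_lam [measurable_cong, simp] = lam(2)

lemma space_lam [simp]: "space lam = UNIV"
  using sets_eq_imp_space_eq[OF sets_lam] by simp

lemma prob_lam_UNIV [simp]: "measure lam UNIV = 1"
  using lam.prob_space by simp

lemma prob_K: "prob_space (K u)" and sets_K [measurable_cong, simp]: "sets (K u) = sets borel"
  using measurable_space[OF K, of u] by (auto simp: space_prob_algebra)

lemma space_K [simp]: "space (K u) = UNIV"
  using sets_eq_imp_space_eq[OF sets_K] by simp

lemma prob_coup: "prob_space (coup u v)"
  and sets_coup [measurable_cong, simp]: "sets (coup u v) = sets (borel \<Otimes>\<^sub>M borel)"
  and fst_coup: "distr (coup u v) borel fst = K u"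
  and snd_coup: "distr (coup u v) borel snd = K v"
  using coup[of u v] by (auto simp: couplings_def)

lemma space_coup [simp]: "space (coup u v) = UNIV"
  using sets_eq_imp_space_eq[OF sets_coup] by (simp add: space_pair_measure)

lemma AE_coup_fst: "AE z in coup u v. norm (fst z) \<le> norm u"
proof -
  have "AE z in distr (coup u v) borel fst. norm z \<le> norm u" unfolding fst_coup by (rule K_norm)
  then show ?thesis by (subst (asm) AE_distr_iff) auto
qed

lemma AE_coup_snd: "AE z in coup u v. norm (snd z) \<le> norm v"
proof -
  have "AE z in distr (coup u v) borel snd. norm z \<le> norm v" unfolding snd_coup by (rule K_norm)
  then show ?thesis by (subst (asm) AE_distr_iff) auto
qed

abbreviation "P \<equiv> rcar_mh Psi K lam"

lemma P: "P \<in> borel \<rightarrow>\<^sub>M prob_algebra borel"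
  by (rule rcar_mh_measurable[OF Psi K lam])

text \<open>The moment of the noise to which all error terms are reduced: \<open>(1 + 2 * norm x) ^ p\<close> bounds the
growth of every weight when noise \<open>x\<close> is added to both points of a pair.\<close>

definition "B = (\<integral>x. (1 + 2 * norm x) ^ p \<partial>lam)"

lemma integrable_B: "integrable lam (\<lambda>x. (1 + 2 * norm x) ^ p)"
proof (rule Bochner_Integration.integrable_bound)
  show "integrable lam (\<lambda>x. 3 ^ p * (1 + norm x ^ p))"
    by (intro integrable_mult_right Bochner_Integration.integrable_add moment) simp
  show "AE x in lam. norm ((1 + 2 * norm x) ^ p) \<le> norm (3 ^ p * (1 + norm x ^ p))"
  proof (rule AE_I2)
    fix x :: 'a
    have "(1 + 2 * norm x) ^ p \<le> 3 ^ p * (1 + norm x ^ p)"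
    proof (cases "norm x \<le> 1")
      case True
      then have "(1 + 2 * norm x) ^ p \<le> 3 ^ p" by (intro power_mono) auto
      also have "\<dots> \<le> 3 ^ p * (1 + norm x ^ p)" by simp
      finally show ?thesis .
    next
      case False
      then have "(1 + 2 * norm x) ^ p \<le> (3 * norm x) ^ p" by (intro power_mono) auto
      also have "\<dots> \<le> 3 ^ p * (1 + norm x ^ p)" by (simp add: power_mult_distrib)
      finally show ?thesis .
    qed
    then show "norm ((1 + 2 * norm x) ^ p) \<le> norm (3 ^ p * (1 + norm x ^ p))" by simp
  qed
qed simp

lemma B_ge_1: "1 \<le> B"
proof -
  have "(\<integral>x. 1 \<partial>lam) \<le> B" unfolding B_def
    by (intro integral_mono integrable_B) (auto intro: one_le_power)
  then show ?thesis using lam.prob_space by simp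
qed

lemma exists_noise_radius: "\<exists>r>0. 0 < measure lam (cball 0 r)"
proof (rule ccontr)
  assume *: "\<not> ?thesis"
  have "emeasure lam (cball 0 (real (Suc n))) = 0" for n
  proof -
    have "measure lam (cball 0 (real (Suc n))) \<le> 0" using * by (metis not_le of_nat_0_less_iff zero_less_Suc)
    then show ?thesis by (simp add: lam.emeasure_eq_measure measure_le_0_iff)
  qed
  then have "emeasure lam (\<Union>n. cball 0 (real (Suc n))) = 0"
    by (intro emeasure_UN_eq_0) auto
  moreover have "(\<Union>n. cball (0::'a) (real (Suc n))) = UNIV"
  proof safe
    fix x :: 'a
    obtain n where "norm x \<le> real n" using real_arch_simple by blast
    then show "x \<in> (\<Union>n. cball 0 (real (Suc n)))" by (intro UN_I[of n]) auto
  qed auto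
  ultimately show False using lam.emeasure_space_1 by simp
qed

text \<open>Adding noise of norm \<open>x\<close> to both points multiplies the weight by at most \<open>(1 + 2 * e * x) powr q\<close> with
\<open>e = \<eta> / (1 + \<eta> * s)\<close>, and convexity of the \<open>p\<close>-th power extracts \<open>e\<close> linearly. The factor \<open>e\<close>,
smaller than \<open>\<eta>\<close> by the factor \<open>1 + \<eta> * s\<close>, has the same denominator as the relative decrease of the
weight far from the origin, which makes loss and gain comparable for all \<open>s\<close>.\<close>

lemma weight_split:
  assumes \<eta>: "0 < \<eta>" "\<eta> \<le> 1" and s: "0 \<le> s" and t: "0 \<le> t" "t \<le> s + 2 * x" and x: "0 \<le> x"
  shows "(1 + \<eta> * t) powr q \<le> (1 + \<eta> * s) powr q * (1 + \<eta> / (1 + \<eta> * s) * (1 + 2 * x) ^ p)"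
proof -
  define e where "e = \<eta> / (1 + \<eta> * s)"
  have s1: "1 \<le> 1 + \<eta> * s" using \<eta> s by simp
  have e: "0 \<le> e" "e \<le> 1" using \<eta> s1 by (auto simp: e_def divide_le_eq_1)
  have es: "(1 + \<eta> * s) * e = \<eta>" using s1 by (simp add: e_def)
  have "\<eta> * t \<le> \<eta> * (s + 2 * x)" using \<eta> t by (intro mult_left_mono) auto
  also have "1 + \<eta> * (s + 2 * x) = (1 + \<eta> * s) * (1 + 2 * e * x)"
  proof -
    have "(1 + \<eta> * s) * (1 + 2 * e * x) = 1 + \<eta> * s + ((1 + \<eta> * s) * e) * (2 * x)"
      by (simp add: algebra_simps)
    then show ?thesis unfolding es by (simp add: algebra_simps)
  qed
  finally have le: "1 + \<eta> * t \<le> (1 + \<eta> * s) * (1 + 2 * e * x)" by simp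
  have "(1 + \<eta> * t) powr q \<le> ((1 + \<eta> * s) * (1 + 2 * e * x)) powr q"
    using le q \<eta> t by (intro powr_mono2) auto
  also have "\<dots> = (1 + \<eta> * s) powr q * (1 + 2 * e * x) powr q"
    by (simp add: powr_mult)
  also have "(1 + 2 * e * x) powr q \<le> (1 + 2 * e * x) powr real p"
    using e x q by (intro powr_mono) auto
  also have "\<dots> = (1 + 2 * e * x) ^ p"
  proof -
    have "0 < 1 + 2 * e * x" using e x by (intro add_pos_nonneg) auto
    then show ?thesis by (rule powr_realpow)
  qed
  also have "(1 + 2 * e * x) ^ p \<le> 1 + e * (1 + 2 * x) ^ p"
  proof -
    have "1 + 2 * e * x = (1 - e) * 1 + e * (1 + 2 * x)" by (simp add: algebra_simps)
    then have "(1 + 2 * e * x) ^ p = ((1 - e) * 1 + e * (1 + 2 * x)) ^ p" by (simp only:)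
    also have "\<dots> \<le> (1 - e) * 1 ^ p + e * (1 + 2 * x) ^ p"
    proof -
      have "convex_on {0::real..} (\<lambda>y. y ^ p)"
        using convex_power_odd[of p] convex_on_subset[OF convex_power_even[of p], of "{0..}"] by (cases "odd p") auto
      from convex_onD[OF this, of e 1 "1 + 2 * x"] show ?thesis using e x by simp
    qed
    also have "\<dots> \<le> 1 + e * (1 + 2 * x) ^ p" using e by simp
    finally show ?thesis .
  qed
  finally show ?thesis by (simp add: e_def mult_left_mono)
qed

lemma d_q_shift_le:
  assumes \<eta>: "0 < \<eta>" "\<eta> \<le> 1" and \<omega>: "0 < \<omega>" and s: "norm z + norm z' \<le> s"
  shows "d_q q \<omega> \<eta> (z + x) (z' + x)
    \<le> (1 + \<eta> * s) powr q / \<omega> * (1 + \<eta> / (1 + \<eta> * s) * (1 + 2 * norm x) ^ p) * norm (z - z')"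
proof -
  have s0: "0 \<le> s" using s norm_ge_zero[of z] norm_ge_zero[of z'] by linarith
  have "(1 + \<eta> * (norm (z + x) + norm (z' + x))) powr q
      \<le> (1 + \<eta> * s) powr q * (1 + \<eta> / (1 + \<eta> * s) * (1 + 2 * norm x) ^ p)"
    using \<eta> s s0 norm_triangle_ineq[of z x] norm_triangle_ineq[of z' x] by (intro weight_split) auto
  then have "(1 + \<eta> * norm (z + x) + \<eta> * norm (z' + x)) powr q * norm (z - z') / \<omega>
      \<le> (1 + \<eta> * s) powr q * (1 + \<eta> / (1 + \<eta> * s) * (1 + 2 * norm x) ^ p) * norm (z - z') / \<omega>"
    using \<omega> by (intro divide_right_mono mult_right_mono) (auto simp: distrib_left add.assoc)
  then show ?thesis by (simp add: d_q_def)
qed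

lemma d_q_less_1_eq:
  assumes "d_q q \<omega> \<eta> u v < 1"
  shows "d_q q \<omega> \<eta> u v = (1 + \<eta> * (norm u + norm v)) powr q / \<omega> * norm (u - v)"
  using assms by (auto simp: d_q_def min_def distrib_left add.assoc split: if_splits)

text \<open>Accepting can increase the cost only through the noise in the weight, since \<open>z\<close> and \<open>z'\<close> are not
farther out and not farther apart than \<open>u\<close> and \<open>v\<close>.\<close>

lemma acceptance_d_q_loss:
  assumes \<eta>: "0 < \<eta>" "\<eta> \<le> 1" and \<omega>: "0 < \<omega>" and close: "d_q q \<omega> \<eta> u v < 1"
    and z: "norm z \<le> norm u" "norm z' \<le> norm v" "norm (z - z') \<le> norm (u - v)"
  shows "- (d_q q \<omega> \<eta> u v * (\<eta> / (1 + \<eta> * (norm u + norm v)) * (1 + 2 * norm x) ^ p))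
    \<le> acceptance Psi u (z + x) * (d_q q \<omega> \<eta> u v - d_q q \<omega> \<eta> (z + x) (z' + x))"
proof -
  define s where "s = norm u + norm v"
  define d where "d = d_q q \<omega> \<eta> u v"
  define y where "y = \<eta> / (1 + \<eta> * s) * (1 + 2 * norm x) ^ p"
  have s: "0 \<le> s" by (simp add: s_def)
  have y: "0 \<le> y" using \<eta> s by (simp add: y_def)
  have d: "d = (1 + \<eta> * s) powr q / \<omega> * norm (u - v)"
    using d_q_less_1_eq[OF close] by (simp add: d_def s_def)
  have "d_q q \<omega> \<eta> (z + x) (z' + x) \<le> (1 + \<eta> * s) powr q / \<omega> * (1 + y) * norm (z - z')"
    unfolding y_def using z by (intro d_q_shift_le \<eta> \<omega>) (simp add: s_def)
  also have "\<dots> \<le> (1 + \<eta> * s) powr q / \<omega> * (1 + y) * norm (u - v)"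
    using z \<omega> y by (intro mult_left_mono) auto
  also have "\<dots> = d + d * y" by (simp add: d algebra_simps add_divide_distrib)
  finally have le: "- (d * y) \<le> d - d_q q \<omega> \<eta> (z + x) (z' + x)" by simp
  have "0 \<le> d * y" using y \<omega> by (simp add: d_def d_q_nonneg)
  then have "acceptance Psi u (z + x) * (d * y) \<le> 1 * (d * y)"
    by (intro mult_right_mono acceptance_le_1)
  then have "- (d * y) \<le> acceptance Psi u (z + x) * (- (d * y))" by simp
  also have "\<dots> \<le> acceptance Psi u (z + x) * (d - d_q q \<omega> \<eta> (z + x) (z' + x))"
    by (intro mult_left_mono le acceptance_nonneg)
  finally show ?thesis by (simp add: d_def y_def s_def)
qed

lemma nn_integral_le_of_integrable:
  assumes "integrable M f" "\<And>x. 0 \<le> f x" "integral\<^sup>L M f \<le> c"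
  shows "(\<integral>\<^sup>+ x. ennreal (f x) \<partial>M) \<le> ennreal c"
  using assms by (subst nn_integral_eq_integral) (auto intro: ennreal_leI)

text \<open>All error terms of one step in closed form. The function \<open>g\<close> is the relative gain from accepted
proposals when the noise has norm at most \<open>r\<close>, of mean at least \<open>G\<close>. The term with \<open>\<eta>\<close> is the growth of
the weight by noise, and the term with \<open>\<omega>\<close> comes from differing decisions: their probability is
bounded by weights times \<open>norm (u - v)\<close>, which is \<open>\<omega>\<close> times a multiple of \<open>d_q q \<omega> \<eta> u v\<close>.\<close>

lemma one_step:
  fixes u v :: 'a and g :: "'a \<times> 'a \<Rightarrow> real"
  assumes \<eta>: "0 < \<eta>" "\<eta> \<le> 1" and \<omega>: "0 < \<omega>" and close: "d_q q \<omega> \<eta> u v < 1"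
    and g [measurable]: "g \<in> borel_measurable (borel \<Otimes>\<^sub>M borel)" and g01: "\<And>z. 0 \<le> g z" "\<And>z. g z \<le> 1"
    and G: "G \<le> integral\<^sup>L (coup u v) g"
    and gain: "AE z in coup u v. \<forall>x. norm x \<le> r \<longrightarrow>
       d_q q \<omega> \<eta> u v * (g z - \<eta> / (1 + \<eta> * (norm u + norm v)) * (1 + 2 * norm x) ^ p)
       \<le> acceptance Psi u (fst z + x) * (d_q q \<omega> \<eta> u v - d_q q \<omega> \<eta> (fst z + x) (snd z + x))"
  shows "transport_dist (d_q q \<omega> \<eta>) (P u) (P v) \<le>
    ennreal (d_q q \<omega> \<eta> u v * (1 - measure lam (cball 0 r) * G + \<eta> / (1 + \<eta> * (norm u + norm v)) * B
      + 2 * L * B * \<omega> * \<eta> powr (- q)))"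
proof -
  interpret cp: prob_space "coup u v" by (rule prob_coup)
  have [simp]: "measure (coup u v) UNIV = 1" using cp.prob_space by simp
  define s where "s = norm u + norm v"
  have s: "0 \<le> s" by (simp add: s_def)
  define d where "d = d_q q \<omega> \<eta> u v"
  have d_nonneg: "0 \<le> d" unfolding d_def using \<omega> by (rule d_q_nonneg)
  define D0 where "D0 = (1 + \<eta> * s) powr q / \<omega>"
  have D0: "0 \<le> D0" using \<omega> by (simp add: D0_def)
  have dD: "d = D0 * norm (u - v)"
    using d_q_less_1_eq[OF close] by (simp add: d_def D0_def s_def)
  define e where "e = \<eta> / (1 + \<eta> * s)"
  have s1: "1 \<le> 1 + \<eta> * s" using \<eta> s by simp
  have e: "0 \<le> e" using \<eta> s1 by (auto simp: e_def)
  define C where "C x = (1 + 2 * norm x) ^ p" for x :: 'a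
  have C1: "1 \<le> C x" for x unfolding C_def by (intro one_le_power) simp
  have [measurable]: "C \<in> borel_measurable borel" unfolding C_def by measurable
  define c where "c = e + 2 * L * \<omega> * \<eta> powr (- q)"
  have c: "0 \<le> c" using e L \<omega> by (simp add: c_def)
  define H where "H x z = acceptance Psi u (fst z + x) * d_q q \<omega> \<eta> (fst z + x) (snd z + x)
        + (1 - acceptance Psi u (fst z + x)) * d_q q \<omega> \<eta> u v
        + \<bar>acceptance Psi u (fst z + x) - acceptance Psi v (snd z + x)\<bar>" for x z
  define I :: "'a \<Rightarrow> real" where "I x = indicator (cball 0 r) x" for x
  have I01: "I x = 0 \<or> I x = (1::real)" for x by (simp add: I_def indicator_def)
  have Hle: "AE z in coup u v. \<forall>x. H x z \<le> d * (1 - I x * g z + c * C x)"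
    using gain AE_coup_fst[of u v] AE_coup_snd[where u=u and v=v] coup_norm[of u v]
  proof eventually_elim
    case (elim z)
    show ?case
    proof
      fix x
      let ?X = "fst z + x" and ?Y = "snd z + x"
      have XY: "?X - ?Y = fst z - snd z" by simp
      have t: "norm ?X + norm ?Y \<le> s + 2 * norm x"
        using elim(2,3) norm_triangle_ineq[of "fst z" x] norm_triangle_ineq[of "snd z" x] by (simp add: s_def)
      have gain': "d * (I x * g z - e * C x) \<le> acceptance Psi u ?X * (d - d_q q \<omega> \<eta> ?X ?Y)"
      proof (cases "norm x \<le> r")
        case True
        then show ?thesis using elim(1)[rule_format, OF True] by (simp add: I_def d_def e_def C_def s_def)
      next
        case False
        then show ?thesis
          using acceptance_d_q_loss[OF \<eta> \<omega> close elim(2,3,4), of x]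
          by (simp add: I_def d_def e_def C_def s_def)
      qed
      have diff: "\<bar>acceptance Psi u ?X - acceptance Psi v ?Y\<bar> \<le> d * (2 * L * \<omega> * \<eta> powr (- q) * C x)"
      proof -
        have "\<bar>acceptance Psi u ?X - acceptance Psi v ?Y\<bar> \<le> \<bar>Psi u - Psi v\<bar> + \<bar>Psi ?X - Psi ?Y\<bar>"
          by (rule abs_acceptance_diff_le)
        also have "\<dots> \<le> L * (1 + norm u + norm v) powr q * norm (u - v)
            + L * (1 + norm ?X + norm ?Y) powr q * norm (fst z - snd z)"
          using Lip[of u v] Lip[of ?X ?Y] unfolding XY by (rule add_mono)
        also have "\<dots> \<le> L * ((1 + s) powr q * C x) * norm (u - v) + L * ((1 + s) powr q * C x) * norm (u - v)"
        proof (intro add_mono mult_mono mult_left_mono)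
          show "(1 + norm u + norm v) powr q \<le> (1 + s) powr q * C x"
            using C1[of x] mult_left_mono[OF C1[of x], of "(1 + s) powr q"] by (simp add: s_def add.assoc)
          have "(1 + norm ?X + norm ?Y) powr q \<le> ((1 + s) * (1 + 2 * norm x)) powr q"
          proof (intro powr_mono2)
            have "0 \<le> s * norm x" using s by simp
            then show "1 + norm ?X + norm ?Y \<le> (1 + s) * (1 + 2 * norm x)" using t by (simp add: algebra_simps)
          qed (use q in auto)
          also have "\<dots> = (1 + s) powr q * (1 + 2 * norm x) powr q" by (simp add: powr_mult)
          also have "(1 + 2 * norm x) powr q \<le> (1 + 2 * norm x) powr real p" using q by (intro powr_mono) auto
          also have "\<dots> = C x" unfolding C_def by (intro powr_realpow) (auto intro: add_pos_nonneg)
          finally show "(1 + norm ?X + norm ?Y) powr q \<le> (1 + s) powr q * C x" by (simp add: mult_left_mono)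
        qed (use L elim(4) C1[of x] in auto)
        also have "\<dots> = 2 * L * C x * ((1 + s) powr q * norm (u - v))" by (simp add: algebra_simps)
        also have "\<dots> \<le> 2 * L * C x * (\<eta> powr (- q) * (1 + \<eta> * s) powr q * norm (u - v))"
        proof (intro mult_left_mono mult_right_mono)
          have "\<eta> * (1 + s) \<le> 1 + \<eta> * s" using \<eta> by (simp add: algebra_simps)
          then have "(\<eta> * (1 + s)) powr q \<le> (1 + \<eta> * s) powr q" using \<eta> s q by (intro powr_mono2) auto
          moreover have "(\<eta> * (1 + s)) powr q = \<eta> powr q * (1 + s) powr q" by (simp add: powr_mult)
          ultimately have "\<eta> powr (- q) * (\<eta> powr q * (1 + s) powr q) \<le> \<eta> powr (- q) * (1 + \<eta> * s) powr q"
            by (intro mult_left_mono) auto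
          moreover have "\<eta> powr (- q) * \<eta> powr q = 1" using \<eta> by (simp add: powr_add[symmetric])
          ultimately show "(1 + s) powr q \<le> \<eta> powr (- q) * (1 + \<eta> * s) powr q"
            by (simp add: mult.assoc[symmetric])
        qed (use L C1[of x] in auto)
        also have "\<dots> = d * (2 * L * \<omega> * \<eta> powr (- q) * C x)"
          unfolding dD D0_def using \<omega> by (simp add: field_simps)
        finally show ?thesis .
      qed
      have "H x z = d - acceptance Psi u ?X * (d - d_q q \<omega> \<eta> ?X ?Y) + \<bar>acceptance Psi u ?X - acceptance Psi v ?Y\<bar>"
        by (simp add: H_def d_def algebra_simps)
      also have "\<dots> \<le> d - d * (I x * g z - e * C x) + d * (2 * L * \<omega> * \<eta> powr (- q) * C x)"
        using gain' diff by linarith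
      also have "\<dots> = d * (1 - I x * g z + c * C x)" by (simp add: c_def algebra_simps)
      finally show "H x z \<le> d * (1 - I x * g z + c * C x)" .
    qed
  qed
  have ig: "integrable (coup u v) g"
    using g01 by (intro cp.integrable_const_bound[where B=1]) auto
  have g1: "integral\<^sup>L (coup u v) g \<le> 1"
    using cp.integral_le_const[OF ig, of 1] g01 by simp
  then have G1: "G \<le> 1" using G by simp
  have inner: "(\<integral>\<^sup>+ z. ennreal (H x z) \<partial>coup u v) \<le> ennreal (d * (1 - I x * G + c * C x))" for x
  proof -
    have "(\<integral>\<^sup>+ z. ennreal (H x z) \<partial>coup u v) \<le> (\<integral>\<^sup>+ z. ennreal (d * (1 - I x * g z + c * C x)) \<partial>coup u v)"
      using Hle by (intro nn_integral_mono_AE) (auto intro: ennreal_leI)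
    also have "\<dots> \<le> ennreal (d * (1 - I x * G + c * C x))"
    proof (rule nn_integral_le_of_integrable)
      show "integrable (coup u v) (\<lambda>z. d * (1 - I x * g z + c * C x))"
        by (intro integrable_mult_right Bochner_Integration.integrable_add Bochner_Integration.integrable_diff ig) auto
      show "0 \<le> d * (1 - I x * g z + c * C x)" for z
        using d_nonneg c C1[of x] I01[of x] g01[of z]
        by (intro mult_nonneg_nonneg add_nonneg_nonneg) auto
      have "integral\<^sup>L (coup u v) (\<lambda>z. d * (1 - I x * g z + c * C x)) = d * (1 - I x * integral\<^sup>L (coup u v) g + c * C x)"
        using ig by (simp add: cp.prob_space)
      also have "\<dots> \<le> d * (1 - I x * G + c * C x)"
        using d_nonneg G I01[of x] by (intro mult_left_mono) auto
      finally show "integral\<^sup>L (coup u v) (\<lambda>z. d * (1 - I x * g z + c * C x)) \<le> d * (1 - I x * G + c * C x)" .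
    qed
    finally show ?thesis .
  qed
  have "transport_dist (d_q q \<omega> \<eta>) (P u) (P v) \<le> (\<integral>\<^sup>+ x. \<integral>\<^sup>+ z. ennreal (H x z) \<partial>coup u v \<partial>lam)"
    unfolding H_def using \<eta> \<omega>
    by (intro transport_dist_rcar_mh_le[OF Psi K lam coup] borel_measurable_d_q d_q_nonneg d_q_le_1) auto
  also have "\<dots> \<le> (\<integral>\<^sup>+ x. ennreal (d * (1 - I x * G + c * C x)) \<partial>lam)"
    by (intro nn_integral_mono inner)
  also have "\<dots> \<le> ennreal (d * (1 - measure lam (cball 0 r) * G + c * B))"
  proof (rule nn_integral_le_of_integrable)
    have iC: "integrable lam C" unfolding C_def by (rule integrable_B)
    have iI: "integrable lam I" 
      unfolding I_def by (intro lam.integrable_const_bound[where B=1]) (auto simp: indicator_def)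
    show "integrable lam (\<lambda>x. d * (1 - I x * G + c * C x))"
      by (intro integrable_mult_right Bochner_Integration.integrable_add Bochner_Integration.integrable_diff
          integrable_mult_left iC iI) auto
    show "0 \<le> d * (1 - I x * G + c * C x)" for x
      using d_nonneg c C1[of x] I01[of x] G1
      by (intro mult_nonneg_nonneg add_nonneg_nonneg) auto
    have "integral\<^sup>L lam I = measure lam (cball 0 r)" unfolding I_def by simp
    moreover have "integral\<^sup>L lam C = B" unfolding C_def B_def ..
    ultimately show "integral\<^sup>L lam (\<lambda>x. d * (1 - I x * G + c * C x)) \<le> d * (1 - measure lam (cball 0 r) * G + c * B)"
      using iC iI by (simp add: lam.prob_space)
  qed
  also have "d * (1 - measure lam (cball 0 r) * G + c * B) = d_q q \<omega> \<eta> u v * (1 - measure lam (cball 0 r) * G + \<eta> / (1 + \<eta> * (norm u + norm v)) * B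
      + 2 * L * B * \<omega> * \<eta> powr (- q))"
    by (simp add: d_def c_def e_def s_def algebra_simps)
  finally show ?thesis .
qed

end

lemma transport_dist_le_1:
  fixes \<mu> \<nu> :: "'a::second_countable_topology measure"
  assumes "\<mu> \<in> space (prob_algebra borel)" "\<nu> \<in> space (prob_algebra borel)"
    and d [measurable]: "(\<lambda>z. d (fst z) (snd z)) \<in> borel_measurable (borel \<Otimes>\<^sub>M borel)"
    and "\<And>x y. 0 \<le> d x y" "\<And>x y. d x y \<le> 1"
  shows "transport_dist d \<mu> \<nu> \<le> 1"
proof -
  have \<mu>\<nu>: "prob_space \<mu>" "sets \<mu> = sets borel" "prob_space \<nu>" "sets \<nu> = sets borel"
    using assms by (auto simp: space_prob_algebra)
  have "transport_dist d \<mu> \<nu> + (\<integral>\<^sup>+ z. ennreal (1 / 2 + 1 / 2 - d (fst z) (snd z)) \<partial>null_measure (borel \<Otimes>\<^sub>M borel))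
    \<le> (\<integral>\<^sup>+ x. ennreal (1 / 2) \<partial>\<mu>) + (\<integral>\<^sup>+ x. ennreal (1 / 2) \<partial>\<nu>)"
    using assms \<mu>\<nu> by (intro transport_dist_add_subcoupling_le) auto
  also have "\<dots> = ennreal (1 / 2) + ennreal (1 / 2)"
    using prob_space.emeasure_space_1[OF \<mu>\<nu>(1)] prob_space.emeasure_space_1[OF \<mu>\<nu>(3)] by simp
  also have "\<dots> = 1" by (subst ennreal_plus[symmetric]) auto
  finally show ?thesis by (simp add: add_increasing2 order_trans)
qed

lemma powr_one_minus_le:
  fixes y q :: real
  assumes y: "0 \<le> y" "y < 1" and q: "0 < q"
  shows "(1 - y) powr q \<le> 1 - min 1 q * y"
proof (cases "1 \<le> q")
  case True
  then have "(1 - y) powr q \<le> (1 - y) powr 1" using y by (intro powr_mono') auto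
  then show ?thesis using y True by simp
next
  case False
  have "exp ((1 - q) *\<^sub>R 0 + q *\<^sub>R ln (1 - y)) \<le> (1 - q) * exp 0 + q * exp (ln (1 - y))"
    using convex_onD[OF exp_convex, of q 0 "ln (1 - y)"] q False by simp
  then show ?thesis using y False by (simp add: powr_def algebra_simps)
qed

context rcar
begin

lemma P_in_prob_algebra: "P u \<in> space (prob_algebra borel)"
  using measurable_space[OF P, of u] by simp

text \<open>The one-step estimate without any gain.\<close>

lemma nearly_nonexpansive:
  assumes \<eta>: "0 < \<eta>" "\<eta> \<le> 1" and \<omega>: "0 < \<omega>"
  shows "transport_dist (d_q q \<omega> \<eta>) (P u) (P v) \<le>
    ennreal ((1 + \<eta> * B + 2 * L * B * \<omega> * \<eta> powr (- q)) * d_q q \<omega> \<eta> u v)"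
proof -
  have nn: "0 \<le> \<eta> * B + 2 * L * B * \<omega> * \<eta> powr (- q)"
    using \<eta> \<omega> L B_ge_1 by (intro add_nonneg_nonneg mult_nonneg_nonneg) auto
  show ?thesis
  proof (cases "d_q q \<omega> \<eta> u v < 1")
    case True
    \<comment> \<open>A negative noise radius makes the claim of a gain vacuous.\<close>
    have no: "\<not> norm x \<le> - 1" for x :: 'a using norm_ge_zero[of x] by linarith
    have "transport_dist (d_q q \<omega> \<eta>) (P u) (P v) \<le>
      ennreal (d_q q \<omega> \<eta> u v * (1 - measure lam (cball 0 (- 1)) * 0 + \<eta> / (1 + \<eta> * (norm u + norm v)) * B
        + 2 * L * B * \<omega> * \<eta> powr (- q)))"
      by (rule one_step[OF \<eta> \<omega> True, of "\<lambda>_. 0"]) (auto simp: no)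
    also have "\<dots> \<le> ennreal ((1 + \<eta> * B + 2 * L * B * \<omega> * \<eta> powr (- q)) * d_q q \<omega> \<eta> u v)"
    proof (rule ennreal_leI)
      have "\<eta> / (1 + \<eta> * (norm u + norm v)) \<le> \<eta> / 1"
        using \<eta> by (intro divide_left_mono) (auto intro: add_pos_nonneg)
      then have "\<eta> / (1 + \<eta> * (norm u + norm v)) * B \<le> \<eta> * B"
        using B_ge_1 by (intro mult_right_mono) auto
      then show "d_q q \<omega> \<eta> u v * (1 - measure lam (cball 0 (- 1)) * 0 + \<eta> / (1 + \<eta> * (norm u + norm v)) * B
        + 2 * L * B * \<omega> * \<eta> powr (- q)) \<le> (1 + \<eta> * B + 2 * L * B * \<omega> * \<eta> powr (- q)) * d_q q \<omega> \<eta> u v"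
        using d_q_nonneg[OF \<omega>, of q \<eta> u v] by (subst mult.commute, intro mult_right_mono) auto
    qed
    finally show ?thesis .
  next
    case False
    then have d1: "d_q q \<omega> \<eta> u v = 1" using d_q_le_1[of q \<omega> \<eta> u v] by simp
    have "transport_dist (d_q q \<omega> \<eta>) (P u) (P v) \<le> 1"
      using \<eta> \<omega> by (intro transport_dist_le_1 P_in_prob_algebra borel_measurable_d_q d_q_nonneg d_q_le_1) auto
    also have "1 \<le> ennreal ((1 + \<eta> * B + 2 * L * B * \<omega> * \<eta> powr (- q)) * d_q q \<omega> \<eta> u v)"
      using nn by (simp add: d1 add.assoc)
    finally show ?thesis .
  qed
qed

lemma acceptance_ge_on_ball:
  assumes R: "0 \<le> R" "0 \<le> r"
  shows "\<exists>a>0. a \<le> 1 \<and> (\<forall>u z x. norm u \<le> R \<longrightarrow> norm z \<le> norm u \<longrightarrow> norm x \<le> r \<longrightarrow> a \<le> acceptance Psi u (z + x))"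
proof -
  define a where "a = exp (- (L * (1 + 2 * R + r) powr q * (2 * R + r)))"
  have a: "0 < a" "a \<le> 1" using L R by (auto simp: a_def)
  have "a \<le> acceptance Psi u (z + x)" if u: "norm u \<le> R" "norm z \<le> norm u" "norm x \<le> r" for u z x
  proof -
    have X: "norm (z + x) \<le> R + r" using norm_triangle_ineq[of z x] u by linarith
    have "Psi (z + x) - Psi u \<le> \<bar>Psi u - Psi (z + x)\<bar>" by linarith
    also have "\<dots> \<le> L * (1 + norm u + norm (z + x)) powr q * norm (u - (z + x))" by (rule Lip)
    also have "\<dots> \<le> L * (1 + 2 * R + r) powr q * (2 * R + r)"
    proof (intro mult_mono mult_left_mono powr_mono2)
      show "norm (u - (z + x)) \<le> 2 * R + r"
        using norm_triangle_ineq4[of u "z + x"] X u by linarith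
    qed (use q L X u R in auto)
    finally have "a \<le> exp (Psi u - Psi (z + x))" by (simp add: a_def)
    then show ?thesis using a by (simp add: acceptance_def)
  qed
  then show ?thesis using a by blast
qed

text \<open>On a ball and for bounded noise the acceptance probability has a lower bound independent of where
the proposal falls, so the mean contraction factor \<open>\<beta>c\<close> of the coupling survives the conditioning on acceptance.\<close>

lemma contraction_near:
  assumes r: "0 < r" "0 < measure lam (cball 0 r)" and R: "0 < R"
  shows "\<exists>\<delta>>0. \<delta> \<le> 1 \<and> (\<forall>\<eta> \<omega> u v. 0 < \<eta> \<longrightarrow> \<eta> \<le> 1 \<longrightarrow> 0 < \<omega> \<longrightarrow> norm u \<le> R \<longrightarrow> d_q q \<omega> \<eta> u v < 1 \<longrightarrow>
     transport_dist (d_q q \<omega> \<eta>) (P u) (P v)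
      \<le> ennreal (d_q q \<omega> \<eta> u v * (1 - \<delta> + \<eta> * B + 2 * L * B * \<omega> * \<eta> powr (- q))))"
proof -
  obtain a0 where a0: "0 < a0" "a0 \<le> 1"
    and acc_ge: "\<And>u z x. norm u \<le> R \<Longrightarrow> norm z \<le> norm u \<Longrightarrow> norm x \<le> r \<Longrightarrow> a0 \<le> acceptance Psi u (z + x)"
    using acceptance_ge_on_ball[of R r] R r by auto
  define \<delta> where "\<delta> = measure lam (cball 0 r) * (a0 * (1 - \<beta>c))"
  have "0 < \<delta>" using r a0 \<beta>c by (simp add: \<delta>_def)
  moreover have "\<delta> \<le> 1 * (1 * 1)" unfolding \<delta>_def using r a0 \<beta>c by (intro mult_mono) auto
  moreover have "transport_dist (d_q q \<omega> \<eta>) (P u) (P v)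
      \<le> ennreal (d_q q \<omega> \<eta> u v * (1 - \<delta> + \<eta> * B + 2 * L * B * \<omega> * \<eta> powr (- q)))"
    if \<eta>: "0 < \<eta>" "\<eta> \<le> 1" and \<omega>: "0 < \<omega>" and u: "norm u \<le> R" and close: "d_q q \<omega> \<eta> u v < 1" for \<eta> \<omega> u v
  proof -
    interpret cp: prob_space "coup u v" by (rule prob_coup)
    define s where "s = norm u + norm v"
    have s: "0 \<le> s" by (simp add: s_def)
    define e where "e = \<eta> / (1 + \<eta> * s)"
    have s1: "1 \<le> 1 + \<eta> * s" using \<eta> s by simp
    have "\<eta> / (1 + \<eta> * s) \<le> \<eta> / 1" using \<eta> s1 by (intro divide_left_mono) auto
    then have e: "0 \<le> e" "e \<le> \<eta>" using \<eta> s1 by (auto simp: e_def)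
    define D0 where "D0 = (1 + \<eta> * s) powr q / \<omega>"
    have D0: "0 \<le> D0" using \<omega> by (simp add: D0_def)
    define d where "d = d_q q \<omega> \<eta> u v"
    have d_nonneg: "0 \<le> d" using \<omega> by (simp add: d_def d_q_nonneg)
    have dD: "d = D0 * norm (u - v)" using d_q_less_1_eq[OF close] by (simp add: d_def D0_def s_def)
    define ratio where "ratio z = norm (fst z - snd z) / norm (u - v)" for z :: "'a \<times> 'a"
    have [measurable]: "ratio \<in> borel_measurable (borel \<Otimes>\<^sub>M borel)"
      unfolding ratio_def by measurable
    have ratio_nonneg: "0 \<le> ratio z" for z by (simp add: ratio_def)
    define g where "g z = a0 * (1 - min 1 (ratio z))" for z
    have g01: "0 \<le> g z" "g z \<le> 1" for z
      using a0 ratio_nonneg[of z] mult_mono[of a0 1 "1 - min 1 (ratio z)" 1] by (auto simp: g_def)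
    have [measurable]: "g \<in> borel_measurable (borel \<Otimes>\<^sub>M borel)" unfolding g_def by measurable
    have "(\<integral>\<^sup>+ z. ennreal (min 1 (ratio z)) \<partial>coup u v) \<le> ennreal \<beta>c"
    proof (cases "u = v")
      case True
      then show ?thesis by (simp add: ratio_def)
    next
      case False
      then have pos: "0 < norm (u - v)" by simp
      have "(\<integral>\<^sup>+ z. ennreal (min 1 (ratio z)) \<partial>coup u v)
         \<le> (\<integral>\<^sup>+ z. ennreal (1 / norm (u - v)) * ennreal (norm (fst z - snd z)) \<partial>coup u v)"
        by (intro nn_integral_mono) (auto simp: ratio_def simp flip: ennreal_mult intro!: ennreal_leI)
      also have "\<dots> = ennreal (1 / norm (u - v)) * (\<integral>\<^sup>+ z. ennreal (norm (fst z - snd z)) \<partial>coup u v)"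
        by (rule nn_integral_cmult) measurable
      also have "\<dots> \<le> ennreal (1 / norm (u - v)) * ennreal (\<beta>c * norm (u - v))"
        by (intro mult_left_mono coup_mean) simp
      also have "\<dots> = ennreal \<beta>c" using pos \<beta>c by (simp flip: ennreal_mult)
      finally show ?thesis .
    qed
    moreover have im: "integrable (coup u v) (\<lambda>z. min 1 (ratio z))"
      by (intro cp.integrable_const_bound[where B=1]) (auto simp: ratio_nonneg)
    ultimately have "integral\<^sup>L (coup u v) (\<lambda>z. min 1 (ratio z)) \<le> \<beta>c"
      using \<beta>c by (subst (asm) nn_integral_eq_integral) (auto simp: ratio_nonneg)
    moreover have "integral\<^sup>L (coup u v) g = a0 * (1 - integral\<^sup>L (coup u v) (\<lambda>z. min 1 (ratio z)))"
      unfolding g_def using im cp.prob_space by simp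
    ultimately have G: "a0 * (1 - \<beta>c) \<le> integral\<^sup>L (coup u v) g"
      using a0 by (simp add: mult_left_mono)
    have "transport_dist (d_q q \<omega> \<eta>) (P u) (P v) \<le>
      ennreal (d_q q \<omega> \<eta> u v * (1 - measure lam (cball 0 r) * (a0 * (1 - \<beta>c)) + \<eta> / (1 + \<eta> * (norm u + norm v)) * B
        + 2 * L * B * \<omega> * \<eta> powr (- q)))"
    proof (rule one_step[OF \<eta> \<omega> close _ g01 G])
      show "AE z in coup u v. \<forall>x. norm x \<le> r \<longrightarrow>
       d_q q \<omega> \<eta> u v * (g z - \<eta> / (1 + \<eta> * (norm u + norm v)) * (1 + 2 * norm x) ^ p)
       \<le> acceptance Psi u (fst z + x) * (d_q q \<omega> \<eta> u v - d_q q \<omega> \<eta> (fst z + x) (snd z + x))"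
        using AE_coup_fst[of u v] AE_coup_snd[where u=u and v=v] coup_norm[of u v]
      proof eventually_elim
        case (elim z)
        show ?case
        proof (intro allI impI)
          fix x :: 'a assume x: "norm x \<le> r"
          define y where "y = e * (1 + 2 * norm x) ^ p"
          have y: "0 \<le> y" using e by (simp add: y_def)
          have acc: "a0 \<le> acceptance Psi u (fst z + x)" using acc_ge u elim x by blast
          have nb: "norm (fst z - snd z) \<le> norm (u - v)" by (rule elim)
          have "d_q q \<omega> \<eta> (fst z + x) (snd z + x) \<le> D0 * (1 + y) * norm (fst z - snd z)"
            unfolding D0_def y_def e_def using elim by (intro d_q_shift_le \<eta> \<omega>) (simp add: s_def)
          also have "\<dots> = D0 * norm (fst z - snd z) + D0 * norm (fst z - snd z) * y"
            by (simp add: algebra_simps)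
          also have "\<dots> \<le> D0 * norm (fst z - snd z) + d * y"
            unfolding dD using D0 y nb by (intro add_left_mono mult_right_mono mult_left_mono) auto
          finally have le: "d - D0 * norm (fst z - snd z) - d * y \<le> d - d_q q \<omega> \<eta> (fst z + x) (snd z + x)" by simp
          have g_eq: "d * g z = a0 * (d - D0 * norm (fst z - snd z))"
          proof (cases "u = v")
            case True
            then show ?thesis using nb by (simp add: dD)
          next
            case False
            then have "min 1 (ratio z) = ratio z" using nb by (simp add: ratio_def)
            then show ?thesis using False by (simp add: g_def dD ratio_def field_simps)
          qed
          have nonneg: "0 \<le> d - D0 * norm (fst z - snd z)" unfolding dD using D0 nb by (simp add: mult_left_mono)
          have "d * g z \<le> acceptance Psi u (fst z + x) * (d - D0 * norm (fst z - snd z))"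
            unfolding g_eq by (intro mult_right_mono acc nonneg)
          moreover have "acceptance Psi u (fst z + x) * (d * y) \<le> 1 * (d * y)"
            using d_nonneg y by (intro mult_right_mono acceptance_le_1) auto
          ultimately have "d * g z - d * y \<le> acceptance Psi u (fst z + x) * (d - D0 * norm (fst z - snd z) - d * y)"
            by (simp add: right_diff_distrib)
          also have "\<dots> \<le> acceptance Psi u (fst z + x) * (d - d_q q \<omega> \<eta> (fst z + x) (snd z + x))"
            by (intro mult_left_mono le acceptance_nonneg)
          finally show "d_q q \<omega> \<eta> u v * (g z - \<eta> / (1 + \<eta> * (norm u + norm v)) * (1 + 2 * norm x) ^ p)
             \<le> acceptance Psi u (fst z + x) * (d_q q \<omega> \<eta> u v - d_q q \<omega> \<eta> (fst z + x) (snd z + x))"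
            by (simp add: d_def y_def e_def s_def right_diff_distrib mult.assoc)
        qed
      qed
    qed measurable
    also have "\<dots> \<le> ennreal (d_q q \<omega> \<eta> u v * (1 - \<delta> + \<eta> * B + 2 * L * B * \<omega> * \<eta> powr (- q)))"
    proof (intro ennreal_leI mult_left_mono)
      have "e * B \<le> \<eta> * B" using e B_ge_1 by (intro mult_right_mono) auto
      then show "1 - measure lam (cball 0 r) * (a0 * (1 - \<beta>c)) + \<eta> / (1 + \<eta> * (norm u + norm v)) * B
        + 2 * L * B * \<omega> * \<eta> powr (- q) \<le> 1 - \<delta> + \<eta> * B + 2 * L * B * \<omega> * \<eta> powr (- q)"
        by (simp add: \<delta>_def e_def s_def)
    qed (rule d_q_nonneg[OF \<omega>])
    finally show ?thesis .
  qed
  ultimately show ?thesis by (intro exI[of _ \<delta>]) auto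
qed

text \<open>Every point of the ball of \<open>K_ball\<close> around \<open>\<beta>0 *\<^sub>R u\<close> has norm at most this fraction of \<open>norm u\<close>.\<close>

definition inner_ratio where "inner_ratio = \<beta>0 + b0 * (1 - \<beta>0)"

lemma inner_ratio: "0 < inner_ratio" "inner_ratio < 1"
proof -
  show "0 < inner_ratio" using K_ball by (simp add: inner_ratio_def add_pos_pos)
  have "b0 * (1 - \<beta>0) < 1 * (1 - \<beta>0)" using K_ball by (intro mult_strict_right_mono) auto
  then show "inner_ratio < 1" by (simp add: inner_ratio_def)
qed

definition inner_ball where "inner_ball u = {z. norm (z - \<beta>0 *\<^sub>R u) \<le> b0 * (1 - \<beta>0) * norm u}" for u :: 'a

lemma inner_ball_sets [measurable]: "inner_ball u \<in> sets borel"
  unfolding inner_ball_def by measurable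

lemma inner_ball_norm: "z \<in> inner_ball u \<Longrightarrow> norm z \<le> inner_ratio * norm u"
  using norm_triangle_ineq[of "z - \<beta>0 *\<^sub>R u" "\<beta>0 *\<^sub>R u"] K_ball
  by (simp add: inner_ball_def inner_ratio_def algebra_simps)

text \<open>The assumption \<open>retract\<close> is used with a radius factor strictly between \<open>b0\<close> and 1; the excess over \<open>b0\<close>, scaled by
\<open>norm u\<close>, absorbs the bounded noise.\<close>

lemma inner_ball_accept:
  assumes r: "0 < r"
  shows "\<exists>R>0. \<exists>M>0. M \<le> 1 \<and> (\<forall>u z x. R < norm u \<longrightarrow> z \<in> inner_ball u \<longrightarrow> norm x \<le> r \<longrightarrow> M \<le> acceptance Psi u (z + x))"
proof -
  define b where "b = (b0 + 1) / 2"
  have b: "b0 < b" "0 < b" "b < 1" using K_ball by (auto simp: b_def)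
  have \<beta>0: "0 < \<beta>0" "\<beta>0 < 1" using K_ball by auto
  obtain R0 M4 where R0: "0 < R0" and M4: "0 < M4" and
    inf: "\<And>u. R0 < norm u \<Longrightarrow> M4 \<le> (INF v\<in>cball (\<beta>0 *\<^sub>R u) (b * (1 - \<beta>0) * norm u). exp (Psi u - Psi v))"
    using retract[OF \<beta>0 b(2,3)] by blast
  define R where "R = max R0 (r / ((b - b0) * (1 - \<beta>0)))"
  have "min 1 M4 \<le> acceptance Psi u (z + x)" if u: "R < norm u" and z: "z \<in> inner_ball u" and x: "norm x \<le> r" for u z x
  proof -
    have pos: "0 < (b - b0) * (1 - \<beta>0)" using b \<beta>0 by simp
    have "r / ((b - b0) * (1 - \<beta>0)) \<le> norm u" using u by (simp add: R_def)
    then have "r \<le> (b - b0) * (1 - \<beta>0) * norm u" using pos by (simp add: pos_divide_le_eq mult.commute)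
    moreover have "norm (z + x - \<beta>0 *\<^sub>R u) \<le> norm (z - \<beta>0 *\<^sub>R u) + norm x"
      using norm_triangle_ineq[of "z - \<beta>0 *\<^sub>R u" x] by (simp add: algebra_simps)
    ultimately have "norm (z + x - \<beta>0 *\<^sub>R u) \<le> b * (1 - \<beta>0) * norm u"
      using z x by (simp add: inner_ball_def algebra_simps)
    then have "z + x \<in> cball (\<beta>0 *\<^sub>R u) (b * (1 - \<beta>0) * norm u)"
      by (simp add: dist_norm norm_minus_commute)
    moreover have "bdd_below ((\<lambda>v. exp (Psi u - Psi v)) ` cball (\<beta>0 *\<^sub>R u) (b * (1 - \<beta>0) * norm u))"
      by (rule bdd_belowI[of _ 0]) auto
    ultimately have "(INF v\<in>cball (\<beta>0 *\<^sub>R u) (b * (1 - \<beta>0) * norm u). exp (Psi u - Psi v)) \<le> exp (Psi u - Psi (z + x))"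
      by (intro cINF_lower)
    then have "M4 \<le> exp (Psi u - Psi (z + x))" using inf[of u] u by (simp add: R_def)
    then show ?thesis by (simp add: acceptance_def)
  qed
  then show ?thesis using R0 M4
    by (intro exI[of _ R] conjI exI[of _ "min 1 M4"]) (auto simp: R_def less_max_iff_disj)
qed

text \<open>When the first proposal falls into \<open>inner_ball u\<close>, the sum \<open>s\<close> of the norms drops by a fixed fraction,
and the relative decrease of the weight is at least a multiple of \<open>\<eta> * s / (1 + \<eta> * s)\<close>. The noise
costs at most \<open>B * \<eta> / (1 + \<eta> * s)\<close>, which is at most half of the gain once \<open>s\<close> exceeds a radius that does not depend on
\<open>\<eta>\<close>.\<close>

lemma contraction_far:
  assumes q0: "0 < q" and r: "0 < r" "0 < measure lam (cball 0 r)"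
  shows "\<exists>R>0. \<exists>c>0. c \<le> 1 \<and> (\<forall>\<eta> \<omega> u v. 0 < \<eta> \<longrightarrow> \<eta> \<le> 1 \<longrightarrow> 0 < \<omega> \<longrightarrow> \<omega> \<le> 1 \<longrightarrow> R < norm u \<longrightarrow> d_q q \<omega> \<eta> u v < 1 \<longrightarrow>
     transport_dist (d_q q \<omega> \<eta>) (P u) (P v)
      \<le> ennreal (d_q q \<omega> \<eta> u v * (1 - c * (\<eta> * R / (1 + \<eta> * R)) + 2 * L * B * \<omega> * \<eta> powr (- q))))"
proof -
  let ?\<rho> = inner_ratio
  obtain R1 M where R1: "0 < R1" and M: "0 < M" "M \<le> 1" and
    acc: "\<And>u z x. R1 < norm u \<Longrightarrow> z \<in> inner_ball u \<Longrightarrow> norm x \<le> r \<Longrightarrow> M \<le> acceptance Psi u (z + x)"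
    using inner_ball_accept[OF r(1)] by blast
  define \<kappa> where "\<kappa> = (1 - ?\<rho>) / 4"
  have \<kappa>: "0 < \<kappa>" "\<kappa> \<le> 1" using inner_ratio by (auto simp: \<kappa>_def)
  define m where "m = min 1 q"
  have m: "0 < m" "m \<le> 1" using q0 by (auto simp: m_def)
  define c0 where "c0 = M * (m * \<kappa>)"
  have c0: "0 < c0" "c0 \<le> 1" using M m \<kappa> by (auto simp: c0_def mult_le_one)
  define c1 where "c1 = measure lam (cball 0 r) * (c0 * \<epsilon>0)"
  have \<epsilon>1: "\<epsilon>0 \<le> 1" using K_ball(5)[of 0] prob_space.prob_le_1[OF prob_K[of 0]] by (meson order_trans)
  have c1: "0 < c1" "c1 \<le> 1" using r c0 K_ball \<epsilon>1 by (auto simp: c1_def mult_le_one)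
  \<comment> \<open>The second bound makes the norms drop in spite of noise r and a distance of the pair up to 1; the third one makes the gain at least twice the loss.\<close>
  define R where "R = max R1 (max ((4 * r + 1) / (1 - ?\<rho>)) (2 * B / c1))"
  have R: "0 < R" "R1 \<le> R" "(4 * r + 1) / (1 - ?\<rho>) \<le> R" "2 * B / c1 \<le> R"
    using R1 by (auto simp: R_def less_max_iff_disj)
  have Rr: "4 * r + 1 \<le> R * (1 - ?\<rho>)" using R(3) inner_ratio by (simp add: pos_divide_le_eq)
  have RB: "2 * B \<le> R * c1" using R(4) c1 by (simp add: pos_divide_le_eq)
  have "transport_dist (d_q q \<omega> \<eta>) (P u) (P v)
      \<le> ennreal (d_q q \<omega> \<eta> u v * (1 - c1 / 2 * (\<eta> * R / (1 + \<eta> * R)) + 2 * L * B * \<omega> * \<eta> powr (- q)))"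
    if \<eta>: "0 < \<eta>" "\<eta> \<le> 1" and \<omega>: "0 < \<omega>" "\<omega> \<le> 1" and u: "R < norm u" and close: "d_q q \<omega> \<eta> u v < 1" for \<eta> \<omega> u v
  proof -
    interpret cp: prob_space "coup u v" by (rule prob_coup)
    define s where "s = norm u + norm v"
    have s: "0 \<le> s" "R \<le> s" using u by (auto simp: s_def intro: add_increasing2)
    have s1: "0 < 1 + \<eta> * s" "1 \<le> 1 + \<eta> * s" using \<eta> s by (auto intro: add_pos_nonneg)
    define d where "d = d_q q \<omega> \<eta> u v"
    have d_nonneg: "0 \<le> d" using \<omega> by (simp add: d_def d_q_nonneg)
    have d_eq: "d = (1 + \<eta> * s) powr q / \<omega> * norm (u - v)"
      using d_q_less_1_eq[OF close] by (simp add: d_def s_def)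
    have uv: "norm (u - v) \<le> 1"
    proof -
      have "1 * norm (u - v) \<le> (1 + \<eta> * s) powr q / \<omega> * norm (u - v)"
        using s1 \<omega> q by (intro mult_right_mono) (auto simp: le_divide_eq ge_one_powr_ge_zero intro: order_trans)
      then show ?thesis using close d_eq d_def by simp
    qed
    have s_le: "s \<le> 2 * norm u + 1"
      using norm_triangle_ineq2[of v u] uv by (simp add: s_def norm_minus_commute)
    define y where "y = \<kappa> * (\<eta> * s / (1 + \<eta> * s))"
    have frac: "0 \<le> \<eta> * s / (1 + \<eta> * s)" "\<eta> * s / (1 + \<eta> * s) < 1"
      using \<eta> s s1 by (auto simp: pos_divide_less_eq[OF s1(1)])
    have "y \<le> 1 * (\<eta> * s / (1 + \<eta> * s))"
      unfolding y_def using \<kappa> frac by (intro mult_right_mono) auto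
    moreover have "0 \<le> y" unfolding y_def using \<kappa> frac by (intro mult_nonneg_nonneg) auto
    ultimately have y: "0 \<le> y" "y < 1" using frac by linarith+
    define g where "g z = M * (m * y) * indicator (inner_ball u) (fst z)" for z :: "'a \<times> 'a"
    have My: "0 \<le> M * (m * y)" "M * (m * y) \<le> 1" using M m y by (auto simp: mult_le_one)
    have g01: "0 \<le> g z" "g z \<le> 1" for z using My by (auto simp: g_def indicator_def)
    have [measurable]: "g \<in> borel_measurable (borel \<Otimes>\<^sub>M borel)" unfolding g_def by measurable
    have "integral\<^sup>L (coup u v) g = M * (m * y) * measure (K u) (inner_ball u)"
    proof -
      have "integral\<^sup>L (coup u v) (\<lambda>z. indicat_real (inner_ball u) (fst z)) = integral\<^sup>L (distr (coup u v) borel fst) (indicat_real (inner_ball u))"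
        by (rule integral_distr[symmetric]) measurable
      also have "\<dots> = measure (K u) (inner_ball u)" by (simp add: fst_coup)
      finally show ?thesis unfolding g_def by simp
    qed
    then have G: "M * (m * y) * \<epsilon>0 \<le> integral\<^sup>L (coup u v) g"
      using K_ball(5)[of u] My by (simp add: inner_ball_def mult_left_mono)
    have "transport_dist (d_q q \<omega> \<eta>) (P u) (P v) \<le>
      ennreal (d_q q \<omega> \<eta> u v * (1 - measure lam (cball 0 r) * (M * (m * y) * \<epsilon>0) + \<eta> / (1 + \<eta> * (norm u + norm v)) * B
        + 2 * L * B * \<omega> * \<eta> powr (- q)))"
    proof (rule one_step[OF \<eta> \<omega>(1) close _ g01 G])
      show "AE z in coup u v. \<forall>x. norm x \<le> r \<longrightarrow>
       d_q q \<omega> \<eta> u v * (g z - \<eta> / (1 + \<eta> * (norm u + norm v)) * (1 + 2 * norm x) ^ p)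
       \<le> acceptance Psi u (fst z + x) * (d_q q \<omega> \<eta> u v - d_q q \<omega> \<eta> (fst z + x) (snd z + x))"
        using AE_coup_fst[of u v] AE_coup_snd[where u=u and v=v] coup_norm[of u v]
      proof eventually_elim
        case (elim z)
        show ?case
        proof (intro allI impI)
          fix x :: 'a assume x: "norm x \<le> r"
          let ?X = "fst z + x" and ?Y = "snd z + x"
          have loss_nonneg: "0 \<le> d * (\<eta> / (1 + \<eta> * (norm u + norm v)) * (1 + 2 * norm x) ^ p)"
            using d_nonneg \<eta> by (intro mult_nonneg_nonneg divide_nonneg_nonneg) auto
          show "d_q q \<omega> \<eta> u v * (g z - \<eta> / (1 + \<eta> * (norm u + norm v)) * (1 + 2 * norm x) ^ p)
             \<le> acceptance Psi u ?X * (d_q q \<omega> \<eta> u v - d_q q \<omega> \<eta> ?X ?Y)"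
          proof (cases "fst z \<in> inner_ball u")
            case True
            have "norm ?X + norm ?Y \<le> ?\<rho> * norm u + norm v + 2 * r"
              using norm_triangle_ineq[of "fst z" x] norm_triangle_ineq[of "snd z" x] inner_ball_norm[OF True] elim x
              by linarith
            also have "\<dots> \<le> (1 - \<kappa>) * s"
            proof -
              have "4 * r + 1 \<le> norm u * (1 - ?\<rho>)"
              proof -
                have "R * (1 - ?\<rho>) \<le> norm u * (1 - ?\<rho>)"
                  using u inner_ratio by (intro mult_right_mono) auto
                then show ?thesis using Rr by linarith
              qed
              moreover have "\<kappa> * s \<le> \<kappa> * (2 * norm u + 1)" using \<kappa> s_le by (intro mult_left_mono) auto
              moreover have "\<kappa> * (2 * norm u + 1) = norm u * (1 - ?\<rho>) / 2 + \<kappa>" by (simp add: \<kappa>_def field_simps)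
              moreover have "\<kappa> \<le> 1 / 4" using inner_ratio by (simp add: \<kappa>_def)
              ultimately show ?thesis by (simp add: s_def algebra_simps)
            qed
            finally have "\<eta> * (norm ?X + norm ?Y) \<le> \<eta> * ((1 - \<kappa>) * s)" using \<eta> by (intro mult_left_mono) auto
            also have "1 + \<eta> * ((1 - \<kappa>) * s) = (1 + \<eta> * s) * (1 - y)"
            proof -
              have "(1 + \<eta> * s) * y = \<kappa> * (\<eta> * s)" using s1 by (simp add: y_def)
              then show ?thesis by (simp add: algebra_simps)
            qed
            finally have "(1 + \<eta> * norm ?X + \<eta> * norm ?Y) powr q \<le> ((1 + \<eta> * s) * (1 - y)) powr q"
              using q \<eta> by (intro powr_mono2) (auto simp: distrib_left add.assoc)
            also have "\<dots> = (1 + \<eta> * s) powr q * (1 - y) powr q" by (simp add: powr_mult)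
            also have "\<dots> \<le> (1 + \<eta> * s) powr q * (1 - m * y)"
              unfolding m_def using y q0 by (intro mult_left_mono powr_one_minus_le) auto
            finally have "(1 + \<eta> * norm ?X + \<eta> * norm ?Y) powr q * norm (?X - ?Y) / \<omega>
                \<le> (1 + \<eta> * s) powr q * (1 - m * y) * norm (u - v) / \<omega>"
              using elim \<omega> m y mult_le_one[of m y] by (intro divide_right_mono mult_mono) auto
            also have "\<dots> = d * (1 - m * y)" by (simp add: d_eq)
            finally have "d_q q \<omega> \<eta> ?X ?Y \<le> d * (1 - m * y)" by (simp add: d_q_def)
            then have "d * (m * y) \<le> d - d_q q \<omega> \<eta> ?X ?Y" by (simp add: algebra_simps)
            then have "M * (d * (m * y)) \<le> acceptance Psi u ?X * (d - d_q q \<omega> \<eta> ?X ?Y)"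
              using acc[of u "fst z" x] u R x True M d_nonneg m y by (intro mult_mono) auto
            then show ?thesis using loss_nonneg True by (simp add: g_def d_def right_diff_distrib mult_ac)
          next
            case False
            then show ?thesis using acceptance_d_q_loss[OF \<eta> \<omega>(1) close elim, of x] by (simp add: g_def)
          qed
        qed
      qed
    qed measurable
    also have "\<dots> \<le> ennreal (d_q q \<omega> \<eta> u v * (1 - c1 / 2 * (\<eta> * R / (1 + \<eta> * R)) + 2 * L * B * \<omega> * \<eta> powr (- q)))"
    proof (intro ennreal_leI mult_left_mono)
      define E where "E = \<eta> / (1 + \<eta> * s)"
      have E: "0 \<le> E" using \<eta> s1 by (simp add: E_def)
      have eq: "measure lam (cball 0 r) * (M * (m * y) * \<epsilon>0) = c1 * s * E"
        by (simp add: c1_def c0_def y_def E_def)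
      have "R * c1 \<le> s * c1" using s c1 by (intro mult_right_mono) auto
      then have "B \<le> c1 * s / 2" using RB by (simp add: mult.commute)
      then have 1: "E * B \<le> E * (c1 * s / 2)" by (intro mult_left_mono E)
      have "\<eta> * R / (1 + \<eta> * R) \<le> s * E"
      proof -
        have "0 < 1 + \<eta> * R" using \<eta> R by (intro add_pos_pos) auto
        moreover have "\<eta> * R * (1 + \<eta> * s) \<le> s * \<eta> * (1 + \<eta> * R)"
          using s \<eta> by (simp add: algebra_simps)
        ultimately show ?thesis using s1 by (simp add: E_def divide_le_eq le_divide_eq mult_ac)
      qed
      then have 2: "c1 / 2 * (\<eta> * R / (1 + \<eta> * R)) \<le> c1 / 2 * (s * E)"
        using c1 by (intro mult_left_mono) auto
      have 3: "c1 / 2 * (s * E) = c1 * s * E / 2" "E * (c1 * s / 2) = c1 * s * E / 2" by simp_all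
      have 4: "\<eta> / (1 + \<eta> * (norm u + norm v)) = E" by (simp add: E_def s_def)
      show "1 - measure lam (cball 0 r) * (M * (m * y) * \<epsilon>0) + \<eta> / (1 + \<eta> * (norm u + norm v)) * B
        + 2 * L * B * \<omega> * \<eta> powr (- q) \<le> 1 - c1 / 2 * (\<eta> * R / (1 + \<eta> * R)) + 2 * L * B * \<omega> * \<eta> powr (- q)"
        unfolding eq 4 using 1 2 unfolding 3 by linarith
    qed (rule d_q_nonneg[OF \<omega>(1)])
    finally show ?thesis .
  qed
  then show ?thesis using R c1 by (intro exI[of _ R] conjI exI[of _ "c1 / 2"]) auto
qed

text \<open>The radius of \<open>contraction_far\<close> is fixed first; then \<open>\<eta>\<close> is taken small against the gain inside this
radius, and finally \<open>\<omega>\<close> small against both gains.\<close>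

lemma contraction:
  assumes q0: "0 < q"
  shows "\<exists>\<eta> \<omega> \<alpha>. 0 < \<eta> \<and> \<eta> \<le> 1 \<and> 0 < \<omega> \<and> \<omega> \<le> 1 \<and> 0 \<le> \<alpha> \<and> \<alpha> < 1 \<and>
    (\<forall>u v. d_q q \<omega> \<eta> u v < 1 \<longrightarrow> transport_dist (d_q q \<omega> \<eta>) (P u) (P v) \<le> ennreal (\<alpha> * d_q q \<omega> \<eta> u v))"
proof -
  obtain r where r: "0 < r" "0 < measure lam (cball 0 r)" using exists_noise_radius by blast
  obtain R c where R: "0 < R" and c: "0 < c" "c \<le> 1" and far: "\<And>\<eta> \<omega> u v. 0 < \<eta> \<Longrightarrow> \<eta> \<le> 1 \<Longrightarrow> 0 < \<omega> \<Longrightarrow> \<omega> \<le> 1 \<Longrightarrow> R < norm u \<Longrightarrow> d_q q \<omega> \<eta> u v < 1 \<Longrightarrow>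
     transport_dist (d_q q \<omega> \<eta>) (P u) (P v)
      \<le> ennreal (d_q q \<omega> \<eta> u v * (1 - c * (\<eta> * R / (1 + \<eta> * R)) + 2 * L * B * \<omega> * \<eta> powr (- q)))"
    using contraction_far[OF q0 r] by blast
  obtain \<delta> where \<delta>: "0 < \<delta>" "\<delta> \<le> 1" and near: "\<And>\<eta> \<omega> u v. 0 < \<eta> \<Longrightarrow> \<eta> \<le> 1 \<Longrightarrow> 0 < \<omega> \<Longrightarrow> norm u \<le> R \<Longrightarrow> d_q q \<omega> \<eta> u v < 1 \<Longrightarrow>
     transport_dist (d_q q \<omega> \<eta>) (P u) (P v)
      \<le> ennreal (d_q q \<omega> \<eta> u v * (1 - \<delta> + \<eta> * B + 2 * L * B * \<omega> * \<eta> powr (- q)))"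
    using contraction_near[OF r R] by blast
  define \<eta> where "\<eta> = min 1 (\<delta> / (2 * B))"
  have \<eta>: "0 < \<eta>" "\<eta> \<le> 1" "\<eta> * B \<le> \<delta> / 2"
  proof -
    show "0 < \<eta>" "\<eta> \<le> 1" using \<delta> B_ge_1 by (auto simp: \<eta>_def)
    have "\<eta> * B \<le> \<delta> / (2 * B) * B" using B_ge_1 by (intro mult_right_mono) (auto simp: \<eta>_def)
    then show "\<eta> * B \<le> \<delta> / 2" using B_ge_1 by simp
  qed
  define \<delta>' where "\<delta>' = min (\<delta> / 2) (c * (\<eta> * R / (1 + \<eta> * R)))"
  have "0 < 1 + \<eta> * R" using \<eta> R by (intro add_pos_pos) auto
  then have \<delta>': "0 < \<delta>'" "\<delta>' \<le> 1" using \<delta> \<eta> R c by (auto simp: \<delta>'_def min_le_iff_disj)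
  define \<omega> where "\<omega> = min 1 (\<delta>' * \<eta> powr q / (4 * L * B))"
  have \<omega>: "0 < \<omega>" "\<omega> \<le> 1" using \<delta>' \<eta> L B_ge_1 by (auto simp: \<omega>_def)
  have small: "2 * L * B * \<omega> * \<eta> powr (- q) \<le> \<delta>' / 2"
  proof -
    have "2 * L * B * \<omega> * \<eta> powr (- q) \<le> 2 * L * B * (\<delta>' * \<eta> powr q / (4 * L * B)) * \<eta> powr (- q)"
      using L B_ge_1 by (intro mult_right_mono mult_left_mono) (auto simp: \<omega>_def)
    also have "\<dots> = \<delta>' / 2 * (\<eta> powr q * \<eta> powr (- q))" using L B_ge_1 by simp
    also have "\<eta> powr q * \<eta> powr (- q) = 1" using \<eta> by (simp add: powr_add[symmetric])
    finally show ?thesis by simp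
  qed
  have \<delta>'_le: "\<delta>' \<le> \<delta> / 2" "\<delta>' \<le> c * (\<eta> * R / (1 + \<eta> * R))" 
    unfolding \<delta>'_def by (rule min.cobounded1 min.cobounded2)+
  have bound: "T \<le> ennreal (t' * d_q q \<omega> \<eta> u v)"
    if "T \<le> ennreal (d_q q \<omega> \<eta> u v * t)" "t \<le> t'" for T t t' and u v :: 'a
  proof -
    have "d_q q \<omega> \<eta> u v * t \<le> t' * d_q q \<omega> \<eta> u v"
      using mult_right_mono[OF that(2) d_q_nonneg[OF \<omega>(1)]] by (simp add: mult.commute)
    then show ?thesis using that(1) by (meson ennreal_leI order_trans)
  qed
  have "transport_dist (d_q q \<omega> \<eta>) (P u) (P v) \<le> ennreal ((1 - \<delta>' / 2) * d_q q \<omega> \<eta> u v)" if close: "d_q q \<omega> \<eta> u v < 1" for u v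
  proof (cases "norm u \<le> R")
    case True
    have "1 - \<delta> + \<eta> * B + 2 * L * B * \<omega> * \<eta> powr (- q) \<le> 1 - \<delta>' / 2"
      using \<eta>(3) small \<delta>'_le by linarith
    then show ?thesis using near[OF \<eta>(1,2) \<omega>(1) True close] bound by blast
  next
    case False
    then have "R < norm u" by simp
    have "1 - c * (\<eta> * R / (1 + \<eta> * R)) + 2 * L * B * \<omega> * \<eta> powr (- q) \<le> 1 - \<delta>' / 2"
      using small \<delta>'_le by linarith
    then show ?thesis using far[OF \<eta>(1,2) \<omega> \<open>R < norm u\<close> close] bound by blast
  qed
  then show ?thesis using \<eta> \<omega> \<delta>'
    by (intro exI[of _ \<eta>] exI[of _ \<omega>] exI[of _ "1 - \<delta>' / 2"]) auto
qed

end

section \<open>Meeting in a bounded region\<close>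

lemma lyap_nonneg: "(\<And>j. j \<le> p \<Longrightarrow> 0 \<le> a j) \<Longrightarrow> 0 \<le> lyap a p u"
  unfolding lyap_def by (intro sum_nonneg mult_nonneg_nonneg) auto

lemma continuous_on_lyap: "continuous_on UNIV (lyap a p)"
  unfolding lyap_def by (intro continuous_intros)

lemma borel_measurable_lyap [measurable]:
  "(lyap a p :: 'a::{real_normed_vector, second_countable_topology} \<Rightarrow> real) \<in> borel_measurable borel"
  by (rule borel_measurable_continuous_onI[OF continuous_on_lyap])

text \<open>For small \<open>t\<close> the factor in front of \<open>s ^ j\<close> is close to 1; the price is a large constant in front of the
term in \<open>y\<close>.\<close>

lemma power_add_le_split:
  fixes s y t :: real
  assumes "0 \<le> s" "0 \<le> y" "0 < t" "j \<le> p"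
  shows "(s + y) ^ j \<le> (1 + t) ^ p * s ^ j + (1 + 1 / t) ^ p * (1 + 2 * y) ^ p"
proof (cases "y \<le> t * s")
  case True
  then have "(s + y) ^ j \<le> ((1 + t) * s) ^ j" using assms by (intro power_mono) (auto simp: algebra_simps)
  also have "\<dots> = (1 + t) ^ j * s ^ j" by (rule power_mult_distrib)
  also have "\<dots> \<le> (1 + t) ^ p * s ^ j" using assms by (intro mult_right_mono power_increasing) auto
  also have "\<dots> \<le> (1 + t) ^ p * s ^ j + (1 + 1 / t) ^ p * (1 + 2 * y) ^ p" using assms by simp
  finally show ?thesis .
next
  case False
  then have "s \<le> y / t" using assms by (simp add: pos_le_divide_eq mult.commute)
  then have "(s + y) ^ j \<le> ((1 + 1 / t) * y) ^ j" using assms by (intro power_mono) (auto simp: algebra_simps)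
  also have "\<dots> = (1 + 1 / t) ^ j * y ^ j" by (rule power_mult_distrib)
  also have "\<dots> \<le> (1 + 1 / t) ^ p * (1 + 2 * y) ^ p"
  proof (intro mult_mono)
    show "(1 + 1 / t) ^ j \<le> (1 + 1 / t) ^ p" using assms by (intro power_increasing) auto
    have "y ^ j \<le> (1 + 2 * y) ^ j" using assms by (intro power_mono) auto
    also have "\<dots> \<le> (1 + 2 * y) ^ p" using assms by (intro power_increasing) auto
    finally show "y ^ j \<le> (1 + 2 * y) ^ p" .
  qed (use assms in auto)
  also have "\<dots> \<le> (1 + t) ^ p * s ^ j + (1 + 1 / t) ^ p * (1 + 2 * y) ^ p" using assms by simp
  finally show ?thesis .
qed

lemma nn_integral_rcar_proposal:
  fixes K :: "'a::{banach, second_countable_topology} \<Rightarrow> 'a measure"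
  assumes K: "K \<in> borel \<rightarrow>\<^sub>M prob_algebra borel"
    and lam: "prob_space lam" "sets lam = sets borel"
    and f [measurable]: "f \<in> borel_measurable borel"
  shows "(\<integral>\<^sup>+ y. f y \<partial>rcar_proposal K lam u) = (\<integral>\<^sup>+ x. \<integral>\<^sup>+ z. f (z + x) \<partial>K u \<partial>lam)"
proof -
  note [measurable_cong] = lam(2)
  have Ku: "prob_space (K u)" and sK [measurable_cong]: "sets (K u) = sets borel"
    using measurable_space[OF K, of u] by (auto simp: space_prob_algebra)
  interpret Ku: prob_space "K u" by fact
  interpret lam: prob_space lam by fact
  interpret pair_prob_space "K u" lam ..
  have "(\<integral>\<^sup>+ y. f y \<partial>rcar_proposal K lam u) = (\<integral>\<^sup>+ zx. f (fst zx + snd zx) \<partial>(K u \<Otimes>\<^sub>M lam))"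
    unfolding rcar_proposal_def by (subst nn_integral_distr) (auto simp: case_prod_beta')
  also have "\<dots> = (\<integral>\<^sup>+ x. \<integral>\<^sup>+ z. f (z + x) \<partial>K u \<partial>lam)"
    by (subst nn_integral_snd[symmetric]) auto
  finally show ?thesis .
qed

text \<open>Adding the same noise to both coupled points leaves their difference unchanged.\<close>

lemma transport_dist_rcar_proposal_le:
  fixes K :: "'a::{banach, second_countable_topology} \<Rightarrow> 'a measure"
  assumes K: "K \<in> borel \<rightarrow>\<^sub>M prob_algebra borel"
    and lam: "prob_space lam" "sets lam = sets borel"
    and \<pi>: "\<pi> \<in> couplings (K u) (K v)"
  shows "transport_dist (\<lambda>x y. norm (x - y)) (rcar_proposal K lam u) (rcar_proposal K lam v)
    \<le> (\<integral>\<^sup>+ z. ennreal (norm (fst z - snd z)) \<partial>\<pi>)"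
proof -
  note [measurable_cong] = lam(2)
  have s\<pi> [measurable_cong]: "sets \<pi> = sets (borel \<Otimes>\<^sub>M borel)"
    and m\<pi>: "distr \<pi> borel fst = K u" "distr \<pi> borel snd = K v" and "prob_space \<pi>"
    using \<pi> by (auto simp: couplings_def)
  interpret \<pi>: prob_space \<pi> by fact
  interpret lam: prob_space lam by fact
  interpret M: pair_prob_space lam \<pi> ..
  have sM [measurable_cong]: "sets (lam \<Otimes>\<^sub>M \<pi>) = sets (borel \<Otimes>\<^sub>M (borel \<Otimes>\<^sub>M borel))"
    by (intro sets_pair_measure_cong lam s\<pi>)
  define S where "S = distr (lam \<Otimes>\<^sub>M \<pi>) (borel \<Otimes>\<^sub>M borel) (\<lambda>m. (fst (snd m) + fst m, snd (snd m) + fst m))"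
  have sS [measurable_cong]: "sets S = sets (borel \<Otimes>\<^sub>M borel)" by (simp add: S_def)
  have int_S: "(\<integral>\<^sup>+ y. g y \<partial>S) = (\<integral>\<^sup>+ x. \<integral>\<^sup>+ z. g (fst z + x, snd z + x) \<partial>\<pi> \<partial>lam)"
    if [measurable]: "g \<in> borel_measurable (borel \<Otimes>\<^sub>M borel)" for g
    unfolding S_def by (subst nn_integral_distr) (auto simp: \<pi>.nn_integral_fst[symmetric])
  have "S \<in> couplings (rcar_proposal K lam u) (rcar_proposal K lam v)"
  proof -
    have "prob_space S" unfolding S_def by (rule M.prob_space_distr) measurable
    moreover have "distr S borel fst = rcar_proposal K lam u"
    proof (rule measure_eqI)
      fix A :: "'a set" assume "A \<in> sets (distr S borel fst)"
      then have A [measurable]: "A \<in> sets borel" by simp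
      have "emeasure (distr S borel fst) A = (\<integral>\<^sup>+ y. indicator A y \<partial>distr S borel fst)" by simp
      also have "\<dots> = (\<integral>\<^sup>+ x. \<integral>\<^sup>+ z. indicator A (fst z + x) \<partial>\<pi> \<partial>lam)"
        by (simp add: nn_integral_distr int_S del: nn_integral_indicator)
      also have "\<dots> = (\<integral>\<^sup>+ x. \<integral>\<^sup>+ z. indicator A (z + x) \<partial>K u \<partial>lam)"
        unfolding m\<pi>(1)[symmetric] by (simp add: nn_integral_distr)
      also have "\<dots> = (\<integral>\<^sup>+ y. indicator A y \<partial>rcar_proposal K lam u)"
        by (rule nn_integral_rcar_proposal[OF K lam, symmetric]) measurable
      finally show "emeasure (distr S borel fst) A = emeasure (rcar_proposal K lam u) A" by simp
    qed simp
    moreover have "distr S borel snd = rcar_proposal K lam v"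
    proof (rule measure_eqI)
      fix A :: "'a set" assume "A \<in> sets (distr S borel snd)"
      then have A [measurable]: "A \<in> sets borel" by simp
      have "emeasure (distr S borel snd) A = (\<integral>\<^sup>+ y. indicator A y \<partial>distr S borel snd)" by simp
      also have "\<dots> = (\<integral>\<^sup>+ x. \<integral>\<^sup>+ z. indicator A (snd z + x) \<partial>\<pi> \<partial>lam)"
        by (simp add: nn_integral_distr int_S del: nn_integral_indicator)
      also have "\<dots> = (\<integral>\<^sup>+ x. \<integral>\<^sup>+ z. indicator A (z + x) \<partial>K v \<partial>lam)"
        unfolding m\<pi>(2)[symmetric] by (simp add: nn_integral_distr)
      also have "\<dots> = (\<integral>\<^sup>+ y. indicator A y \<partial>rcar_proposal K lam v)"
        by (rule nn_integral_rcar_proposal[OF K lam, symmetric]) measurable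
      finally show "emeasure (distr S borel snd) A = emeasure (rcar_proposal K lam v) A" by simp
    qed simp
    ultimately show ?thesis by (simp add: couplings_def sS)
  qed
  then have "transport_dist (\<lambda>x y. norm (x - y)) (rcar_proposal K lam u) (rcar_proposal K lam v)
      \<le> (\<integral>\<^sup>+ z. ennreal (norm (fst z - snd z)) \<partial>S)"
    unfolding transport_dist_def by (rule INF_lower)
  also have "\<dots> = (\<integral>\<^sup>+ x. \<integral>\<^sup>+ z. ennreal (norm (fst z - snd z)) \<partial>\<pi> \<partial>lam)"
    by (subst int_S) auto
  also have "\<dots> = (\<integral>\<^sup>+ z. ennreal (norm (fst z - snd z)) \<partial>\<pi>)"
    by (simp add: lam.emeasure_space_1)
  finally show ?thesis .
qed

context rcar
begin

text \<open>The mean contraction of the coupling with the second point 0, which \<open>K\<close> leaves fixed.\<close>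

lemma K_mean: "(\<integral>\<^sup>+ z. ennreal (norm z) \<partial>K u) \<le> ennreal (\<beta>c * norm u)"
proof -
  have "(\<integral>\<^sup>+ z. ennreal (norm z) \<partial>K u) = (\<integral>\<^sup>+ z. ennreal (norm (fst z)) \<partial>coup u 0)"
    unfolding fst_coup[of u 0, symmetric] by (subst nn_integral_distr) auto
  also have "\<dots> = (\<integral>\<^sup>+ z. ennreal (norm (fst z - snd z)) \<partial>coup u 0)"
    using AE_coup_snd[where u=u and v=0] by (intro nn_integral_cong_AE) auto
  also have "\<dots> \<le> ennreal (\<beta>c * norm (u - 0))" by (rule coup_mean)
  finally show ?thesis by simp
qed

text \<open>Conditioning the noise to be bounded confines the chain to a bounded set for a given number of
steps; there the acceptance probability is bounded below.\<close>

definition trunc_noise where "trunc_noise r = uniform_measure lam (cball 0 r)"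

definition trunc_proposal where "trunc_proposal r = rcar_proposal K (trunc_noise r)"

lemma trunc_noise:
  assumes "0 < measure lam (cball 0 r)"
  shows "prob_space (trunc_noise r)" "sets (trunc_noise r) = sets borel" "AE x in trunc_noise r. norm x \<le> r"
proof -
  have ne: "emeasure lam (cball 0 r) \<noteq> 0" "emeasure lam (cball 0 r) \<noteq> \<infinity>"
    using assms by (auto simp: lam.emeasure_eq_measure)
  show "prob_space (trunc_noise r)" unfolding trunc_noise_def by (rule prob_space_uniform_measure[OF ne])
  show "sets (trunc_noise r) = sets borel" by (simp add: trunc_noise_def)
  show "AE x in trunc_noise r. norm x \<le> r"
    unfolding trunc_noise_def by (rule AE_uniform_measureI) auto
qed

lemma trunc_proposal_kernel:
  assumes "0 < measure lam (cball 0 r)"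
  shows "trunc_proposal r \<in> borel \<rightarrow>\<^sub>M prob_algebra borel"
  unfolding trunc_proposal_def by (rule rcar_proposal_measurable[OF K trunc_noise(1,2)[OF assms]])

lemma trunc_proposal_mean:
  assumes r: "0 < r" "0 < measure lam (cball 0 r)"
  shows "(\<integral>\<^sup>+ y. ennreal (norm y) \<partial>trunc_proposal r u) \<le> ennreal (\<beta>c * norm u + r)"
proof -
  note tn = trunc_noise[OF r(2)]
  interpret tn: prob_space "trunc_noise r" by (rule tn)
  note [measurable_cong] = tn(2)
  interpret Ku: prob_space "K u" by (rule prob_K)
  have "(\<integral>\<^sup>+ y. ennreal (norm y) \<partial>trunc_proposal r u) = (\<integral>\<^sup>+ x. \<integral>\<^sup>+ z. ennreal (norm (z + x)) \<partial>K u \<partial>trunc_noise r)"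
    unfolding trunc_proposal_def by (rule nn_integral_rcar_proposal[OF K tn(1,2)]) measurable
  also have "\<dots> \<le> (\<integral>\<^sup>+ x. ennreal (\<beta>c * norm u + r) \<partial>trunc_noise r)"
  proof (rule nn_integral_mono_AE)
    show "AE x in trunc_noise r. (\<integral>\<^sup>+ z. ennreal (norm (z + x)) \<partial>K u) \<le> ennreal (\<beta>c * norm u + r)"
      using tn(3)
    proof eventually_elim
      case (elim x)
      have "(\<integral>\<^sup>+ z. ennreal (norm (z + x)) \<partial>K u) \<le> (\<integral>\<^sup>+ z. ennreal (norm z) + ennreal r \<partial>K u)"
        using elim r by (intro nn_integral_mono) (auto simp flip: ennreal_plus intro!: ennreal_leI norm_triangle_le)
      also have "\<dots> = (\<integral>\<^sup>+ z. ennreal (norm z) \<partial>K u) + ennreal r"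
        using Ku.emeasure_space_1 by (simp add: nn_integral_add)
      also have "\<dots> \<le> ennreal (\<beta>c * norm u) + ennreal r" by (intro add_right_mono K_mean)
      also have "\<dots> = ennreal (\<beta>c * norm u + r)" using \<beta>c r by (simp add: ennreal_plus)
      finally show ?case .
    qed
  qed
  also have "\<dots> = ennreal (\<beta>c * norm u + r)" using tn.emeasure_space_1 by simp
  finally show ?thesis .
qed

lemma trunc_proposal_le_P:
  assumes r: "0 < r" "0 < measure lam (cball 0 r)" and R: "0 \<le> R"
  shows "\<exists>\<epsilon>>0. \<epsilon> \<le> 1 \<and> (\<forall>u A. norm u \<le> R \<longrightarrow> A \<in> sets borel \<longrightarrow>
     ennreal \<epsilon> * emeasure (trunc_proposal r u) A \<le> emeasure (P u) A)"
proof -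
  note tn = trunc_noise[OF r(2)]
  obtain a where a: "0 < a" "a \<le> 1" and acc: "\<And>u z x. norm u \<le> R \<Longrightarrow> norm z \<le> norm u \<Longrightarrow> norm x \<le> r \<Longrightarrow> a \<le> acceptance Psi u (z + x)"
    using acceptance_ge_on_ball[OF R, of r] r by auto
  define m where "m = measure lam (cball 0 r)"
  have m: "0 < m" "m \<le> 1" "emeasure lam (cball 0 r) = ennreal m" using r by (auto simp: m_def lam.emeasure_eq_measure)
  have "ennreal (a * m) * emeasure (trunc_proposal r u) A \<le> emeasure (P u) A"
    if u: "norm u \<le> R" and A [measurable]: "A \<in> sets borel" for u A
  proof -
    interpret Ku: prob_space "K u" by (rule prob_K)
    have [measurable]: "cball 0 r \<in> sets (borel :: 'a measure)" by simp
    have [measurable]: "(\<lambda>x. \<integral>\<^sup>+ z. indicator A (z + x) \<partial>K u) \<in> borel_measurable lam"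
      by measurable
    have "emeasure (trunc_proposal r u) A = (\<integral>\<^sup>+ y. indicator A y \<partial>trunc_proposal r u)"
      by (simp add: trunc_proposal_def)
    also have "\<dots> = (\<integral>\<^sup>+ x. \<integral>\<^sup>+ z. indicator A (z + x) \<partial>K u \<partial>trunc_noise r)"
      unfolding trunc_proposal_def by (rule nn_integral_rcar_proposal[OF K tn(1,2)]) measurable
    also have "\<dots> = (\<integral>\<^sup>+ x. (\<integral>\<^sup>+ z. indicator A (z + x) \<partial>K u) * indicator (cball 0 r) x \<partial>lam) / ennreal m"
      unfolding trunc_noise_def m(3)[symmetric] by (rule nn_integral_uniform_measure) measurable
    finally have "ennreal (a * m) * emeasure (trunc_proposal r u) A
        = ennreal a * (ennreal m * ((\<integral>\<^sup>+ x. (\<integral>\<^sup>+ z. indicator A (z + x) \<partial>K u) * indicator (cball 0 r) x \<partial>lam) / ennreal m))"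
      using a m by (simp add: ennreal_mult mult.assoc)
    also have "ennreal m * ((\<integral>\<^sup>+ x. (\<integral>\<^sup>+ z. indicator A (z + x) \<partial>K u) * indicator (cball 0 r) x \<partial>lam) / ennreal m)
      = (\<integral>\<^sup>+ x. (\<integral>\<^sup>+ z. indicator A (z + x) \<partial>K u) * indicator (cball 0 r) x \<partial>lam)"
      using m by (simp add: ennreal_times_divide mult.commute[of "ennreal m"] ennreal_mult_divide_eq)
    also have "ennreal a * \<dots> = (\<integral>\<^sup>+ x. ennreal a * ((\<integral>\<^sup>+ z. indicator A (z + x) \<partial>K u) * indicator (cball 0 r) x) \<partial>lam)"
      by (rule nn_integral_cmult[symmetric]) measurable
    also have "\<dots> = (\<integral>\<^sup>+ x. (\<integral>\<^sup>+ z. ennreal a * indicator A (z + x) * indicator (cball 0 r) x \<partial>K u) \<partial>lam)"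
      by (intro nn_integral_cong) (simp add: nn_integral_cmult nn_integral_multc mult.assoc)
    also have "\<dots> \<le> (\<integral>\<^sup>+ x. \<integral>\<^sup>+ z. ennreal (acceptance Psi u (z + x)) * indicator A (z + x)
        + ennreal (1 - acceptance Psi u (z + x)) * indicator A u \<partial>K u \<partial>lam)"
    proof (rule nn_integral_mono, rule nn_integral_mono_AE)
      fix x
      show "AE z in K u. ennreal a * indicator A (z + x) * indicator (cball 0 r) x
        \<le> ennreal (acceptance Psi u (z + x)) * indicator A (z + x) + ennreal (1 - acceptance Psi u (z + x)) * indicator A u"
        using K_norm[of u]
      proof eventually_elim
        case (elim z)
        have "ennreal a * indicator A (z + x) * indicator (cball 0 r) x \<le> ennreal (acceptance Psi u (z + x)) * indicator A (z + x)"
          using acc[OF u elim, of x] by (auto simp: indicator_def intro: ennreal_leI)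
        then show ?case by (rule order_trans) (simp add: add_increasing2)
      qed
    qed
    also have "\<dots> = (\<integral>\<^sup>+ y. indicator A y \<partial>P u)"
      by (rule nn_integral_rcar_mh[OF Psi K lam, symmetric]) measurable
    finally show ?thesis by simp
  qed
  then show ?thesis using a m by (intro exI[of _ "a * m"]) (auto simp: mult_le_one)
qed

text \<open>The support bound is carried through the induction because the domination of a single step is only
uniform on balls.\<close>

lemma trunc_proposal_pow_le_P_pow:
  assumes r: "0 < r" "0 < measure lam (cball 0 r)" and R: "0 \<le> R"
  shows "\<exists>\<epsilon>>0. \<epsilon> \<le> 1 \<and> (\<forall>u. norm u \<le> R \<longrightarrow>
     (\<forall>A\<in>sets borel. ennreal \<epsilon> * emeasure (kernel_pow (trunc_proposal r) n (return borel u)) A \<le> emeasure (kernel_pow P n (return borel u)) A) \<and>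
     (AE y in kernel_pow (trunc_proposal r) n (return borel u). norm y \<le> R + real n * r))"
proof (induction n)
  case 0
  show ?case unfolding kernel_pow_0 by (intro exI[of _ 1]) (auto simp: AE_return)
next
  case (Suc n)
  then obtain \<epsilon> where \<epsilon>: "0 < \<epsilon>" "\<epsilon> \<le> 1"
    and le: "\<And>u A. norm u \<le> R \<Longrightarrow> A \<in> sets borel \<Longrightarrow>
      ennreal \<epsilon> * emeasure (kernel_pow (trunc_proposal r) n (return borel u)) A \<le> emeasure (kernel_pow P n (return borel u)) A"
    and bd: "\<And>u. norm u \<le> R \<Longrightarrow> AE y in kernel_pow (trunc_proposal r) n (return borel u). norm y \<le> R + real n * r"
    by blast
  have R': "0 \<le> R + real n * r" using R r by simp
  obtain \<epsilon>' where \<epsilon>': "0 < \<epsilon>'" "\<epsilon>' \<le> 1"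
    and le': "\<And>u A. norm u \<le> R + real n * r \<Longrightarrow> A \<in> sets borel \<Longrightarrow> ennreal \<epsilon>' * emeasure (trunc_proposal r u) A \<le> emeasure (P u) A"
    using trunc_proposal_le_P[OF r R'] by blast
  note Q = trunc_proposal_kernel[OF r(2)]
  note [measurable] = measurable_prob_algebraD[OF Q] measurable_prob_algebraD[OF P]
  show ?case
  proof (intro exI[of _ "\<epsilon> * \<epsilon>'"] conjI allI impI ballI)
    show "0 < \<epsilon> * \<epsilon>'" "\<epsilon> * \<epsilon>' \<le> 1" using \<epsilon> \<epsilon>' by (auto simp: mult_le_one)
    fix u :: 'a assume u: "norm u \<le> R"
    let ?q = "kernel_pow (trunc_proposal r) n (return borel u)" and ?p = "kernel_pow P n (return borel u)"
    have q_prob: "?q \<in> space (prob_algebra borel)" and p_prob: "?p \<in> space (prob_algebra borel)"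
      by (auto intro!: kernel_pow_in_prob_algebra Q P)
    then have [measurable_cong]: "sets ?q = sets borel" "sets ?p = sets borel" by (auto simp: space_prob_algebra)
    have [simp]: "space ?q = UNIV" "space ?p = UNIV"
      using \<open>sets ?q = sets borel\<close> \<open>sets ?p = sets borel\<close> by (auto dest!: sets_eq_imp_space_eq)
    {
      fix A :: "'a set" assume A [measurable]: "A \<in> sets borel"
      have "ennreal (\<epsilon> * \<epsilon>') * emeasure (?q \<bind> trunc_proposal r) A
          = ennreal \<epsilon> * (\<integral>\<^sup>+ x. ennreal \<epsilon>' * emeasure (trunc_proposal r x) A \<partial>?q)"
        using \<epsilon> \<epsilon>' by (subst emeasure_bind[where N=borel]) (auto simp: ennreal_mult mult.assoc nn_integral_cmult)
      also have "\<dots> \<le> ennreal \<epsilon> * (\<integral>\<^sup>+ x. emeasure (P x) A \<partial>?q)"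
        using bd[OF u] by (intro mult_left_mono nn_integral_mono_AE) (auto intro: le' A)
      also have "\<dots> = (\<integral>\<^sup>+ x. emeasure (P x) A \<partial>scale_measure (ennreal \<epsilon>) ?q)"
        by (rule nn_integral_scale_measure[symmetric]) measurable
      also have "\<dots> \<le> (\<integral>\<^sup>+ x. emeasure (P x) A \<partial>?p)"
      proof (rule nn_integral_mono_measure)
        show "sets (scale_measure (ennreal \<epsilon>) ?q) = sets ?p" by (simp add: \<open>sets ?q = sets borel\<close> \<open>sets ?p = sets borel\<close>)
        then show "scale_measure (ennreal \<epsilon>) ?q \<le> ?p"
          using le[OF u] by (subst le_measure) (auto simp: le_fun_def \<open>sets ?p = sets borel\<close> \<open>sets ?q = sets borel\<close>)
      qed
      also have "\<dots> = emeasure (?p \<bind> P) A"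
        by (subst emeasure_bind[where N=borel]) auto
      finally show "ennreal (\<epsilon> * \<epsilon>') * emeasure (kernel_pow (trunc_proposal r) (Suc n) (return borel u)) A
          \<le> emeasure (kernel_pow P (Suc n) (return borel u)) A"
        by (simp add: kernel_pow_Suc)
    }
    have Q_AE: "AE y in trunc_proposal r x. norm y \<le> R + real (Suc n) * r" if x: "norm x \<le> R + real n * r" for x
    proof -
      note tn = trunc_noise[OF r(2)]
      note [measurable_cong] = tn(2)
      let ?N = "{y. \<not> norm y \<le> R + real (Suc n) * r}"
      have N [measurable]: "?N \<in> sets borel" by measurable
      have "emeasure (trunc_proposal r x) ?N = (\<integral>\<^sup>+ y. indicator ?N y \<partial>trunc_proposal r x)"
        by (simp add: trunc_proposal_def)
      also have "\<dots> = (\<integral>\<^sup>+ w. \<integral>\<^sup>+ z. indicator ?N (z + w) \<partial>K x \<partial>trunc_noise r)"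
        unfolding trunc_proposal_def by (rule nn_integral_rcar_proposal[OF K tn(1,2)]) measurable
      also have "\<dots> = (\<integral>\<^sup>+ w. 0 \<partial>trunc_noise r)"
      proof (rule nn_integral_cong_AE)
        show "AE w in trunc_noise r. (\<integral>\<^sup>+ z. indicator ?N (z + w) \<partial>K x) = 0"
          using tn(3)
        proof eventually_elim
          case (elim w)
          have "(\<integral>\<^sup>+ z. indicator ?N (z + w) \<partial>K x) = (\<integral>\<^sup>+ z. 0 \<partial>K x)"
          proof (rule nn_integral_cong_AE)
            show "AE z in K x. indicator ?N (z + w) = (0::ennreal)"
              using K_norm[of x]
            proof eventually_elim
              case (elim z)
              then have "norm (z + w) \<le> R + real (Suc n) * r"
                using norm_triangle_ineq[of z w] x \<open>norm w \<le> r\<close> by (simp add: algebra_simps)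
              then show ?case by simp
            qed
          qed
          then show ?case by simp
        qed
      qed
      finally have "emeasure (trunc_proposal r x) ?N = 0" by simp
      then show ?thesis
        by (intro AE_I[where N="?N"]) (auto simp: trunc_proposal_def)
    qed
    have "AE y in ?q \<bind> trunc_proposal r. norm y \<le> R + real (Suc n) * r"
      using bd[OF u] Q_AE by (subst AE_bind[where B=borel]) auto
    then show "AE y in kernel_pow (trunc_proposal r) (Suc n) (return borel u). norm y \<le> R + real (Suc n) * r"
      unfolding kernel_pow_Suc .
  qed
qed

text \<open>After \<open>n\<close> steps the chains that accept all proposals and use bounded noise have mean distance at most
\<open>\<beta>c ^ n * (2 * R)\<close>, while their mean norms stay bounded. So their \<open>d_q\<close>-cost is at most \<open>1 / 2\<close> for large
\<open>n\<close>, and \<open>P\<close> follows them with a probability bounded below.\<close>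

lemma small_set:
  assumes \<eta>: "0 < \<eta>" and \<omega>: "0 < \<omega>" and R: "0 < R"
  shows "\<exists>n\<ge>1. \<exists>s>0. s \<le> 1 \<and> (\<forall>u v. norm u \<le> R \<longrightarrow> norm v \<le> R \<longrightarrow>
    transport_dist (d_q q \<omega> \<eta>) (kernel_pow P n (return borel u)) (kernel_pow P n (return borel v)) \<le> ennreal (1 - s))"
proof -
  obtain r where r: "0 < r" "0 < measure lam (cball 0 r)" using exists_noise_radius by blast
  define Q where "Q = trunc_proposal r"
  have Q: "Q \<in> borel \<rightarrow>\<^sub>M prob_algebra borel" unfolding Q_def by (rule trunc_proposal_kernel[OF r(2)])
  define m where "m = R + r / (1 - \<beta>c)"
  have m: "0 < m" using R r \<beta>c by (simp add: m_def add_pos_pos)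
  \<comment> \<open>By Markov's inequality norms beyond R' contribute at most 1/4 to the cost; the choice of n makes the rest another 1/4.\<close>
  define R' where "R' = 8 * m"
  have R': "0 < R'" using m by (simp add: R'_def)
  define D where "D = (1 + \<eta> * R') powr q / \<omega>"
  have "0 < 1 + \<eta> * R'" using \<eta> R' by (intro add_pos_pos mult_pos_pos) auto
  then have D: "0 < D" using \<omega> by (simp add: D_def)
  have "(\<lambda>n. \<beta>c ^ n) \<longlonglongrightarrow> 0" using \<beta>c by (intro LIMSEQ_power_zero) auto
  then have "eventually (\<lambda>n. \<beta>c ^ n < 1 / (8 * D * R)) sequentially"
    using D R by (intro order_tendstoD) auto
  then obtain n where n: "1 \<le> n" "\<beta>c ^ n < 1 / (8 * D * R)"
    using eventually_happens'[OF sequentially_bot eventually_conj[OF _ eventually_ge_at_top[of 1]]] by blast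
  have R0: "0 \<le> R" using R by simp
  obtain \<epsilon> where \<epsilon>: "0 < \<epsilon>" "\<epsilon> \<le> 1"
    and le: "\<And>u A. norm u \<le> R \<Longrightarrow> A \<in> sets borel \<Longrightarrow>
      ennreal \<epsilon> * emeasure (kernel_pow Q n (return borel u)) A \<le> emeasure (kernel_pow P n (return borel u)) A"
    using trunc_proposal_pow_le_P_pow[OF r R0, of n] unfolding Q_def by blast
  have mean: "(\<integral>\<^sup>+ y. ennreal (norm y) \<partial>kernel_pow Q k (return borel u)) \<le> ennreal (\<beta>c ^ k * norm u + r / (1 - \<beta>c))" for k u
    using \<beta>c r trunc_proposal_mean[OF r] by (intro kernel_pow_drift Q) (auto simp: Q_def)
  have "transport_dist (d_q q \<omega> \<eta>) (kernel_pow P n (return borel u)) (kernel_pow P n (return borel v)) \<le> ennreal (1 - \<epsilon> / 2)"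
    if u: "norm u \<le> R" and v: "norm v \<le> R" for u v
  proof -
    let ?qu = "kernel_pow Q n (return borel u)" and ?qv = "kernel_pow Q n (return borel v)"
    let ?pu = "kernel_pow P n (return borel u)" and ?pv = "kernel_pow P n (return borel v)"
    let ?c = "\<lambda>x y :: 'a. norm (x - y)"
    have "transport_dist ?c ?qu ?qv \<le> ennreal (\<beta>c ^ n) * transport_dist ?c (return borel u) (return borel v)"
    proof (rule transport_dist_kernel_pow_le[OF Q, where f=norm])
      show "transport_dist ?c (Q x) (Q y) \<le> ennreal (\<beta>c * norm (x - y))" for x y
        unfolding Q_def trunc_proposal_def
        by (rule order_trans[OF transport_dist_rcar_proposal_le[OF K trunc_noise(1,2)[OF r(2)] coup] coup_mean])
      show "(\<integral>\<^sup>+ y. ennreal (norm y) \<partial>Q x) < \<infinity>" for x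
        unfolding Q_def using trunc_proposal_mean[OF r, of x] by (auto intro: order.strict_trans1)
      show "(\<integral>\<^sup>+ y. ennreal (norm y) \<partial>kernel_pow Q k (return borel x)) < \<infinity>" 
         "(\<integral>\<^sup>+ y. ennreal (norm y) \<partial>kernel_pow Q k (return borel x)) < \<infinity>" for k x
        using mean[of k x] by (auto intro: order.strict_trans1)
    qed (use \<beta>c in \<open>auto intro!: continuous_intros norm_triangle_ineq4\<close>)
    also have "\<dots> \<le> ennreal (\<beta>c ^ n) * ennreal (norm (u - v))"
      by (intro mult_left_mono transport_dist_return_le) auto
    also have "\<dots> \<le> ennreal (\<beta>c ^ n) * ennreal (2 * R)"
      using norm_triangle_ineq4[of u v] u v by (intro mult_left_mono ennreal_leI) auto
    also have "\<dots> = ennreal (\<beta>c ^ n * (2 * R))" using \<beta>c R by (simp add: ennreal_mult)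
    also have "\<dots> < ennreal (1 / (4 * D))"
    proof (rule ennreal_lessI)
      have "\<beta>c ^ n * (2 * R) < 1 / (8 * D * R) * (2 * R)" using n R by (intro mult_strict_right_mono) auto
      then show "\<beta>c ^ n * (2 * R) < 1 / (4 * D)" using R D by simp
    qed (use D in simp)
    finally obtain \<pi> where \<pi>: "\<pi> \<in> couplings ?qu ?qv"
      and less: "(\<integral>\<^sup>+ z. ennreal (norm (fst z - snd z)) \<partial>\<pi>) < ennreal (1 / (4 * D))"
      unfolding transport_dist_def by (auto simp: INF_less_iff)
    have s\<pi> [measurable_cong]: "sets \<pi> = sets (borel \<Otimes>\<^sub>M borel)"
      and m\<pi>: "distr \<pi> borel fst = ?qu" "distr \<pi> borel snd = ?qv" and "prob_space \<pi>"
      using \<pi> by (auto simp: couplings_def)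
    interpret \<pi>: prob_space \<pi> by fact
    have [simp]: "space \<pi> = UNIV" using sets_eq_imp_space_eq[OF s\<pi>] by (simp add: space_pair_measure)
    have [measurable]: "(\<lambda>z :: 'a \<times> 'a. d_q q \<omega> \<eta> (fst z) (snd z)) \<in> borel_measurable (borel \<Otimes>\<^sub>M borel)"
      using \<eta> by (intro borel_measurable_d_q) simp
    have pt: "d_q q \<omega> \<eta> x y \<le> D * norm (x - y) + 1 / R' * norm x + 1 / R' * norm y" for x y :: 'a
    proof (cases "norm x + norm y \<le> R'")
      case True
      then have "\<eta> * (norm x + norm y) \<le> \<eta> * R'" using \<eta> by (intro mult_left_mono) auto
      then have "(1 + \<eta> * norm x + \<eta> * norm y) powr q \<le> (1 + \<eta> * R') powr q"
        using \<eta> q by (intro powr_mono2) (auto simp: distrib_left)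
      then have "(1 + \<eta> * norm x + \<eta> * norm y) powr q * norm (x - y) / \<omega> \<le> (1 + \<eta> * R') powr q * norm (x - y) / \<omega>"
        using \<omega> by (intro divide_right_mono mult_right_mono) auto
      then have "d_q q \<omega> \<eta> x y \<le> D * norm (x - y)" by (simp add: d_q_def D_def)
      moreover have "0 \<le> 1 / R' * norm x" "0 \<le> 1 / R' * norm y" using R' by auto
      ultimately show ?thesis by linarith
    next
      case False
      have "d_q q \<omega> \<eta> x y \<le> 1" by (rule d_q_le_1)
      also have "1 \<le> (norm x + norm y) / R'" using False R' by simp
      also have "\<dots> = 1 / R' * norm x + 1 / R' * norm y" by (simp add: add_divide_distrib)
      also have "\<dots> \<le> D * norm (x - y) + 1 / R' * norm x + 1 / R' * norm y" using D by simp
      finally show ?thesis .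
    qed
    have "(\<integral>\<^sup>+ z. ennreal (d_q q \<omega> \<eta> (fst z) (snd z)) \<partial>\<pi>)
      \<le> (\<integral>\<^sup>+ z. ennreal D * ennreal (norm (fst z - snd z)) + ennreal (1 / R') * ennreal (norm (fst z)) + ennreal (1 / R') * ennreal (norm (snd z)) \<partial>\<pi>)"
      using pt D R' by (intro nn_integral_mono) (auto simp flip: ennreal_mult ennreal_plus intro!: ennreal_leI)
    also have "\<dots> = ennreal D * (\<integral>\<^sup>+ z. ennreal (norm (fst z - snd z)) \<partial>\<pi>) + ennreal (1 / R') * (\<integral>\<^sup>+ z. ennreal (norm (fst z)) \<partial>\<pi>)
        + ennreal (1 / R') * (\<integral>\<^sup>+ z. ennreal (norm (snd z)) \<partial>\<pi>)"
      by (simp add: nn_integral_add nn_integral_cmult)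
    also have "(\<integral>\<^sup>+ z. ennreal (norm (fst z)) \<partial>\<pi>) = (\<integral>\<^sup>+ y. ennreal (norm y) \<partial>?qu)"
      unfolding m\<pi>[symmetric] by (subst nn_integral_distr) auto
    also have "(\<integral>\<^sup>+ z. ennreal (norm (snd z)) \<partial>\<pi>) = (\<integral>\<^sup>+ y. ennreal (norm y) \<partial>?qv)"
      unfolding m\<pi>[symmetric] by (subst nn_integral_distr) auto
    also have "ennreal D * (\<integral>\<^sup>+ z. ennreal (norm (fst z - snd z)) \<partial>\<pi>) + ennreal (1 / R') * (\<integral>\<^sup>+ y. ennreal (norm y) \<partial>?qu)
        + ennreal (1 / R') * (\<integral>\<^sup>+ y. ennreal (norm y) \<partial>?qv)
      \<le> ennreal D * ennreal (1 / (4 * D)) + ennreal (1 / R') * ennreal m + ennreal (1 / R') * ennreal m"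
    proof (intro add_mono mult_left_mono)
      have "\<beta>c ^ n * norm w + r / (1 - \<beta>c) \<le> m" if "norm w \<le> R" for w :: 'a
        using mult_mono[of "\<beta>c ^ n" 1 "norm w" R] that \<beta>c by (simp add: m_def power_le_one)
      then show "(\<integral>\<^sup>+ y. ennreal (norm y) \<partial>?qu) \<le> ennreal m" "(\<integral>\<^sup>+ y. ennreal (norm y) \<partial>?qv) \<le> ennreal m"
        using mean[of n u] mean[of n v] u v by (meson ennreal_leI order_trans)+
    qed (use less in auto)
    also have "\<dots> = ennreal (1 / 2)"
      using D m by (simp add: R'_def flip: ennreal_mult ennreal_plus)
    finally have int_le: "(\<integral>\<^sup>+ z. ennreal (d_q q \<omega> \<eta> (fst z) (snd z)) \<partial>\<pi>) \<le> ennreal (1 / 2)" .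
    have int_ge: "ennreal (1 / 2) \<le> (\<integral>\<^sup>+ z. ennreal (1 / 2 + 1 / 2 - d_q q \<omega> \<eta> (fst z) (snd z)) \<partial>\<pi>)"
    proof -
      have d01: "0 \<le> d_q q \<omega> \<eta> (fst z) (snd z)" "d_q q \<omega> \<eta> (fst z) (snd z) \<le> 1" for z :: "'a \<times> 'a"
        using d_q_nonneg[OF \<omega>] d_q_le_1 by auto
      have [simp]: "measure \<pi> UNIV = 1" using \<pi>.prob_space by simp
      have int: "integrable \<pi> (\<lambda>z. d_q q \<omega> \<eta> (fst z) (snd z))"
        by (intro \<pi>.integrable_const_bound[where B=1] AE_I2) (simp_all add: d01)
      have "(\<integral>\<^sup>+ z. ennreal (d_q q \<omega> \<eta> (fst z) (snd z)) \<partial>\<pi>) = ennreal (integral\<^sup>L \<pi> (\<lambda>z. d_q q \<omega> \<eta> (fst z) (snd z)))"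
        by (rule nn_integral_eq_integral[OF int AE_I2]) (rule d01)
      with int_le have "ennreal (integral\<^sup>L \<pi> (\<lambda>z. d_q q \<omega> \<eta> (fst z) (snd z))) \<le> ennreal (1 / 2)" by (simp only:)
      then have "integral\<^sup>L \<pi> (\<lambda>z. d_q q \<omega> \<eta> (fst z) (snd z)) \<le> 1 / 2"
        by (subst (asm) ennreal_le_iff) auto
      then have "1 / 2 \<le> integral\<^sup>L \<pi> (\<lambda>z. 1 / 2 + 1 / 2 - d_q q \<omega> \<eta> (fst z) (snd z))"
        using int by simp
      then have "ennreal (1 / 2) \<le> ennreal (integral\<^sup>L \<pi> (\<lambda>z. 1 / 2 + 1 / 2 - d_q q \<omega> \<eta> (fst z) (snd z)))"
        by (rule ennreal_leI)
      also have "\<dots> = (\<integral>\<^sup>+ z. ennreal (1 / 2 + 1 / 2 - d_q q \<omega> \<eta> (fst z) (snd z)) \<partial>\<pi>)"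
        using int by (intro nn_integral_eq_integral[symmetric] AE_I2) (auto simp: d01)
      finally show ?thesis .
    qed
    have pp: "?pu \<in> space (prob_algebra borel)" "?pv \<in> space (prob_algebra borel)"
      by (auto intro!: kernel_pow_in_prob_algebra P)
    then have ps: "prob_space ?pu" "prob_space ?pv" "sets ?pu = sets borel" "sets ?pv = sets borel"
      by (auto simp: space_prob_algebra)
    have "transport_dist (d_q q \<omega> \<eta>) ?pu ?pv + (\<integral>\<^sup>+ z. ennreal (1 / 2 + 1 / 2 - d_q q \<omega> \<eta> (fst z) (snd z)) \<partial>scale_measure (ennreal \<epsilon>) \<pi>)
      \<le> (\<integral>\<^sup>+ y. ennreal (1 / 2) \<partial>?pu) + (\<integral>\<^sup>+ y. ennreal (1 / 2) \<partial>?pv)"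
    proof (rule transport_dist_add_subcoupling_le[OF ps])
      show "sets (scale_measure (ennreal \<epsilon>) \<pi>) = sets (borel \<Otimes>\<^sub>M borel)" by (simp add: s\<pi>)
      fix A :: "'a set" assume A [measurable]: "A \<in> sets borel"
      have "emeasure \<pi> (A \<times> UNIV) = emeasure ?qu A"
        unfolding m\<pi>[symmetric] by (subst emeasure_distr) (auto intro!: arg_cong[where f="emeasure \<pi>"])
      then show "emeasure (scale_measure (ennreal \<epsilon>) \<pi>) (A \<times> UNIV) \<le> emeasure ?pu A" using le[OF u A] by simp
      have "emeasure \<pi> (UNIV \<times> A) = emeasure ?qv A"
        unfolding m\<pi>[symmetric] by (subst emeasure_distr) (auto intro!: arg_cong[where f="emeasure \<pi>"])
      then show "emeasure (scale_measure (ennreal \<epsilon>) \<pi>) (UNIV \<times> A) \<le> emeasure ?pv A" using le[OF v A] by simp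
    qed (use d_q_nonneg[OF \<omega>] d_q_le_1 in auto)
    also have "(\<integral>\<^sup>+ y. ennreal (1 / 2) \<partial>?pu) + (\<integral>\<^sup>+ y. ennreal (1 / 2) \<partial>?pv) = ennreal (1 / 2) + ennreal (1 / 2)"
      using prob_space.emeasure_space_1[OF ps(1)] prob_space.emeasure_space_1[OF ps(2)] by simp
    also have "\<dots> = ennreal (1 / 2 + 1 / 2)" by (rule ennreal_plus[symmetric]) auto
    also have "\<dots> = ennreal (\<epsilon> / 2 + (1 - \<epsilon> / 2))" by simp
    also have "\<dots> = ennreal (\<epsilon> / 2) + ennreal (1 - \<epsilon> / 2)"
      using \<epsilon> by (intro ennreal_plus) auto
    finally have main: "transport_dist (d_q q \<omega> \<eta>) ?pu ?pv + (\<integral>\<^sup>+ z. ennreal (1 / 2 + 1 / 2 - d_q q \<omega> \<eta> (fst z) (snd z)) \<partial>scale_measure (ennreal \<epsilon>) \<pi>)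
      \<le> ennreal (\<epsilon> / 2) + ennreal (1 - \<epsilon> / 2)" .
    have "ennreal (\<epsilon> / 2) = ennreal (\<epsilon> * (1 / 2))" by simp
    also have "\<dots> = ennreal \<epsilon> * ennreal (1 / 2)" using \<epsilon> by (intro ennreal_mult) auto
    also have "\<dots> \<le> ennreal \<epsilon> * (\<integral>\<^sup>+ z. ennreal (1 / 2 + 1 / 2 - d_q q \<omega> \<eta> (fst z) (snd z)) \<partial>\<pi>)"
      by (intro mult_left_mono int_ge) simp
    also have "\<dots> = (\<integral>\<^sup>+ z. ennreal (1 / 2 + 1 / 2 - d_q q \<omega> \<eta> (fst z) (snd z)) \<partial>scale_measure (ennreal \<epsilon>) \<pi>)"
      by (rule nn_integral_scale_measure[symmetric]) measurable
    finally have "ennreal (\<epsilon> / 2) + transport_dist (d_q q \<omega> \<eta>) ?pu ?pv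
      \<le> transport_dist (d_q q \<omega> \<eta>) ?pu ?pv + (\<integral>\<^sup>+ z. ennreal (1 / 2 + 1 / 2 - d_q q \<omega> \<eta> (fst z) (snd z)) \<partial>scale_measure (ennreal \<epsilon>) \<pi>)"
      by (subst add.commute) (rule add_left_mono)
    also note main
    finally show ?thesis unfolding ennreal_add_left_cancel_le by simp
  qed
  then show ?thesis using n \<epsilon> by (intro exI[of _ n] conjI exI[of _ "\<epsilon> / 2"]) auto
qed

end

section \<open>Contraction of the weighted cost\<close>

lemma transport_dist_le_mult:
  assumes t: "0 < t" and c: "\<And>x y. c x y \<le> t * c' x y" and c': "\<And>x y. 0 \<le> c' x y"
    and [measurable]: "(\<lambda>z. c' (fst z) (snd z)) \<in> borel_measurable (borel \<Otimes>\<^sub>M borel)"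
  shows "transport_dist c \<mu> \<nu> \<le> ennreal t * transport_dist c' \<mu> \<nu>"
proof (rule le_mult_transport_dist[OF t])
  fix \<pi> assume \<pi>: "\<pi> \<in> couplings \<mu> \<nu>"
  have s\<pi> [measurable_cong]: "sets \<pi> = sets (borel \<Otimes>\<^sub>M borel)" using \<pi> by (simp add: couplings_def)
  have "transport_dist c \<mu> \<nu> \<le> (\<integral>\<^sup>+ z. ennreal (c (fst z) (snd z)) \<partial>\<pi>)"
    unfolding transport_dist_def by (rule INF_lower[OF \<pi>])
  also have "\<dots> \<le> (\<integral>\<^sup>+ z. ennreal t * ennreal (c' (fst z) (snd z)) \<partial>\<pi>)"
    using t c c' by (intro nn_integral_mono) (simp add: ennreal_leI flip: ennreal_mult)
  also have "\<dots> = ennreal t * (\<integral>\<^sup>+ z. ennreal (c' (fst z) (snd z)) \<partial>\<pi>)"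
    by (rule nn_integral_cmult) measurable
  finally show "transport_dist c \<mu> \<nu> \<le> ennreal t * (\<integral>\<^sup>+ z. ennreal (c' (fst z) (snd z)) \<partial>\<pi>)" .
qed

lemma norm_le_lyap:
  assumes "0 < a p" "\<And>j. j \<le> p \<Longrightarrow> 0 \<le> a j" "1 \<le> p"
  shows "norm u \<le> 1 + lyap a p u / a p"
proof -
  have "a p * norm u ^ p \<le> lyap a p u"
    unfolding lyap_def using assms by (intro member_le_sum[of p "{..p}" "\<lambda>j. a j * norm u ^ j"]) auto
  then have "norm u ^ p \<le> lyap a p u / a p" using assms by (simp add: pos_le_divide_eq mult.commute)
  moreover have "norm u \<le> 1 + norm u ^ p"
  proof (cases "norm u \<le> 1")
    case False
    then have "norm u ^ 1 \<le> norm u ^ p" using assms by (intro power_increasing) auto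
    then show ?thesis by simp
  qed (simp add: add_increasing2)
  ultimately show ?thesis by linarith
qed

lemma continuous_on_d_q_tilde:
  assumes "0 \<le> \<eta>"
  shows "continuous_on UNIV (\<lambda>z :: 'a::real_normed_vector \<times> 'a. d_q_tilde q (lyap a p) \<theta> \<omega> \<eta> (fst z) (snd z))"
  unfolding d_q_tilde_def
  by (intro continuous_intros continuous_on_d_q assms continuous_on_compose2[OF continuous_on_lyap]) auto

lemma d_q_tilde_nonneg:
  assumes "0 < \<omega>" "0 \<le> \<theta>" "\<And>j. j \<le> p \<Longrightarrow> 0 \<le> a j"
  shows "0 \<le> d_q_tilde q (lyap a p) \<theta> \<omega> \<eta> u v"
  unfolding d_q_tilde_def using assms lyap_nonneg[of p a]
  by (intro real_sqrt_ge_zero mult_nonneg_nonneg d_q_nonneg add_nonneg_nonneg) auto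

context rcar
begin

text \<open>A proposal in \<open>inner_ball u\<close> is accepted with probability bounded below and then reduces \<open>V\<close> by a fixed
fraction, up to the constant term of \<open>V\<close>. All other moves increase \<open>V\<close> only by the noise, that is by a small multiple
of \<open>V u\<close> plus a constant, because \<open>K\<close> does not increase the norm.\<close>

lemma drift:
  assumes a: "0 < a p" "\<And>j. j \<le> p \<Longrightarrow> 0 \<le> a j"
  shows "\<exists>l J. 0 < l \<and> l < 1 \<and> 0 < J \<and> (\<forall>u. (\<integral>\<^sup>+ y. ennreal (lyap a p y) \<partial>P u) \<le> ennreal (l * lyap a p u + J))"
proof -
  let ?V = "lyap a p :: 'a \<Rightarrow> real" and ?\<rho> = inner_ratio
  have V_nonneg: "0 \<le> ?V u" for u by (rule lyap_nonneg) (rule a(2))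
  obtain r where r: "0 < r" "0 < measure lam (cball 0 r)" using exists_noise_radius by blast
  obtain R1 M where R1: "0 < R1" and M: "0 < M" "M \<le> 1" and
    acc: "\<And>u z x. R1 < norm u \<Longrightarrow> z \<in> inner_ball u \<Longrightarrow> norm x \<le> r \<Longrightarrow> M \<le> acceptance Psi u (z + x)"
    using inner_ball_accept[OF r(1)] by blast
  define \<rho>' where "\<rho>' = (1 + ?\<rho>) / 2"
  have \<rho>': "0 < \<rho>'" "\<rho>' < 1" using inner_ratio by (auto simp: \<rho>'_def)
  define R where "R = max R1 (2 * r / (1 - ?\<rho>))"
  have R: "0 < R" "R1 \<le> R" "2 * r / (1 - ?\<rho>) \<le> R" using R1 by (auto simp: R_def less_max_iff_disj)
  have \<epsilon>1: "\<epsilon>0 \<le> 1" using K_ball(5)[of 0] prob_space.prob_le_1[OF prob_K[of 0]] by (meson order_trans)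
  define G where "G = measure lam (cball 0 r) * (M * (1 - \<rho>') * \<epsilon>0)"
  have G: "0 < G" "G \<le> 1"
  proof -
    show "0 < G" using r M \<rho>' K_ball by (simp add: G_def)
    have "M * (1 - \<rho>') * \<epsilon>0 \<le> 1 * 1 * 1" using M \<rho>' \<epsilon>1 K_ball by (intro mult_mono mult_nonneg_nonneg) auto
    then have "G \<le> 1 * 1" unfolding G_def using M \<rho>' K_ball
      by (intro mult_mono) auto
    then show "G \<le> 1" by simp
  qed
  obtain t where t: "0 < t" "(1 + t) ^ p \<le> 1 + G / 2"
  proof -
    have "((\<lambda>t. (1 + t) ^ p) \<longlongrightarrow> (1 + 0) ^ p) (at_right (0::real))" by (intro tendsto_intros)
    then have "eventually (\<lambda>t. (1 + t) ^ p < 1 + G / 2) (at_right (0::real))"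
      by (rule order_tendstoD) (use G in simp)
    then have "eventually (\<lambda>t. (1 + t) ^ p < 1 + G / 2 \<and> 0 < t) (at_right (0::real))"
      using eventually_at_right_less[of "0::real"] by eventually_elim simp
    then obtain t :: real where "(1 + t) ^ p < 1 + G / 2 \<and> 0 < t"
      using eventually_happens'[OF trivial_limit_at_right_real] by blast
    then show ?thesis by (intro that[of t]) auto
  qed
  define S where "S = (\<Sum>j\<le>p. a j) * (1 + 1 / t) ^ p"
  have S: "0 \<le> S" unfolding S_def using a t by (intro mult_nonneg_nonneg sum_nonneg) auto
  define C where "C x = (1 + 2 * norm x) ^ p" for x :: 'a
  have C1: "1 \<le> C x" for x unfolding C_def by (intro one_le_power) simp
  have V_add: "?V (z + x) \<le> (1 + G / 2) * ?V u + S * C x" if "norm z \<le> norm u" for z u x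
  proof -
    have "?V (z + x) \<le> (\<Sum>j\<le>p. a j * ((1 + t) ^ p * norm u ^ j + (1 + 1 / t) ^ p * (1 + 2 * norm x) ^ p))"
      unfolding lyap_def
    proof (intro sum_mono mult_left_mono)
      fix j assume j: "j \<in> {..p}"
      have "norm (z + x) ^ j \<le> (norm u + norm x) ^ j"
        using that norm_triangle_ineq[of z x] by (intro power_mono) auto
      also have "\<dots> \<le> (1 + t) ^ p * norm u ^ j + (1 + 1 / t) ^ p * (1 + 2 * norm x) ^ p"
        using j t by (intro power_add_le_split) auto
      finally show "norm (z + x) ^ j \<le> (1 + t) ^ p * norm u ^ j + (1 + 1 / t) ^ p * (1 + 2 * norm x) ^ p" .
    qed (use a in auto)
    also have "\<dots> = (1 + t) ^ p * ?V u + S * C x"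
      by (simp add: lyap_def S_def C_def distrib_left sum.distrib sum_distrib_left sum_distrib_right mult_ac)
    also have "\<dots> \<le> (1 + G / 2) * ?V u + S * C x" using t V_nonneg by (intro add_right_mono mult_right_mono) auto
    finally show ?thesis .
  qed
  have V_shrink: "?V y \<le> a 0 + \<rho>' * (?V u - a 0)" if "norm y \<le> \<rho>' * norm u" for y u
  proof -
    have "{..p} = insert 0 {1..p}" by auto
    then have dec: "?V w = a 0 + (\<Sum>j\<in>{1..p}. a j * norm w ^ j)" for w
      by (simp add: lyap_def)
    have "(\<Sum>j\<in>{1..p}. a j * norm y ^ j) \<le> (\<Sum>j\<in>{1..p}. \<rho>' * (a j * norm u ^ j))"
    proof (rule sum_mono)
      fix j assume j: "j \<in> {1..p}"
      have "norm y ^ j \<le> (\<rho>' * norm u) ^ j" using that by (intro power_mono) auto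
      also have "\<dots> = \<rho>' ^ j * norm u ^ j" by (rule power_mult_distrib)
      also have "\<dots> \<le> \<rho>' * norm u ^ j"
        using power_decreasing[of 1 j \<rho>'] j \<rho>' by (intro mult_right_mono) auto
      finally have "a j * norm y ^ j \<le> a j * (\<rho>' * norm u ^ j)" using a(2)[of j] j by (intro mult_left_mono) auto
      then show "a j * norm y ^ j \<le> \<rho>' * (a j * norm u ^ j)" by (simp add: mult_ac)
    qed
    then show ?thesis by (simp add: dec sum_distrib_left)
  qed
  have a0_le: "a 0 \<le> ?V u" for u
  proof -
    have "a 0 * norm u ^ 0 \<le> ?V u"
      unfolding lyap_def using a by (intro member_le_sum[of 0 "{..p}" "\<lambda>j. a j * norm u ^ j"]) auto
    then show ?thesis by simp
  qed
  define VR where "VR = (\<Sum>j\<le>p. a j * R ^ j)"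
  have VR: "?V u \<le> VR" if "norm u \<le> R" for u
    unfolding lyap_def VR_def using that a by (intro sum_mono mult_left_mono power_mono) auto
  have VR0: "0 \<le> VR" unfolding VR_def using a R by (intro sum_nonneg) auto
  define J where "J = S * B + G * (a 0 + VR) + 1"
  have J: "0 < J" using S B_ge_1 G a(2)[of 0] VR0 by (simp add: J_def add_nonneg_pos)
  have main: "(\<integral>\<^sup>+ y. ennreal (?V y) \<partial>P u) \<le> ennreal ((1 - G / 2) * ?V u + J)" for u
  proof -
    interpret Ku: prob_space "K u" by (rule prob_K)
    \<comment> \<open>The decrease of V on inner_ball u, claimed far from the origin only.\<close>
    define h where "h = (if R < norm u then M * (1 - \<rho>') * (?V u - a 0) else 0)"
    have h: "0 \<le> h" "h \<le> ?V u"
    proof -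
      show "0 \<le> h" using M \<rho>' a0_le[of u] by (simp add: h_def)
      have "M * (1 - \<rho>') * (?V u - a 0) \<le> 1 * 1 * ?V u"
        using M \<rho>' a0_le[of u] a(2)[of 0] by (intro mult_mono) auto
      then show "h \<le> ?V u" using V_nonneg[of u] by (simp add: h_def)
    qed
    define I :: "'a \<Rightarrow> real" where "I x = indicator (cball 0 r) x" for x
    have I01: "I x = 0 \<or> I x = 1" for x by (simp add: I_def indicator_def)
    define F where "F x z = acceptance Psi u (z + x) * ?V (z + x) + (1 - acceptance Psi u (z + x)) * ?V u" for x z
    define U where "U x = (1 + G / 2) * ?V u + S * C x" for x
    have VU: "?V u \<le> U x" for x
      using S C1[of x] G V_nonneg[of u] unfolding U_def by (simp add: algebra_simps add_nonneg_nonneg)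
    have F_le: "AE z in K u. \<forall>x. F x z \<le> U x - I x * h * indicator (inner_ball u) z"
      using K_norm[of u]
    proof eventually_elim
      case (elim z)
      show ?case
      proof
        fix x
        let ?\<alpha> = "acceptance Psi u (z + x)"
        have \<alpha>: "0 \<le> ?\<alpha>" "?\<alpha> \<le> 1" by (auto simp: acceptance_nonneg acceptance_le_1)
        show "F x z \<le> U x - I x * h * indicator (inner_ball u) z"
        proof (cases "norm x \<le> r \<and> z \<in> inner_ball u \<and> R < norm u")
          case True
          have "norm (z + x) \<le> \<rho>' * norm u"
          proof -
            have "2 * r \<le> R * (1 - ?\<rho>)" using R(3) inner_ratio by (simp add: pos_divide_le_eq)
            also have "\<dots> \<le> norm u * (1 - ?\<rho>)" using True inner_ratio by (intro mult_right_mono) auto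
            finally have "?\<rho> * norm u + r \<le> \<rho>' * norm u" by (simp add: \<rho>'_def algebra_simps)
            moreover have "norm (z + x) \<le> ?\<rho> * norm u + r"
              using norm_triangle_ineq[of z x] inner_ball_norm[of z u] True by linarith
            ultimately show ?thesis by simp
          qed
          then have "(1 - \<rho>') * (?V u - a 0) \<le> ?V u - ?V (z + x)"
            using V_shrink[of "z + x" u] by (simp add: algebra_simps)
          then have "M * ((1 - \<rho>') * (?V u - a 0)) \<le> ?\<alpha> * (?V u - ?V (z + x))"
            using acc[of u z x] True R M \<rho>' a0_le[of u] by (intro mult_mono) auto
          then have "F x z \<le> ?V u - h" using True by (simp add: F_def h_def algebra_simps)
          then show ?thesis using VU[of x] True by (simp add: I_def)
        next
          case False
          then have zero: "I x * h * indicator (inner_ball u) z = 0"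
            by (auto simp: I_def h_def indicator_def)
          have "F x z \<le> ?\<alpha> * U x + (1 - ?\<alpha>) * U x"
            unfolding F_def using V_add[OF elim, of x] VU[of x] \<alpha>
            by (intro add_mono mult_left_mono) (auto simp: U_def)
          also have "\<dots> = U x" by (simp add: algebra_simps)
          finally show ?thesis unfolding zero by simp
        qed
      qed
    qed
    have inner: "(\<integral>\<^sup>+ z. ennreal (F x z) \<partial>K u) \<le> ennreal (U x - I x * (h * \<epsilon>0))" for x
    proof -
      have "(\<integral>\<^sup>+ z. ennreal (F x z) \<partial>K u) \<le> (\<integral>\<^sup>+ z. ennreal (U x - I x * h * indicator (inner_ball u) z) \<partial>K u)"
        using F_le by (intro nn_integral_mono_AE) (auto intro: ennreal_leI)
      also have "\<dots> \<le> ennreal (U x - I x * (h * \<epsilon>0))"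
      proof (rule nn_integral_le_of_integrable)
        have ii: "integrable (K u) (indicat_real (inner_ball u))"
          by (intro Ku.integrable_const_bound[where B=1]) (auto simp: indicator_def)
        show "integrable (K u) (\<lambda>z. U x - I x * h * indicator (inner_ball u) z)"
          by (intro Bochner_Integration.integrable_diff integrable_mult_right ii) auto
        show "0 \<le> U x - I x * h * indicator (inner_ball u) z" for z
          using VU[of x] h I01[of x] V_nonneg[of u] by (auto simp: indicator_def)
        have [simp]: "measure (K u) UNIV = 1" using Ku.prob_space by simp
        have "integral\<^sup>L (K u) (\<lambda>z. U x - I x * h * indicator (inner_ball u) z) = U x - I x * h * measure (K u) (inner_ball u)"
          using ii by simp
        also have "\<dots> \<le> U x - I x * (h * \<epsilon>0)"
        proof -
          have "I x * h * \<epsilon>0 \<le> I x * h * measure (K u) (inner_ball u)"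
            using K_ball(5)[of u] h I01[of x] by (intro mult_left_mono) (auto simp: inner_ball_def)
          then show ?thesis by (simp add: mult.assoc)
        qed
        finally show "integral\<^sup>L (K u) (\<lambda>z. U x - I x * h * indicator (inner_ball u) z) \<le> U x - I x * (h * \<epsilon>0)" .
      qed
      finally show ?thesis .
    qed
    have "(\<integral>\<^sup>+ y. ennreal (?V y) \<partial>P u) = (\<integral>\<^sup>+ x. \<integral>\<^sup>+ z. ennreal (acceptance Psi u (z + x)) * ennreal (?V (z + x))
        + ennreal (1 - acceptance Psi u (z + x)) * ennreal (?V u) \<partial>K u \<partial>lam)"
      by (rule nn_integral_rcar_mh[OF Psi K lam]) measurable
    also have "\<dots> = (\<integral>\<^sup>+ x. \<integral>\<^sup>+ z. ennreal (F x z) \<partial>K u \<partial>lam)"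
      unfolding F_def
      by (intro nn_integral_cong) (simp add: ennreal_plus ennreal_mult V_nonneg acceptance_nonneg acceptance_le_1)
    also have "\<dots> \<le> (\<integral>\<^sup>+ x. ennreal (U x - I x * (h * \<epsilon>0)) \<partial>lam)"
      by (intro nn_integral_mono inner)
    also have "\<dots> \<le> ennreal ((1 - G / 2) * ?V u + J)"
    proof (rule nn_integral_le_of_integrable)
      have iC: "integrable lam C" unfolding C_def by (rule integrable_B)
      have iI: "integrable lam I"
        unfolding I_def by (intro lam.integrable_const_bound[where B=1]) (auto simp: indicator_def)
      have iU: "integrable lam U"
        unfolding U_def by (intro Bochner_Integration.integrable_add integrable_mult_right iC) auto
      show "integrable lam (\<lambda>x. U x - I x * (h * \<epsilon>0))"
        by (intro Bochner_Integration.integrable_diff integrable_mult_left iU iI)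
      show "0 \<le> U x - I x * (h * \<epsilon>0)" for x
      proof -
        have "h * \<epsilon>0 \<le> ?V u * 1" using h \<epsilon>1 K_ball V_nonneg[of u] by (intro mult_mono) auto
        then show ?thesis using VU[of x] V_nonneg[of u] I01[of x] by auto
      qed
      have "integral\<^sup>L lam C = B" unfolding C_def B_def ..
      moreover have "integral\<^sup>L lam I = measure lam (cball 0 r)" unfolding I_def by simp
      ultimately have "integral\<^sup>L lam (\<lambda>x. U x - I x * (h * \<epsilon>0))
          = (1 + G / 2) * ?V u + S * B - measure lam (cball 0 r) * (h * \<epsilon>0)"
        using iU iI iC by (simp add: U_def)
      also have "\<dots> \<le> (1 - G / 2) * ?V u + J"
      proof (cases "R < norm u")
        case True
        then have "measure lam (cball 0 r) * (h * \<epsilon>0) = G * (?V u - a 0)" by (simp add: h_def G_def)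
        moreover have "0 \<le> G * VR" using G VR0 by simp
        ultimately show ?thesis by (simp add: J_def algebra_simps)
      next
        case False
        then have "G * ?V u \<le> G * VR" using VR[of u] G by (intro mult_left_mono) auto
        moreover have "0 \<le> G * a 0" using G a(2)[of 0] by simp
        moreover have "h = 0" using False by (simp add: h_def)
        ultimately show ?thesis by (simp add: J_def algebra_simps)
      qed
      finally show "integral\<^sup>L lam (\<lambda>x. U x - I x * (h * \<epsilon>0)) \<le> (1 - G / 2) * ?V u + J" .
    qed
    finally show ?thesis .
  qed
  then show ?thesis using G J by (intro exI[of _ "1 - G / 2"] exI[of _ J]) auto
qed

lemma kernel_pow_Suc_return: "kernel_pow P (Suc n) (return borel x) = kernel_pow P n (P x)"
proof -
  have "kernel_pow P 1 (return borel x) = P x"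
    using bind_return[OF measurable_prob_algebraD[OF P], of x] by (simp add: kernel_pow_Suc)
  then show ?thesis using kernel_pow_add[of P n 1 "return borel x"] by simp
qed

lemma nn_integral_half:
  assumes "\<mu> \<in> space (prob_algebra borel)"
  shows "(\<integral>\<^sup>+ y. ennreal (1 / 2) \<partial>\<mu>) < \<infinity>"
proof -
  have "(\<integral>\<^sup>+ y. ennreal (1 / 2) \<partial>\<mu>) = ennreal (1 / 2)"
    using prob_space.emeasure_space_1[of \<mu>] assms by (simp add: space_prob_algebra)
  then show ?thesis by (metis ennreal_less_top infinity_ennreal_def)
qed

lemma transport_dist_d_q_pow_le:
  assumes \<eta>: "0 \<le> \<eta>" and \<omega>: "0 < \<omega>" and c: "0 < c"
    and step: "\<And>x y. transport_dist (d_q q \<omega> \<eta>) (P x) (P y) \<le> ennreal (c * d_q q \<omega> \<eta> x y)"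
    and \<mu>: "\<mu> \<in> space (prob_algebra borel)" and \<nu>: "\<nu> \<in> space (prob_algebra borel)"
  shows "transport_dist (d_q q \<omega> \<eta>) (kernel_pow P n \<mu>) (kernel_pow P n \<nu>) \<le> ennreal (c ^ n) * transport_dist (d_q q \<omega> \<eta>) \<mu> \<nu>"
proof (rule transport_dist_kernel_pow_le[OF P \<mu> \<nu> continuous_on_d_q[OF \<eta>], where f="\<lambda>_. 1 / 2"])
  show "(\<integral>\<^sup>+ y. ennreal (1 / 2) \<partial>P x) < \<infinity>" for x
    by (rule nn_integral_half[OF P_in_prob_algebra])
  show "(\<integral>\<^sup>+ y. ennreal (1 / 2) \<partial>kernel_pow P m \<mu>) < \<infinity>" "(\<integral>\<^sup>+ y. ennreal (1 / 2) \<partial>kernel_pow P m \<nu>) < \<infinity>" for m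
    by (rule nn_integral_half[OF kernel_pow_in_prob_algebra[OF P]], fact)+
qed (use c step in \<open>auto simp: d_q_le_1 d_q_nonneg[OF \<omega>]\<close>)

text \<open>The number of steps comes from the level set of \<open>V\<close> that \<open>weak_harris\<close> asks for; the contraction of a
single step persists for all later steps because one step never increases the cost.\<close>

lemma d_q_tilde_contraction_pos:
  assumes q0: "0 < q" and a: "0 < a p" "\<And>j. j \<le> p \<Longrightarrow> 0 \<le> a j"
  shows "\<exists>\<theta> \<omega> \<eta> n \<gamma>. 0 < \<theta> \<and> 0 < \<omega> \<and> 0 < \<eta> \<and> 1 \<le> n \<and> 0 < \<gamma> \<and> \<gamma> < 1 \<and>
    (\<forall>u v. transport_dist (d_q_tilde q (lyap a p) \<theta> \<omega> \<eta>) (kernel_pow P n (return borel u)) (kernel_pow P n (return borel v))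
      \<le> ennreal (\<gamma> * d_q_tilde q (lyap a p) \<theta> \<omega> \<eta> u v))"
proof -
  let ?V = "lyap a p :: 'a \<Rightarrow> real"
  have V_nonneg: "0 \<le> ?V u" for u by (rule lyap_nonneg) (rule a(2))
  obtain \<eta> \<omega> \<alpha> where \<eta>: "0 < \<eta>" "\<eta> \<le> 1" and \<omega>: "0 < \<omega>" "\<omega> \<le> 1" and \<alpha>: "0 \<le> \<alpha>" "\<alpha> < 1"
    and contr: "\<And>u v. d_q q \<omega> \<eta> u v < 1 \<Longrightarrow> transport_dist (d_q q \<omega> \<eta>) (P u) (P v) \<le> ennreal (\<alpha> * d_q q \<omega> \<eta> u v)"
    using contraction[OF q0] by blast
  let ?d = "d_q q \<omega> \<eta> :: 'a \<Rightarrow> 'a \<Rightarrow> real"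
  have d [measurable]: "(\<lambda>z. ?d (fst z) (snd z)) \<in> borel_measurable (borel \<Otimes>\<^sub>M borel)"
    using \<eta> by (intro borel_measurable_d_q) simp
  obtain l J where l: "0 < l" "l < 1" and J: "0 < J"
    and drift1: "\<And>u. (\<integral>\<^sup>+ y. ennreal (?V y) \<partial>P u) \<le> ennreal (l * ?V u + J)"
    using drift[of a, OF a] by blast
  define J' where "J' = J / (1 - l)"
  have J': "0 < J'" using J l by (simp add: J'_def)
  define C where "C = 4 * J' / (1 - l)"
  have C: "0 < C" using J' l by (simp add: C_def)
  define R where "R = 1 + C / a p"
  have R: "0 < R" using C a by (simp add: R_def add_pos_pos)
  obtain n s where n: "1 \<le> n" and s: "0 < s" "s \<le> 1"
    and small: "\<And>u v. norm u \<le> R \<Longrightarrow> norm v \<le> R \<Longrightarrow>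
      transport_dist ?d (kernel_pow P n (return borel u)) (kernel_pow P n (return borel v)) \<le> ennreal (1 - s)"
    using small_set[OF \<eta>(1) \<omega>(1) R] by blast
  obtain n' where n': "n = Suc n'" using n by (cases n) auto
  have nonexp: "transport_dist ?d (P x) (P y) \<le> ennreal (1 * ?d x y)" for x y
  proof (cases "?d x y < 1")
    case True
    have "\<alpha> * ?d x y \<le> 1 * ?d x y" using \<alpha> d_q_nonneg[OF \<omega>(1)] by (intro mult_right_mono) auto
    then show ?thesis using contr[OF True] by (meson ennreal_leI order_trans)
  next
    case False
    then have "?d x y = 1" using d_q_le_1[of q \<omega> \<eta> x y] by simp
    then show ?thesis
      using transport_dist_le_1[OF P_in_prob_algebra P_in_prob_algebra d d_q_nonneg[OF \<omega>(1)] d_q_le_1] by simp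
  qed
  have "\<exists>\<theta>>0. \<exists>\<gamma>\<in>{0<..<1}. \<forall>x y.
     transport_dist (\<lambda>x y. sqrt (?d x y * (2 + \<theta> * ?V x + \<theta> * ?V y))) (kernel_pow P n (return borel x)) (kernel_pow P n (return borel y))
       \<le> ennreal (\<gamma> * sqrt (?d x y * (2 + \<theta> * ?V x + \<theta> * ?V y)))"
  proof (rule weak_harris[where l=l and J=J' and \<alpha>=\<alpha> and s=s])
    show "(\<integral>\<^sup>+ y. ennreal (?V y) \<partial>kernel_pow P n (return borel x)) \<le> ennreal (l * ?V x + J')" for x
    proof -
      have "(\<integral>\<^sup>+ y. ennreal (?V y) \<partial>kernel_pow P n (return borel x)) \<le> ennreal (l ^ n * ?V x + J')"
        unfolding J'_def using l J V_nonneg by (intro kernel_pow_drift P drift1) auto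
      also have "\<dots> \<le> ennreal (l * ?V x + J')"
        using power_decreasing[of 1 n l] n l V_nonneg by (intro ennreal_leI add_right_mono mult_right_mono) auto
      finally show ?thesis .
    qed
    show "transport_dist ?d (kernel_pow P n (return borel x)) (kernel_pow P n (return borel y)) \<le> ennreal (\<alpha> * ?d x y)"
      if "?d x y < 1" for x y
    proof -
      have "transport_dist ?d (kernel_pow P n (return borel x)) (kernel_pow P n (return borel y)) \<le> ennreal (1 ^ n') * transport_dist ?d (P x) (P y)"
        unfolding n' kernel_pow_Suc_return using \<eta> \<omega>
        by (intro transport_dist_d_q_pow_le nonexp P_in_prob_algebra) auto
      also have "\<dots> \<le> ennreal (\<alpha> * ?d x y)" using contr[OF that] by simp
      finally show ?thesis .
    qed
    show "transport_dist ?d (kernel_pow P n (return borel x)) (kernel_pow P n (return borel y)) \<le> 1" for x y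
      by (intro transport_dist_le_1 kernel_pow_in_prob_algebra P return_in_prob_algebra d d_q_nonneg \<omega> d_q_le_1)
    show "transport_dist ?d (kernel_pow P n (return borel x)) (kernel_pow P n (return borel y)) \<le> ennreal (1 - s)"
      if "?V x + ?V y \<le> 4 * J' / (1 - l)" for x y
    proof (rule small)
      have "?V x \<le> C" "?V y \<le> C"
        using that V_nonneg[of x] V_nonneg[of y] unfolding C_def by linarith+
      then have "?V x / a p \<le> C / a p" "?V y / a p \<le> C / a p"
        using a by (auto intro!: divide_right_mono)
      then show "norm x \<le> R" "norm y \<le> R"
        using norm_le_lyap[of a p x] norm_le_lyap[of a p y] a p unfolding R_def by force+
    qed
  qed (use l J' \<alpha> s \<omega> V_nonneg d_q_le_1 in \<open>auto intro: d_q_nonneg\<close>)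
  then obtain \<theta> \<gamma> where "0 < \<theta>" "0 < \<gamma>" "\<gamma> < 1" "\<And>x y.
     transport_dist (\<lambda>x y. sqrt (?d x y * (2 + \<theta> * ?V x + \<theta> * ?V y))) (kernel_pow P n (return borel x)) (kernel_pow P n (return borel y))
       \<le> ennreal (\<gamma> * sqrt (?d x y * (2 + \<theta> * ?V x + \<theta> * ?V y)))" by auto
  then show ?thesis using \<omega> \<eta> n
    by (intro exI[of _ \<theta>] exI[of _ \<omega>] exI[of _ \<eta>] exI[of _ n] exI[of _ \<gamma>]) (auto simp: d_q_tilde_def[abs_def])
qed

text \<open>The instance with \<open>q = 1\<close> provides a cost \<open>D\<close> that contracts by \<open>\<gamma> ^ k\<close> in \<open>n * k\<close> steps and exceeds
the cost for \<open>q = 0\<close> at most by the factor \<open>sqrt (1 + \<eta> * s)\<close>, up to constants. Where \<open>1 + \<eta> * s\<close> is below \<open>1 / \<gamma> ^ k\<close>, this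
loss is paid by the contraction. Elsewhere \<open>V\<close> is at least of order \<open>1 / \<gamma> ^ k\<close>, so the constant
terms in the drift are negligible. There \<open>d_q\<close> for \<open>q = 0\<close> grows at most by the factor
\<open>(1 + C0 * \<omega>) ^ (n * k)\<close>, which is beaten by the drift after a suitable choice of \<open>\<omega>\<close>; since \<open>n\<close> and \<open>\<gamma>\<close> belong to \<open>D\<close>, they
are fixed before \<open>\<omega>\<close>.\<close>

lemma d_q_tilde_contraction_zero:
  assumes q0: "q = 0" and a: "0 < a p" "\<And>j. j \<le> p \<Longrightarrow> 0 \<le> a j"
  shows "\<exists>\<theta> \<omega> \<eta> n \<gamma>. 0 < \<theta> \<and> 0 < \<omega> \<and> 0 < \<eta> \<and> 1 \<le> n \<and> 0 < \<gamma> \<and> \<gamma> < 1 \<and>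
    (\<forall>u v. transport_dist (d_q_tilde q (lyap a p) \<theta> \<omega> \<eta>) (kernel_pow P n (return borel u)) (kernel_pow P n (return borel v))
      \<le> ennreal (\<gamma> * d_q_tilde q (lyap a p) \<theta> \<omega> \<eta> u v))"
proof -
  let ?V = "lyap a p :: 'a \<Rightarrow> real"
  have V_nonneg: "0 \<le> ?V u" for u by (rule lyap_nonneg) (rule a(2))
  interpret one: rcar Psi K lam 1 p L b0 \<beta>0 \<epsilon>0 \<beta>c coup
  proof
    fix u v :: 'a
    have "L * (1 + norm u + norm v) powr q * norm (u - v) \<le> L * (1 + norm u + norm v) powr 1 * norm (u - v)"
      using L by (intro mult_right_mono mult_left_mono powr_mono) (auto simp: q0)
    then show "\<bar>Psi u - Psi v\<bar> \<le> L * (1 + norm u + norm v) powr 1 * norm (u - v)"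
      using Lip[of u v] by linarith
  qed (fact Psi K lam L retract K_norm K_ball coup coup_norm \<beta>c coup_mean moment p | use p in simp)+
  obtain \<theta> \<omega>1 \<eta> n \<gamma> where \<theta>: "0 < \<theta>" and \<omega>1: "0 < \<omega>1" and \<eta>: "0 < \<eta>" and n: "1 \<le> n" and \<gamma>: "0 < \<gamma>" "\<gamma> < 1"
    and contr: "\<And>u v. transport_dist (d_q_tilde 1 ?V \<theta> \<omega>1 \<eta>) (kernel_pow P n (return borel u)) (kernel_pow P n (return borel v))
      \<le> ennreal (\<gamma> * d_q_tilde 1 ?V \<theta> \<omega>1 \<eta> u v)"
    using one.d_q_tilde_contraction_pos[of a, OF zero_less_one a] by blast
  obtain l J where l: "0 < l" "l < 1" and J: "0 < J"
    and drift1: "\<And>u. (\<integral>\<^sup>+ y. ennreal (?V y) \<partial>P u) \<le> ennreal (l * ?V u + J)"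
    using drift[of a, OF a] by blast
  define J' where "J' = J / (1 - l)"
  have J': "0 < J'" using J l by (simp add: J'_def)
  have drift_n: "(\<integral>\<^sup>+ y. ennreal (?V y) \<partial>kernel_pow P m (return borel x)) \<le> ennreal (l ^ m * ?V x + J')" for m x
    unfolding J'_def using l J V_nonneg by (intro kernel_pow_drift P drift1) auto
  define D where "D = (d_q_tilde 1 ?V \<theta> \<omega>1 \<eta> :: 'a \<Rightarrow> 'a \<Rightarrow> real)"
  have D_nonneg: "0 \<le> D u v" for u v
    unfolding D_def using \<theta> \<omega>1 a by (intro d_q_tilde_nonneg) auto
  have cont_D: "continuous_on UNIV (\<lambda>z. D (fst z) (snd z))"
    unfolding D_def using \<eta> by (intro continuous_on_d_q_tilde) simp
  have D_meas [measurable]: "(\<lambda>z. D (fst z) (snd z)) \<in> borel_measurable (borel \<Otimes>\<^sub>M borel)"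
    using borel_measurable_continuous_onI[OF cont_D] by (simp add: borel_prod)
  define f where "f x = 1 + \<theta> * ?V x" for x
  have f: "0 \<le> f x" for x using \<theta> V_nonneg by (simp add: f_def add_nonneg_nonneg)
  have cont_f: "continuous_on UNIV f" unfolding f_def by (intro continuous_intros continuous_on_lyap)
  have D_le: "D x y \<le> f x + f y" for x y
  proof -
    have W: "0 \<le> \<theta> * ?V x" "0 \<le> \<theta> * ?V y" using \<theta> V_nonneg by auto
    have "d_q 1 \<omega>1 \<eta> x y * (2 + \<theta> * ?V x + \<theta> * ?V y) \<le> 1 * (2 + \<theta> * ?V x + \<theta> * ?V y)"
      using W by (intro mult_right_mono d_q_le_1) auto
    also have "\<dots> \<le> (2 + \<theta> * ?V x + \<theta> * ?V y)\<^sup>2" using W by (simp add: power2_eq_square mult_le_cancel_right1)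
    finally have "D x y \<le> 2 + \<theta> * ?V x + \<theta> * ?V y"
      unfolding D_def d_q_tilde_def using W by (intro real_le_lsqrt) auto
    then show ?thesis by (simp add: f_def)
  qed
  have fin_f: "(\<integral>\<^sup>+ y. ennreal (f y) \<partial>kernel_pow P m (return borel x)) < \<infinity>" for m x
  proof -
    have pm: "kernel_pow P m (return borel x) \<in> space (prob_algebra borel)"
      by (intro kernel_pow_in_prob_algebra P) simp
    then have s [measurable_cong]: "sets (kernel_pow P m (return borel x)) = sets borel" and "prob_space (kernel_pow P m (return borel x))"
      by (auto simp: space_prob_algebra)
    interpret pm: prob_space "kernel_pow P m (return borel x)" by fact
    have "(\<integral>\<^sup>+ y. ennreal (f y) \<partial>kernel_pow P m (return borel x)) = (\<integral>\<^sup>+ y. 1 + ennreal \<theta> * ennreal (?V y) \<partial>kernel_pow P m (return borel x))"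
      unfolding f_def using \<theta> V_nonneg by (intro nn_integral_cong) (simp add: ennreal_plus ennreal_mult)
    also have "\<dots> = 1 + ennreal \<theta> * (\<integral>\<^sup>+ y. ennreal (?V y) \<partial>kernel_pow P m (return borel x))"
      by (simp add: nn_integral_add nn_integral_cmult pm.emeasure_space_1)
    also have "\<dots> < \<infinity>" using drift_n[of m x] by (auto simp: ennreal_add_less_top ennreal_mult_less_top intro: order.strict_trans1)
    finally show ?thesis .
  qed
  have iter: "transport_dist D (kernel_pow P (n * k) (return borel u)) (kernel_pow P (n * k) (return borel v)) \<le> ennreal (\<gamma> ^ k * D u v)" for k u v
  proof -
    let ?R = "\<lambda>x. kernel_pow P n (return borel x)"
    have pow: "kernel_pow ?R k (return borel x) = kernel_pow P (n * k) (return borel x)" for k x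
      by (rule kernel_pow_mult[OF P return_in_prob_algebra])
    have "transport_dist D (kernel_pow ?R k (return borel u)) (kernel_pow ?R k (return borel v)) \<le> ennreal (\<gamma> ^ k) * transport_dist D (return borel u) (return borel v)"
      using contr fin_f \<gamma> unfolding D_def[symmetric]
      by (intro transport_dist_kernel_pow_le[OF kernel_pow_return_measurable[OF P] _ _ cont_D cont_f D_nonneg D_le f]) (auto simp: pow)
    also have "\<dots> \<le> ennreal (\<gamma> ^ k) * ennreal (D u v)"
      by (intro mult_left_mono transport_dist_return_le D_meas) simp
    finally show ?thesis using \<gamma> D_nonneg by (simp add: pow ennreal_mult)
  qed
  define C0 where "C0 = B + 2 * L * B"
  have C0: "0 < C0" using B_ge_1 L by (simp add: C0_def add_pos_pos)
  define \<tau>0 where "\<tau>0 = max l \<gamma>"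
  have \<tau>0: "0 < \<tau>0" "\<tau>0 < 1" using l \<gamma> by (auto simp: \<tau>0_def less_max_iff_disj)
  define \<tau> where "\<tau> = (1 + \<tau>0) / 2"
  have \<tau>: "0 < \<tau>" "\<tau> < 1" "\<tau>0 < \<tau>" using \<tau>0 by (auto simp: \<tau>_def)
  obtain \<omega> where \<omega>: "0 < \<omega>" "\<omega> \<le> \<omega>1" "\<omega> \<le> 1" and \<omega>\<tau>: "(1 + C0 * \<omega>) ^ n * \<tau>0 \<le> \<tau>"
  proof -
    have "((\<lambda>\<omega>. (1 + C0 * \<omega>) ^ n * \<tau>0) \<longlongrightarrow> (1 + C0 * 0) ^ n * \<tau>0) (at_right 0)" by (intro tendsto_intros)
    then have "eventually (\<lambda>\<omega>. (1 + C0 * \<omega>) ^ n * \<tau>0 < \<tau>) (at_right 0)"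
      by (rule order_tendstoD) (use \<tau> in simp)
    moreover have "eventually (\<lambda>\<omega>. \<omega> \<in> {0<..<min 1 \<omega>1}) (at_right 0)"
      by (rule eventually_at_right_real) (use \<omega>1 in simp)
    ultimately have "eventually (\<lambda>\<omega>. (1 + C0 * \<omega>) ^ n * \<tau>0 < \<tau> \<and> \<omega> \<in> {0<..<min 1 \<omega>1}) (at_right 0)"
      by (rule eventually_conj)
    then obtain \<omega> where "(1 + C0 * \<omega>) ^ n * \<tau>0 < \<tau> \<and> \<omega> \<in> {0<..<min 1 \<omega>1}"
      using eventually_happens'[OF trivial_limit_at_right_real] by blast
    then show ?thesis by (intro that[of \<omega>]) auto
  qed
  \<comment> \<open>The factor by which one step may expand the unweighted cost.\<close>
  define c where "c = 1 + C0 * \<omega>"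
  have c: "1 \<le> c" using C0 \<omega> by (simp add: c_def)
  have c\<tau>: "c ^ (n * k) * l ^ (n * k) \<le> \<tau> ^ k" "c ^ (n * k) * \<gamma> ^ k \<le> \<tau> ^ k" for k
  proof -
    have le: "c ^ n * \<tau>0 \<le> \<tau>" using \<omega>\<tau> by (simp add: c_def)
    have "l ^ n \<le> l ^ 1" using n l by (intro power_decreasing) auto
    then have "c ^ n * l ^ n \<le> c ^ n * \<tau>0" using c by (intro mult_left_mono) (auto simp: \<tau>0_def)
    then have "c ^ n * l ^ n \<le> \<tau>" using le by (rule order_trans)
    then have "(c ^ n * l ^ n) ^ k \<le> \<tau> ^ k" using c l by (intro power_mono) auto
    then show "c ^ (n * k) * l ^ (n * k) \<le> \<tau> ^ k" by (simp add: power_mult_distrib power_mult)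
    have "c ^ n * \<gamma> \<le> c ^ n * \<tau>0" using c by (intro mult_left_mono) (auto simp: \<tau>0_def)
    then have "c ^ n * \<gamma> \<le> \<tau>" using le by (rule order_trans)
    then have "(c ^ n * \<gamma>) ^ k \<le> \<tau> ^ k" using c \<gamma> by (intro power_mono) auto
    then show "c ^ (n * k) * \<gamma> ^ k \<le> \<tau> ^ k" by (simp add: power_mult_distrib power_mult)
  qed
  define e where "e = (d_q 0 \<omega> \<eta> :: 'a \<Rightarrow> 'a \<Rightarrow> real)"
  have e_nonneg: "0 \<le> e u v" for u v unfolding e_def using \<omega> by (intro d_q_nonneg)
  have pos: "0 < 1 + t * norm x + t * norm y" if "0 < t" for t and x y :: 'a
    using that by (intro add_pos_nonneg) auto
  have e_alt: "e u v = min 1 (norm (u - v) / \<omega>)" for u v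
    using pos[OF \<eta>, of u v] by (simp add: e_def d_q_def)
  \<comment> \<open>For q = 0 the cost is the same for all \<eta>, and \<eta> = \<omega> makes both error terms of the one-step estimate small.\<close>
  have e_eq: "d_q q \<omega> \<omega> = e"
    using pos[OF \<omega>(1)] by (intro ext) (simp add: e_alt d_q_def q0 less_imp_neq[THEN not_sym])
  have e_pow: "transport_dist e (kernel_pow P m (return borel u)) (kernel_pow P m (return borel v)) \<le> ennreal (c ^ m * e u v)" for m u v
  proof -
    have "transport_dist (d_q q \<omega> \<omega>) (P x) (P y) \<le> ennreal (c * d_q q \<omega> \<omega> x y)" for x y
      using nearly_nonexpansive[OF \<omega>(1) \<omega>(3) \<omega>(1), of x y] \<omega> by (simp add: c_def C0_def q0 algebra_simps)
    then have "transport_dist (d_q q \<omega> \<omega>) (kernel_pow P m (return borel u)) (kernel_pow P m (return borel v))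
        \<le> ennreal (c ^ m) * transport_dist (d_q q \<omega> \<omega>) (return borel u) (return borel v)"
      using \<omega> c by (intro transport_dist_d_q_pow_le) auto
    also have "\<dots> \<le> ennreal (c ^ m) * ennreal (d_q q \<omega> \<omega> u v)"
      using \<omega> by (intro mult_left_mono transport_dist_return_le borel_measurable_d_q) auto
    finally show ?thesis using c e_nonneg by (simp add: e_eq ennreal_mult)
  qed
  define E where "E = (2 + 2 * \<theta> * J') * ((1 + 2 * \<eta>) + \<eta> / (a p * \<theta>))"
  have E: "0 \<le> E" using \<theta> J' \<eta> a by (simp add: E_def)
  obtain k where k: "1 \<le> k" "(E + 1) * \<tau> ^ k \<le> 1 / 4" "\<omega>1 / \<omega> * \<gamma> ^ k \<le> 1 / 4"
  proof -
    have "(\<lambda>k. (E + 1) * \<tau> ^ k) \<longlonglongrightarrow> (E + 1) * 0"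
      using \<tau> by (intro tendsto_intros LIMSEQ_power_zero) auto
    then have 1: "eventually (\<lambda>k. (E + 1) * \<tau> ^ k < 1 / 4) sequentially" by (rule order_tendstoD) simp
    have "(\<lambda>k. \<omega>1 / \<omega> * \<gamma> ^ k) \<longlonglongrightarrow> \<omega>1 / \<omega> * 0"
      using \<gamma> by (intro tendsto_intros LIMSEQ_power_zero) auto
    then have 2: "eventually (\<lambda>k. \<omega>1 / \<omega> * \<gamma> ^ k < 1 / 4) sequentially" by (rule order_tendstoD) simp
    obtain k where "(E + 1) * \<tau> ^ k < 1 / 4 \<and> \<omega>1 / \<omega> * \<gamma> ^ k < 1 / 4 \<and> 1 \<le> k"
      using eventually_happens'[OF sequentially_bot eventually_conj[OF 1 eventually_conj[OF 2 eventually_ge_at_top[of 1]]]] by blast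
    then show ?thesis by (intro that[of k]) auto
  qed
  define N where "N = n * k"
  have N: "1 \<le> N" using n k by (simp add: N_def)
  let ?G = "d_q_tilde q ?V \<theta> \<omega> \<eta> :: 'a \<Rightarrow> 'a \<Rightarrow> real"
  have G_eq: "?G u v = sqrt (e u v * (2 + \<theta> * ?V u + \<theta> * ?V v))" for u v
    by (simp add: d_q_tilde_def q0 e_def)
  have "transport_dist ?G (kernel_pow P N (return borel u)) (kernel_pow P N (return borel v)) \<le> ennreal (1 / 2 * ?G u v)" for u v
  proof -
    define s where "s = norm u + norm v"
    define W where "W = 2 + \<theta> * ?V u + \<theta> * ?V v"
    have W: "2 \<le> W" using \<theta> V_nonneg by (simp add: W_def add_nonneg_nonneg)
    show ?thesis
    proof (cases "(1 + \<eta> * s) * \<gamma> ^ k \<le> 1")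
      case True
      \<comment> \<open>Applied to the laws after N steps: dropping the weight costs only a constant.\<close>
      have GD: "?G x y \<le> sqrt (\<omega>1 / \<omega>) * D x y" for x y
      proof -
        have "e x y \<le> \<omega>1 / \<omega> * d_q 1 \<omega>1 \<eta> x y"
        proof -
          have "norm (x - y) \<le> (1 + \<eta> * norm x + \<eta> * norm y) * norm (x - y)"
            using \<eta> mult_right_mono[of 1 "1 + \<eta> * norm x + \<eta> * norm y" "norm (x - y)"] by simp
          then have "norm (x - y) / \<omega> \<le> (1 + \<eta> * norm x + \<eta> * norm y) * norm (x - y) / \<omega>"
            using \<omega> by (intro divide_right_mono) auto
          moreover have "1 \<le> \<omega>1 / \<omega>" using \<omega> by simp
          moreover have "\<omega>1 / \<omega> * min 1 ((1 + \<eta> * norm x + \<eta> * norm y) * norm (x - y) / \<omega>1)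
              = min (\<omega>1 / \<omega>) ((1 + \<eta> * norm x + \<eta> * norm y) * norm (x - y) / \<omega>)"
            using \<omega> \<omega>1 by (subst min_mult_distrib_left) auto
          ultimately show ?thesis
            unfolding e_alt d_q_def using pos[OF \<eta>, of x y] by (simp add: min_le_iff_disj)
        qed
        then have "e x y * (2 + \<theta> * ?V x + \<theta> * ?V y) \<le> \<omega>1 / \<omega> * d_q 1 \<omega>1 \<eta> x y * (2 + \<theta> * ?V x + \<theta> * ?V y)"
          using \<theta> V_nonneg by (intro mult_right_mono) (auto simp: add_nonneg_nonneg)
        then show ?thesis
          unfolding G_eq unfolding D_def d_q_tilde_def by (simp add: real_sqrt_mult[symmetric] mult.assoc)
      qed
      \<comment> \<open>Applied to the starting points: here the weight enters.\<close>
      have De: "D u v \<le> sqrt (1 + \<eta> * s) * ?G u v"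
      proof -
        have s1: "1 \<le> 1 + \<eta> * s" using \<eta> by (simp add: s_def)
        have "norm (u - v) / \<omega>1 \<le> norm (u - v) / \<omega>" using \<omega> \<omega>1 by (intro divide_left_mono) auto
        then have "(1 + \<eta> * s) * (norm (u - v) / \<omega>1) \<le> (1 + \<eta> * s) * (norm (u - v) / \<omega>)" using s1 by (intro mult_left_mono) auto
        then have "d_q 1 \<omega>1 \<eta> u v \<le> (1 + \<eta> * s) * e u v"
          unfolding e_alt d_q_def using pos[OF \<eta>, of u v] s1
          by (subst min_mult_distrib_left) (auto simp: s_def distrib_left add.assoc min_le_iff_disj)
        then have "d_q 1 \<omega>1 \<eta> u v * W \<le> (1 + \<eta> * s) * e u v * W" using W by (intro mult_right_mono) auto
        then show ?thesis
          unfolding G_eq unfolding D_def d_q_tilde_def W_def[symmetric] by (simp add: real_sqrt_mult[symmetric] mult.assoc)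
      qed
      have "transport_dist ?G (kernel_pow P N (return borel u)) (kernel_pow P N (return borel v))
        \<le> ennreal (sqrt (\<omega>1 / \<omega>)) * transport_dist D (kernel_pow P N (return borel u)) (kernel_pow P N (return borel v))"
        using \<omega> \<omega>1 by (intro transport_dist_le_mult GD D_nonneg D_meas) auto
      also have "\<dots> \<le> ennreal (sqrt (\<omega>1 / \<omega>)) * ennreal (\<gamma> ^ k * D u v)"
        unfolding N_def by (intro mult_left_mono iter) simp
      also have "\<dots> = ennreal (sqrt (\<omega>1 / \<omega>) * (\<gamma> ^ k * D u v))"
        using \<omega> \<omega>1 \<gamma> D_nonneg by (intro ennreal_mult[symmetric]) auto
      also have "\<dots> \<le> ennreal (1 / 2 * ?G u v)"
      proof (rule ennreal_leI)
        have g0: "0 \<le> ?G u v" unfolding G_eq using e_nonneg W by (simp add: W_def[symmetric])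
        have "\<gamma> ^ k * D u v \<le> \<gamma> ^ k * (sqrt (1 + \<eta> * s) * ?G u v)" using \<gamma> De by (intro mult_left_mono) auto
        also have "\<gamma> ^ k * (sqrt (1 + \<eta> * s) * ?G u v) = sqrt (\<gamma> ^ k) * sqrt ((1 + \<eta> * s) * \<gamma> ^ k) * ?G u v"
          using \<gamma> by (simp add: real_sqrt_mult)
        also have "\<dots> \<le> sqrt (\<gamma> ^ k) * 1 * ?G u v"
          using True g0 \<gamma> by (intro mult_right_mono mult_left_mono) auto
        finally have "sqrt (\<omega>1 / \<omega>) * (\<gamma> ^ k * D u v) \<le> sqrt (\<omega>1 / \<omega>) * (sqrt (\<gamma> ^ k) * 1 * ?G u v)"
          using \<omega> \<omega>1 by (intro mult_left_mono) auto
        also have "\<dots> = sqrt (\<omega>1 / \<omega> * \<gamma> ^ k) * ?G u v"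
          by (simp only: real_sqrt_mult mult_1_right mult.assoc)
        also have "\<dots> \<le> sqrt (1 / 4) * ?G u v" using k g0 by (intro mult_right_mono real_sqrt_le_mono)
        also have "sqrt (1 / 4) = (1 / 2 :: real)" by (simp add: real_sqrt_divide)
        finally show "sqrt (\<omega>1 / \<omega>) * (\<gamma> ^ k * D u v) \<le> 1 / 2 * ?G u v" .
      qed
      finally show ?thesis .
    next
      case False
      have hs: "0 \<le> 1 + \<eta> * s" using \<eta> by (simp add: s_def)
      have W_s: "1 + \<eta> * s \<le> ((1 + 2 * \<eta>) + \<eta> / (a p * \<theta>)) * W"
      proof -
        have "s \<le> 2 + (?V u + ?V v) / a p"
          using norm_le_lyap[of a p u, OF a p] norm_le_lyap[of a p v, OF a p] by (simp add: s_def add_divide_distrib)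
        then have "\<eta> * s \<le> \<eta> * (2 + (?V u + ?V v) / a p)" using \<eta> by (intro mult_left_mono) auto
        also have "\<dots> = 2 * \<eta> + \<eta> / (a p * \<theta>) * (\<theta> * ?V u + \<theta> * ?V v)"
          using \<theta> a by (simp add: field_simps)
        also have "\<dots> \<le> 2 * \<eta> + \<eta> / (a p * \<theta>) * W"
          using \<eta> \<theta> a by (intro add_left_mono mult_left_mono) (auto simp: W_def)
        finally have "1 + \<eta> * s \<le> (1 + 2 * \<eta>) * 1 + \<eta> / (a p * \<theta>) * W" by simp
        also have "\<dots> \<le> (1 + 2 * \<eta>) * W + \<eta> / (a p * \<theta>) * W"
          using W \<eta> by (intro add_right_mono mult_left_mono) auto
        finally show ?thesis by (simp add: distrib_right)
      qed
      have "transport_dist ?G (kernel_pow P N (return borel u)) (kernel_pow P N (return borel v))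
         \<le> ennreal (sqrt (c ^ N * e u v * (2 + \<theta> * (l ^ N * ?V u + J') + \<theta> * (l ^ N * ?V v + J'))))"
        unfolding d_q_tilde_def[abs_def] q0 e_def[symmetric]
      proof (rule transport_dist_sqrt_le)
        show "(\<lambda>z. e (fst z) (snd z)) \<in> borel_measurable (borel \<Otimes>\<^sub>M borel)"
          unfolding e_def using \<eta> by (intro borel_measurable_d_q) simp
        show "0 \<le> l ^ N * ?V u + J'" "0 \<le> l ^ N * ?V v + J'" using l V_nonneg J' by (simp_all add: add_nonneg_nonneg)
      qed (use e_nonneg V_nonneg \<theta> c e_pow drift_n in auto)
      also have "\<dots> \<le> ennreal (1 / 2 * ?G u v)"
      proof (rule ennreal_leI)
        have cN: "0 \<le> c ^ N" using c by simp
        have "c ^ N * (2 + 2 * \<theta> * J') \<le> c ^ N * (2 + 2 * \<theta> * J') * ((1 + \<eta> * s) * \<gamma> ^ k)"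
          using False c \<theta> J' mult_left_mono[of 1 "(1 + \<eta> * s) * \<gamma> ^ k" "c ^ N * (2 + 2 * \<theta> * J')"] by simp
        also have "\<dots> = (c ^ N * \<gamma> ^ k) * ((2 + 2 * \<theta> * J') * (1 + \<eta> * s))" by (simp add: mult_ac)
        also have "\<dots> \<le> \<tau> ^ k * ((2 + 2 * \<theta> * J') * (((1 + 2 * \<eta>) + \<eta> / (a p * \<theta>)) * W))"
        proof (intro mult_mono mult_left_mono W_s)
          show "c ^ N * \<gamma> ^ k \<le> \<tau> ^ k" unfolding N_def by (rule c\<tau>)
          show "0 \<le> (2 + 2 * \<theta> * J') * (1 + \<eta> * s)" using \<theta> J' \<eta> by (simp add: s_def)
        qed (use \<theta> J' \<tau> hs in auto)
        also have "\<dots> = E * \<tau> ^ k * W" by (simp add: E_def mult_ac)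
        finally have 1: "c ^ N * (2 + 2 * \<theta> * J') \<le> E * \<tau> ^ k * W" .
        have "c ^ N * l ^ N * (\<theta> * ?V u + \<theta> * ?V v) \<le> \<tau> ^ k * W"
          using c\<tau>(1)[of k] \<theta> V_nonneg \<tau> by (intro mult_mono) (auto simp: N_def W_def add_nonneg_nonneg)
        with 1 have "c ^ N * (2 + \<theta> * (l ^ N * ?V u + J') + \<theta> * (l ^ N * ?V v + J')) \<le> (E + 1) * \<tau> ^ k * W"
          by (simp add: algebra_simps)
        also have "\<dots> \<le> 1 / 4 * W" using k W by (intro mult_right_mono) auto
        finally have "c ^ N * (2 + \<theta> * (l ^ N * ?V u + J') + \<theta> * (l ^ N * ?V v + J')) * e u v \<le> 1 / 4 * W * e u v"
          using e_nonneg by (intro mult_right_mono) auto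
        then have "sqrt (c ^ N * e u v * (2 + \<theta> * (l ^ N * ?V u + J') + \<theta> * (l ^ N * ?V v + J'))) \<le> sqrt (1 / 4 * (e u v * W))"
          by (intro real_sqrt_le_mono) (simp add: mult_ac)
        also have "\<dots> = 1 / 2 * ?G u v"
          unfolding G_eq W_def[symmetric] by (simp add: real_sqrt_mult real_sqrt_divide)
        finally show "sqrt (c ^ N * e u v * (2 + \<theta> * (l ^ N * ?V u + J') + \<theta> * (l ^ N * ?V v + J'))) \<le> 1 / 2 * ?G u v" .
      qed
      finally show ?thesis .
    qed
  qed
  then show ?thesis using \<theta> \<omega> \<eta> N
    by (intro exI[of _ \<theta>] exI[of _ \<omega>] exI[of _ \<eta>] exI[of _ N] exI[of _ "1 / 2"]) auto
qed

end

text \<open>The supremum condition on the coupling is turned into its pairwise form and the local Lipschitz bound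
into its weighted form; the two cases for \<open>q\<close> then apply.\<close>

theorem theorem2:
  fixes Psi :: "'a::{banach, second_countable_topology} \<Rightarrow> real"
    and K :: "'a \<Rightarrow> 'a measure"
    and lam :: "'a measure"
    and q :: real
    and p :: nat
    and a :: "nat \<Rightarrow> real"
  assumes Psi_meas: "Psi \<in> borel_measurable borel"
    and K_kernel: "K \<in> borel \<rightarrow>\<^sub>M prob_algebra borel"
    and lam_radon: "radon_prob_measure lam"
    and q: "q \<ge> 0"
    and A1a: "\<forall>R>0. \<exists>M1\<ge>0. \<forall>u\<in>cball 0 R. Psi u \<le> M1"
    and A1b: "\<exists>M2\<ge>0. \<exists>M3\<ge>0. \<forall>u. Psi u \<ge> M3 - M2 * ln (1 + rpow (norm u) q)"
    and A1c: "\<forall>\<beta>\<in>{0<..<1}. \<forall>b\<in>{0<..<1}. \<exists>R0>0. \<exists>M4>0. \<forall>u. norm u > R0 \<longrightarrow>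
        (INF v\<in>cball (\<beta> *\<^sub>R u) (b * (1 - \<beta>) * norm u). exp (Psi u - Psi v)) \<ge> M4"
    and A1d: "\<exists>L>0. \<forall>u v. \<bar>Psi u - Psi v\<bar>
        \<le> L * max 1 (max (rpow (norm u) q) (rpow (norm v) q)) * norm (u - v)"
    and A2a: "\<forall>u. u \<noteq> 0 \<longrightarrow> (AE z in K u. norm z < norm u)" "AE z in K 0. z = 0"
    and A2b: "\<exists>b0 \<beta>0 \<epsilon>0. 0 < b0 \<and> b0 < \<beta>0 \<and> \<beta>0 < 1 \<and> \<epsilon>0 > 0 \<and>
        (\<forall>u. measure (K u) {z. norm (z - \<beta>0 *\<^sub>R u) \<le> b0 * (1 - \<beta>0) * norm u} \<ge> \<epsilon>0)"
    and A2c: "\<exists>\<kappa>. (\<forall>u v. \<kappa> u v \<in> couplings (K u) (K v) \<and>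
          (u \<noteq> v \<longrightarrow> (AE z in \<kappa> u v. norm (fst z - snd z) < norm (u - v))) \<and>
          (u = v \<longrightarrow> (AE z in \<kappa> u v. fst z = snd z))) \<and>
        (\<exists>\<beta>c\<in>{0<..<1}. (SUP (u, v)\<in>{(u, v). u \<noteq> v}.
          (\<integral>\<^sup>+ z. ennreal (norm (fst z - snd z)) \<partial>\<kappa> u v) / ennreal (norm (u - v))) \<le> ennreal \<beta>c)"
    and p: "p \<ge> 1" "int p \<ge> \<lceil>q\<rceil>"
    and lam_moment: "integrable lam (\<lambda>x. norm x ^ p)"
    and a: "a p > 0" "\<forall>j<p. a j \<ge> 0"
  shows "\<exists>(\<theta>::real) (\<omega>::real) (\<eta>::real) (n::nat) (\<gamma>::real).
      \<theta> > 0 \<and> \<omega> > 0 \<and> \<eta> > 0 \<and> n \<ge> 1 \<and> 0 < \<gamma> \<and> \<gamma> < 1 \<and>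
      (\<forall>u v. transport_dist (d_q_tilde q (lyap a p) \<theta> \<omega> \<eta>)
           (kernel_pow (rcar_mh Psi K lam) n (return borel u))
           (kernel_pow (rcar_mh Psi K lam) n (return borel v))
         \<le> ennreal (\<gamma> * d_q_tilde q (lyap a p) \<theta> \<omega> \<eta> u v))"
proof -
  have lam: "prob_space lam" "sets lam = sets borel"
    using lam_radon by (auto simp: radon_prob_measure_def)
  have qp: "q \<le> real p"
  proof -
    have "q \<le> of_int \<lceil>q\<rceil>" by (rule le_of_int_ceiling)
    also have "\<dots> \<le> real p" using p(2) by linarith
    finally show ?thesis .
  qed
  obtain L where L: "0 < L" and L_le: "\<And>u v. \<bar>Psi u - Psi v\<bar>
        \<le> L * max 1 (max (rpow (norm u) q) (rpow (norm v) q)) * norm (u - v)"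
    using A1d by blast
  have Lip: "\<bar>Psi u - Psi v\<bar> \<le> L * (1 + norm u + norm v) powr q * norm (u - v)" for u v
  proof -
    have "max 1 (max (rpow (norm u) q) (rpow (norm v) q)) \<le> (1 + norm u + norm v) powr q"
    proof (cases "q = 0")
      case True
      have "1 + norm u + norm v \<noteq> 0" using norm_ge_zero[of u] norm_ge_zero[of v] by linarith
      then show ?thesis using True by (simp add: rpow_def)
    next
      case False
      then show ?thesis using q by (auto simp: rpow_def intro!: powr_mono2 ge_one_powr_ge_zero)
    qed
    then have "L * max 1 (max (rpow (norm u) q) (rpow (norm v) q)) * norm (u - v)
        \<le> L * (1 + norm u + norm v) powr q * norm (u - v)"
      using L by (intro mult_right_mono mult_left_mono) auto
    then show ?thesis using L_le[of u v] by linarith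
  qed
  have K_norm: "AE z in K u. norm z \<le> norm u" for u
  proof (cases "u = 0")
    case True
    show ?thesis using A2a(2) unfolding True by eventually_elim simp
  next
    case False
    then have "AE z in K u. norm z < norm u" using A2a(1) by blast
    then show ?thesis by eventually_elim simp
  qed
  obtain b0 \<beta>0 \<epsilon>0 where ball: "0 < b0" "b0 < \<beta>0" "\<beta>0 < 1" "0 < \<epsilon>0"
    "\<And>u. \<epsilon>0 \<le> measure (K u) {z. norm (z - \<beta>0 *\<^sub>R u) \<le> b0 * (1 - \<beta>0) * norm u}"
    using A2b by blast
  obtain \<kappa> where \<kappa>: "\<And>u v. \<kappa> u v \<in> couplings (K u) (K v)"
    and lt: "\<And>u v. u \<noteq> v \<Longrightarrow> AE z in \<kappa> u v. norm (fst z - snd z) < norm (u - v)"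
    and eq: "\<And>u v. u = v \<Longrightarrow> AE z in \<kappa> u v. fst z = snd z"
    and "\<exists>\<beta>c\<in>{0<..<1}. (SUP (u, v)\<in>{(u, v). u \<noteq> v}.
          (\<integral>\<^sup>+ z. ennreal (norm (fst z - snd z)) \<partial>\<kappa> u v) / ennreal (norm (u - v))) \<le> ennreal \<beta>c"
    using A2c by blast
  then obtain \<beta>c where \<beta>c: "0 < \<beta>c" "\<beta>c < 1" and sup: "(SUP (u, v)\<in>{(u, v). u \<noteq> v}.
          (\<integral>\<^sup>+ z. ennreal (norm (fst z - snd z)) \<partial>\<kappa> u v) / ennreal (norm (u - v))) \<le> ennreal \<beta>c"
    by auto
  have \<kappa>_norm: "AE z in \<kappa> u v. norm (fst z - snd z) \<le> norm (u - v)" for u v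
  proof (cases "u = v")
    case True
    show ?thesis using eq[OF True] by eventually_elim simp
  next
    case False
    show ?thesis using lt[OF False] by eventually_elim simp
  qed
  have \<kappa>_mean: "(\<integral>\<^sup>+ z. ennreal (norm (fst z - snd z)) \<partial>\<kappa> u v) \<le> ennreal (\<beta>c * norm (u - v))" for u v
  proof (cases "u = v")
    case True
    have "(\<integral>\<^sup>+ z. ennreal (norm (fst z - snd z)) \<partial>\<kappa> u v) = (\<integral>\<^sup>+ z. 0 \<partial>\<kappa> u v)"
      using eq[OF True] by (intro nn_integral_cong_AE) (auto elim: eventually_mono)
    then show ?thesis by simp
  next
    case False
    let ?I = "\<integral>\<^sup>+ z. ennreal (norm (fst z - snd z)) \<partial>\<kappa> u v"
    have "?I / ennreal (norm (u - v)) \<le> ennreal \<beta>c"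
      using sup False by (auto simp: SUP_le_iff)
    then have "ennreal (norm (u - v)) * (?I / ennreal (norm (u - v))) \<le> ennreal (norm (u - v)) * ennreal \<beta>c"
      by (rule mult_left_mono) simp
    moreover have "ennreal (norm (u - v)) * (?I / ennreal (norm (u - v))) = ?I"
      using False by (simp add: ennreal_times_divide mult.commute[of "ennreal (norm (u - v))"] ennreal_mult_divide_eq)
    ultimately show ?thesis using \<beta>c by (simp add: ennreal_mult mult.commute)
  qed
  interpret rcar Psi K lam q p L b0 \<beta>0 \<epsilon>0 \<beta>c \<kappa>
  proof (rule rcar.intro)
    show "\<exists>R0>0. \<exists>M4>0. \<forall>u. norm u > R0 \<longrightarrow>
        (INF v\<in>cball (\<beta> *\<^sub>R u) (b * (1 - \<beta>) * norm u). exp (Psi u - Psi v)) \<ge> M4"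
      if "0 < \<beta>" "\<beta> < 1" "0 < b" "b < 1" for \<beta> b
      using A1c that by simp
  qed (fact Psi_meas K_kernel lam q qp p(1) L Lip K_norm ball \<kappa> \<kappa>_norm \<beta>c \<kappa>_mean lam_moment)+
  have a': "0 \<le> a j" if "j \<le> p" for j
    using a that by (cases "j = p") auto
  show ?thesis
  proof (cases "q = 0")
    case True
    show ?thesis using d_q_tilde_contraction_zero[of a, OF True a(1) a'] by blast
  next
    case False
    then have "0 < q" using q by simp
    from d_q_tilde_contraction_pos[of a, OF this a(1) a'] show ?thesis by blast
  qed
qed

end
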